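(* Let $\Phi\colon\mathbb{R}\to\mathbb{R}$ be a convex function, let $a,b>0$, and let $U\colon\mathbb{R}\to(-\infty,0]$ be given by $U(x)=-ax$ for $x\ge 0$ and $U(x)=bx$ for $x<0$. Let $V\colon\mathbb{R}\times[0,+\infty)\to\mathbb{R}$ be defined by $$V(x,t)=\sup_{p\in\mathbb{R}}\{V(x,t;p,a,b)-\Phi^*(p)\},$$ where $V(x,t;p,a,b)$ is the explicit function given in the context and $\Phi^*$ is the Legendre-Fenchel transform of $\Phi$. Consider the Hamilton-Jacobi PDE $$\frac{\partial V}{\partial t}(x,t)+\frac12(\nabla_xV(x,t))^2+U(x)=0\ \ (x\in\mathbb{R},\ t\in(0,+\infty)),\qquad V(x,0)=\Phi(x)\ \ (x\in\mathbb{R}).\tag{HJ}$$ Then: (a) The function $V$ is a continuously differentiable solution to (HJ). (b) If there are constants $C\ge0$, $\delta\ge0$ such that $|\Phi(x)-\Phi(y)|\le C|x-y|(1+|x|^\delta+|y|^\delta)$ for all $x,y\in\mathbb{R}$, then $V$ is the unique viscosity solution to (HJ) in the set $$\mathcal{G}=\{W\in C(\mathbb{R}\times[0,+\infty))\colon \|W\|_R<\infty\ \forall R>0;\ \exists\alpha\in\mathbb{R}\text{ s.t. }\forall T>0\ \exists C_T\in\mathbb{R}\text{ s.t. }W(x,t)-\alpha x\ge C_T\ \forall x\in\mathbb{R},\forall t\in[0,T]\},$$ where $\|W\|_R=\sup\{|W(x,t)|+|q|\colon (x,t)\in B_R(\mathbb{R})\times[0,R],\ q\in D_x^-W(x,t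)\}$.
   Context: Explicit function. For $a,b>0$, $x,p\in\mathbb{R}$, $t\ge0$, define $V(x,t;p,a,b)$ as follows. If $p\ge0$, then $V(x,t;p,a,b)=f_i(x,t;p,a,b)$ whenever $(x,t,p)\in\Omega_i$, $i=1,\dots,5$, where (the regions depend on $a,b$, are subsets of $\mathbb{R}\times[0,+\infty)\times[0,+\infty)$, and partition it) $\Omega_1=\{x\ge pt+\frac a2t^2\}$; $\Omega_2=\{x<0,\ t<\frac pb\}\cup\{x<-\frac b2(t-\frac pb)^2,\ t\ge\frac pb\}$; $\Omega_3=\{0\le x<pt+\frac a2t^2,\ t<\frac pb\}\cup\{\frac a2(t-\frac pb)^2\le x<pt+\frac a2t^2,\ t\ge\frac pb\}$; $\Omega_4=\{0\le x<\frac a2(t-\frac pb)^2,\ t\ge\frac pb\}$; $\Omega_5=\{-\frac b2(t-\frac pb)^2\le x<0,\ t\ge\frac pb\}$; and $f_1=-\frac{a^2}{6}t^3-\frac a2pt^2+atx-\frac12p^2t+px$; $f_2=-\frac{b^2}{6}t^3+\frac b2pt^2-\frac12p^2t+px-btx$; $f_3=\frac{a+b}{3(a+2b)^2}\left((bt-p)^3+((bt-p)^2+2x(a+2b))^{3/2}\right)-\frac{b}{a+2b}(bt-p)x-\frac{b^2}{6}t^3+\frac b2pt^2-\frac12p^2t$; $f_4=\frac{a^2}{3}\left(\frac{2x}{a}\right)^{3/2}-\frac{p^3}{6b}$; $f_5=\frac{b^2}{3}\left(\frac{-2x}{b}\right)^{3/2}-\frac{p^3}{6b}$. If $p<0$,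 then $V(x,t;p,a,b)=V(-x,t;-p,b,a)$ (the right-hand side being given by the case $-p>0$ with $a$ and $b$ exchanged). Other notation. $\Phi^*(p)=\sup_x\{px-\Phi(x)\}\in\mathbb{R}\cup\{+\infty\}$. $B_R(\mathbb{R})$ is the closed ball (interval) of center $0$ and radius $R$. $D_x^-W(x,t)$ is the (Fréchet/viscosity) subdifferential of $y\mapsto W(y,t)$ at $y=x$. A "continuously differentiable solution" is a function continuous on $\mathbb{R}\times[0,+\infty)$, continuously differentiable on $\mathbb{R}\times(0,+\infty)$, satisfying the PDE pointwise there and the initial condition at $t=0$. "Viscosity solution" has the standard (Crandall-Lions) meaning, together with the initial condition. *)

theory Defs
  imports "HOL-Analysis.Analysis"
begin

section \<open>The explicit function $V(x,t;p,a,b)$\<close>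

text \<open>
  The five regions partition $\{(x,t,p) : t \ge 0,\ p \ge 0\}$ when $a, b > 0$
  (lemma \<open>Omega_partition\<close> below).
\<close>

definition Omega1 :: "real \<Rightarrow> real \<Rightarrow> (real \<times> real \<times> real) set" where
  "Omega1 a b = {(x, t, p). 0 \<le> t \<and> 0 \<le> p \<and> x \<ge> p * t + a / 2 * t\<^sup>2}"

definition Omega2 :: "real \<Rightarrow> real \<Rightarrow> (real \<times> real \<times> real) set" where
  "Omega2 a b = {(x, t, p). 0 \<le> t \<and> 0 \<le> p \<and>
     ((x < 0 \<and> t < p / b) \<or> (x < - (b / 2) * (t - p / b)\<^sup>2 \<and> t \<ge> p / b))}"

definition Omega3 :: "real \<Rightarrow> real \<Rightarrow> (real \<times> real \<times> real) set" where
  "Omega3 a b = {(x, t, p). 0 \<le> t \<and> 0 \<le> p \<and>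
     ((0 \<le> x \<and> x < p * t + a / 2 * t\<^sup>2 \<and> t < p / b) \<or>
      (a / 2 * (t - p / b)\<^sup>2 \<le> x \<and> x < p * t + a / 2 * t\<^sup>2 \<and> t \<ge> p / b))}"

definition Omega4 :: "real \<Rightarrow> real \<Rightarrow> (real \<times> real \<times> real) set" where
  "Omega4 a b = {(x, t, p). 0 \<le> t \<and> 0 \<le> p \<and>
     0 \<le> x \<and> x < a / 2 * (t - p / b)\<^sup>2 \<and> t \<ge> p / b}"

definition Omega5 :: "real \<Rightarrow> real \<Rightarrow> (real \<times> real \<times> real) set" where
  "Omega5 a b = {(x, t, p). 0 \<le> t \<and> 0 \<le> p \<and>
     - (b / 2) * (t - p / b)\<^sup>2 \<le> x \<and> x < 0 \<and> t \<ge> p / b}"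

definition f1 :: "real \<Rightarrow> real \<Rightarrow> real \<Rightarrow> real \<Rightarrow> real \<Rightarrow> real" where
  "f1 a b x t p = - (a\<^sup>2 / 6) * t^3 - a / 2 * p * t\<^sup>2 + a * t * x - 1 / 2 * p\<^sup>2 * t + p * x"

definition f2 :: "real \<Rightarrow> real \<Rightarrow> real \<Rightarrow> real \<Rightarrow> real \<Rightarrow> real" where
  "f2 a b x t p = - (b\<^sup>2 / 6) * t^3 + b / 2 * p * t\<^sup>2 - 1 / 2 * p\<^sup>2 * t + p * x - b * t * x"

definition f3 :: "real \<Rightarrow> real \<Rightarrow> real \<Rightarrow> real \<Rightarrow> real \<Rightarrow> real" where
  "f3 a b x t p =
     (a + b) / (3 * (a + 2 * b)\<^sup>2) *
       ((b * t - p)^3 + ((b * t - p)\<^sup>2 + 2 * x * (a + 2 * b)) powr (3 / 2))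
     - b / (a + 2 * b) * (b * t - p) * x
     - b\<^sup>2 / 6 * t^3 + b / 2 * p * t\<^sup>2 - 1 / 2 * p\<^sup>2 * t"

definition f4 :: "real \<Rightarrow> real \<Rightarrow> real \<Rightarrow> real \<Rightarrow> real \<Rightarrow> real" where
  "f4 a b x t p = a\<^sup>2 / 3 * (2 * x / a) powr (3 / 2) - p^3 / (6 * b)"

definition f5 :: "real \<Rightarrow> real \<Rightarrow> real \<Rightarrow> real \<Rightarrow> real \<Rightarrow> real" where
  "f5 a b x t p = b\<^sup>2 / 3 * (- 2 * x / b) powr (3 / 2) - p^3 / (6 * b)"

text \<open>
  The case $p \ge 0$. The last branch, value 0, is reached only if $t < 0$ or $p < 0$.
\<close>

definition V_nonneg :: "real \<Rightarrow> real \<Rightarrow> real \<Rightarrow> real \<Rightarrow> real \<Rightarrow> real" where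
  "V_nonneg x t p a b =
    (if (x, t, p) \<in> Omega1 a b then f1 a b x t p
     else if (x, t, p) \<in> Omega2 a b then f2 a b x t p
     else if (x, t, p) \<in> Omega3 a b then f3 a b x t p
     else if (x, t, p) \<in> Omega4 a b then f4 a b x t p
     else if (x, t, p) \<in> Omega5 a b then f5 a b x t p
     else 0)"

definition V_explicit :: "real \<Rightarrow> real \<Rightarrow> real \<Rightarrow> real \<Rightarrow> real \<Rightarrow> real" where
  "V_explicit x t p a b =
    (if 0 \<le> p then V_nonneg x t p a b else V_nonneg (- x) t (- p) b a)"

lemma Omega_partition:
  assumes "a > 0" "b > 0"
  shows "Omega1 a b \<union> Omega2 a b \<union> Omega3 a b \<union> Omega4 a b \<union> Omega5 a b
           = {(x, t, p). 0 \<le> t \<and> 0 \<le> p}"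
    and "disjoint_family_on (\<lambda>i. [Omega1 a b, Omega2 a b, Omega3 a b, Omega4 a b, Omega5 a b] ! i) {..<5}"
proof -
  have le: "a / 2 * (t - p / b)\<^sup>2 \<le> p * t + a / 2 * t\<^sup>2" if "0 \<le> t" "0 \<le> p" "t \<ge> p / b" for t p
  proof -
    have "(t - p / b)\<^sup>2 \<le> t\<^sup>2"
      using that assms by (intro power_mono) auto
    hence "a / 2 * (t - p / b)\<^sup>2 \<le> a / 2 * t\<^sup>2"
      using assms by (intro mult_left_mono) auto
    moreover have "0 \<le> p * t" using that by simp
    ultimately show ?thesis by linarith
  qed
  have nn: "0 \<le> p * t + a / 2 * t\<^sup>2" if "0 \<le> t" "0 \<le> p" for t p
    using that assms by simp
  have sq: "0 \<le> a / 2 * (t - p / b)\<^sup>2" "- (b / 2) * (t - p / b)\<^sup>2 \<le> 0" for t p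
    using assms by simp_all
  note defs = Omega1_def Omega2_def Omega3_def Omega4_def Omega5_def
  note mem = mem_Collect_eq case_prod_conv Un_iff Int_iff empty_iff split_paired_All
  show "Omega1 a b \<union> Omega2 a b \<union> Omega3 a b \<union> Omega4 a b \<union> Omega5 a b
           = {(x, t, p). 0 \<le> t \<and> 0 \<le> p}"
    unfolding defs set_eq_iff mem by (smt (verit))
  have d: "Omega1 a b \<inter> Omega2 a b = {}" "Omega1 a b \<inter> Omega3 a b = {}"
    "Omega1 a b \<inter> Omega4 a b = {}" "Omega1 a b \<inter> Omega5 a b = {}"
    "Omega2 a b \<inter> Omega3 a b = {}" "Omega2 a b \<inter> Omega4 a b = {}"
    "Omega2 a b \<inter> Omega5 a b = {}" "Omega3 a b \<inter> Omega4 a b = {}"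
    "Omega3 a b \<inter> Omega5 a b = {}" "Omega4 a b \<inter> Omega5 a b = {}"
    unfolding defs set_eq_iff mem using le nn sq by (smt (verit))+
  have "{..<5} = {0, 1, 2, 3, 4::nat}" by auto
  thus "disjoint_family_on (\<lambda>i. [Omega1 a b, Omega2 a b, Omega3 a b, Omega4 a b, Omega5 a b] ! i) {..<5}"
    using d by (auto simp: disjoint_family_on_def Int_commute)
qed


section \<open>The candidate solution\<close>

definition U :: "real \<Rightarrow> real \<Rightarrow> real \<Rightarrow> real" where
  "U a b x = (if x \<ge> 0 then - a * x else b * x)"

definition legendre :: "(real \<Rightarrow> real) \<Rightarrow> real \<Rightarrow> ereal" where
  "legendre \<Phi> p = (SUP x. ereal (p * x - \<Phi> x))"

text \<open>
  The supremum is taken in \<open>ereal\<close>, so that parameters with \<open>legendre \<Phi> p = \<infinity>\<close> contribute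
  $-\infty$ and finiteness of the supremum remains something to be proved;
  \<open>V_fun\<close> is its real value.
\<close>

definition V_sup :: "(real \<Rightarrow> real) \<Rightarrow> real \<Rightarrow> real \<Rightarrow> real \<Rightarrow> real \<Rightarrow> ereal" where
  "V_sup \<Phi> a b x t = (SUP p. ereal (V_explicit x t p a b) - legendre \<Phi> p)"

definition V_fun :: "(real \<Rightarrow> real) \<Rightarrow> real \<Rightarrow> real \<Rightarrow> real \<times> real \<Rightarrow> real" where
  "V_fun \<Phi> a b = (\<lambda>(x, t). real_of_ereal (V_sup \<Phi> a b x t))"


section \<open>Solutions of $W_t + \frac12 W_x^2 + U = 0$, $W(\cdot,0) = \Phi$\<close>

text \<open>
  Functions on $\mathbb{R} \times [0,\infty)$ are total functions on pairs \<open>(x, t)\<close> whose values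
  for \<open>t < 0\<close> play no role. \<open>C1_on S\<close> is meant for open \<open>S\<close>.
\<close>

definition C1_on :: "(real \<times> real) set \<Rightarrow> (real \<times> real \<Rightarrow> real) \<Rightarrow> bool" where
  "C1_on S W \<longleftrightarrow>
    (\<exists>W' :: real \<times> real \<Rightarrow> (real \<times> real) \<Rightarrow>\<^sub>L real.
       continuous_on S W' \<and> (\<forall>z\<in>S. (W has_derivative blinfun_apply (W' z)) (at z)))"

definition HJ_op :: "(real \<Rightarrow> real) \<Rightarrow> (real \<times> real \<Rightarrow> real) \<Rightarrow> real \<Rightarrow> real \<Rightarrow> real" where
  "HJ_op u W x t = deriv (\<lambda>s. W (x, s)) t + 1 / 2 * (deriv (\<lambda>y. W (y, t)) x)\<^sup>2 + u x"

definition C1_solution :: "(real \<Rightarrow> real) \<Rightarrow> (real \<Rightarrow> real) \<Rightarrow> (real \<times> real \<Rightarrow> real) \<Rightarrow> bool" where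
  "C1_solution u \<Phi> W \<longleftrightarrow>
     continuous_on (UNIV \<times> {0..}) W \<and>
     C1_on (UNIV \<times> {0<..}) W \<and>
     (\<forall>x. \<forall>t>0. HJ_op u W x t = 0) \<and>
     (\<forall>x. W (x, 0) = \<Phi> x)"

definition viscosity_subsolution :: "(real \<Rightarrow> real) \<Rightarrow> (real \<times> real \<Rightarrow> real) \<Rightarrow> bool" where
  "viscosity_subsolution u W \<longleftrightarrow>
     (\<forall>\<phi> x t. C1_on (UNIV \<times> {0<..}) \<phi> \<and> t > 0 \<and>
        (\<forall>\<^sub>F z in nhds (x, t). W z - \<phi> z \<le> W (x, t) - \<phi> (x, t)) \<longrightarrow> HJ_op u \<phi> x t \<le> 0)"

definition viscosity_supersolution :: "(real \<Rightarrow> real) \<Rightarrow> (real \<times> real \<Rightarrow> real) \<Rightarrow> bool" where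
  "viscosity_supersolution u W \<longleftrightarrow>
     (\<forall>\<phi> x t. C1_on (UNIV \<times> {0<..}) \<phi> \<and> t > 0 \<and>
        (\<forall>\<^sub>F z in nhds (x, t). W z - \<phi> z \<ge> W (x, t) - \<phi> (x, t)) \<longrightarrow> HJ_op u \<phi> x t \<ge> 0)"

definition viscosity_solution :: "(real \<Rightarrow> real) \<Rightarrow> (real \<Rightarrow> real) \<Rightarrow> (real \<times> real \<Rightarrow> real) \<Rightarrow> bool" where
  "viscosity_solution u \<Phi> W \<longleftrightarrow>
     continuous_on (UNIV \<times> {0..}) W \<and>
     viscosity_subsolution u W \<and> viscosity_supersolution u W \<and>
     (\<forall>x. W (x, 0) = \<Phi> x)"


section \<open>The uniqueness class and the growth condition\<close>

definition frechet_subdiff :: "(real \<Rightarrow> real) \<Rightarrow> real \<Rightarrow> real set" where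
  "frechet_subdiff g x =
     {q. 0 \<le> Liminf (at x) (\<lambda>y. ereal ((g y - g x - q * (y - x)) / \<bar>y - x\<bar>))}"

definition norm_R :: "real \<Rightarrow> (real \<times> real \<Rightarrow> real) \<Rightarrow> ereal" where
  "norm_R R W =
     Sup {ereal (\<bar>W (x, t)\<bar> + \<bar>q\<bar>) | x t q.
            x \<in> cball 0 R \<and> t \<in> {0..R} \<and> q \<in> frechet_subdiff (\<lambda>y. W (y, t)) x}"

definition uniqueness_class :: "(real \<times> real \<Rightarrow> real) set" where
  "uniqueness_class =
     {W. continuous_on (UNIV \<times> {0..}) W \<and>
         (\<forall>R>0. norm_R R W < \<infinity>) \<and>
         (\<exists>\<alpha>. \<forall>T>0. \<exists>C. \<forall>x. \<forall>t\<in>{0..T}. W (x, t) - \<alpha> * x \<ge> C)}"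

text \<open>
  $s^\delta$ for $s, \delta \ge 0$ with the convention $0^0 = 1$, whereas \<open>0 powr 0 = 0\<close>.
\<close>

definition rpow :: "real \<Rightarrow> real \<Rightarrow> real" where
  "rpow s \<delta> = (if \<delta> = 0 then 1 else s powr \<delta>)"

definition poly_lipschitz :: "(real \<Rightarrow> real) \<Rightarrow> bool" where
  "poly_lipschitz \<Phi> \<longleftrightarrow>
     (\<exists>C\<ge>0. \<exists>\<delta>\<ge>0. \<forall>x y. \<bar>\<Phi> x - \<Phi> y\<bar> \<le> C * \<bar>x - y\<bar> * (1 + rpow \<bar>x\<bar> \<delta> + rpow \<bar>y\<bar> \<delta>))"

end

theory Submission
  imports Defs
begin

text \<open>
  Each \<open>F\<^sub>p(x, t) = V(x, t; p, a, b)\<close> is a classical solution with data \<open>p x\<close>, obtained by gluing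
  its five formulas along closed sets. Comparing a viscosity sub- or supersolution with a
  classical solution needs no doubling of variables, since the classical solution plus a
  penalty is itself a test function. Applied to averages of the \<open>F\<^sub>p\<close>, comparison shows that
  \<open>F\<^sub>p\<close> is strictly concave in \<open>p\<close> for \<open>t > 0\<close>. So the supremum over \<open>p\<close> of
  \<open>F\<^sub>p - \<Phi>\<^sup>*(p)\<close> has a unique maximiser, which depends continuously on \<open>(x, t)\<close>, and the
  supremum has the gradient of the maximising \<open>F\<^sub>p\<close>: it is continuously differentiable and
  inherits the equation. For uniqueness, a solution \<open>W\<close> lies below \<open>V\<close> by comparison with
  \<open>V\<close>, whose convexity in \<open>x\<close> bounds the relevant speed of propagation, and \<open>W\<close> lies above
  every \<open>F\<^sub>p - \<Phi>\<^sup>*(p)\<close>, whose gradient is bounded in \<open>x\<close>.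
\<close>

section \<open>Gradients of functions of space and time\<close>

text \<open>The quadratic Hamiltonian gives no a priori speed of propagation and the data may grow
  faster than linearly, so the two halves of uniqueness rest on comparison theorems of different
  shape. Adding a penalty to a supersolution creates the square of the penalty slope with the
  helpful sign, and a bound on inward slopes is then enough. Subtracting it from a subsolution
  creates the same square with the harmful sign: the slope of the penalty must be fixed before its
  speed, and it is taken from linear growth bounds, which each \<open>F\<^sub>p\<close> satisfies.
  Maximisers exist and stay in compact sets because \<Phi> is finite everywhere: its conjugate grows
  faster than any linear function, whereas \<open>F\<^sub>p(x, t)\<close> is bounded above by p x
  plus a term independent of p. Strict concavity in p comes from comparison and not from second
  derivatives of the five formulas, which would have to be controlled across every edge between
  regions.\<close>

definition has_grad :: "(real \<times> real \<Rightarrow> real) \<Rightarrow> real \<Rightarrow> real \<Rightarrow> real \<times> real \<Rightarrow> bool" where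
  "has_grad f p q z \<longleftrightarrow> (f has_derivative (\<lambda>h. p * fst h + q * snd h)) (at z)"

lemma has_grad_partial_x:
  assumes "has_grad f p q (x, t)"
  shows "((\<lambda>y. f (y, t)) has_real_derivative p) (at x)"
proof -
  have "((\<lambda>y. (y, t)) has_derivative (\<lambda>h. (h, 0))) (at x)"
    by (auto intro!: derivative_eq_intros)
  from has_derivative_compose[OF this assms[unfolded has_grad_def]]
  show ?thesis by (simp add: has_field_derivative_def mult_commute_abs)
qed

lemma has_grad_partial_t:
  assumes "has_grad f p q (x, t)"
  shows "((\<lambda>s. f (x, s)) has_real_derivative q) (at t)"
proof -
  have "((\<lambda>s. (x, s)) has_derivative (\<lambda>h. (0, h))) (at t)"
    by (auto intro!: derivative_eq_intros)
  from has_derivative_compose[OF this assms[unfolded has_grad_def]]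
  show ?thesis by (simp add: has_field_derivative_def mult_commute_abs)
qed

lemma has_grad_isCont: "has_grad f p q z \<Longrightarrow> isCont f z"
  unfolding has_grad_def by (rule has_derivative_continuous)

lemma HJ_op_has_grad:
  assumes "has_grad f p q (x, t)"
  shows "HJ_op u f x t = q + 1 / 2 * p\<^sup>2 + u x"
  using has_grad_partial_x[OF assms] has_grad_partial_t[OF assms]
  by (simp add: HJ_op_def DERIV_imp_deriv)

lemma has_grad_add:
  assumes "has_grad f p q z" "has_grad g p' q' z"
  shows "has_grad (\<lambda>w. f w + g w) (p + p') (q + q') z"
  using has_derivative_add[OF assms[unfolded has_grad_def]]
  by (simp add: has_grad_def algebra_simps)

lemma has_grad_cmult:
  assumes "has_grad f p q z"
  shows "has_grad (\<lambda>w. c * f w) (c * p) (c * q) z"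
  using has_derivative_mult_right[OF assms[unfolded has_grad_def], of c]
  by (simp add: has_grad_def algebra_simps)

lemma has_grad_diff:
  assumes "has_grad f p q z" "has_grad g p' q' z"
  shows "has_grad (\<lambda>w. f w - g w) (p - p') (q - q') z"
  using has_derivative_diff[OF assms[unfolded has_grad_def]]
  by (simp add: has_grad_def algebra_simps)

lemma has_grad_compose:
  assumes "(k has_real_derivative d) (at (f z))" "has_grad f p q z"
  shows "has_grad (\<lambda>w. k (f w)) (d * p) (d * q) z"
  using has_derivative_compose[OF assms(2)[unfolded has_grad_def]
      assms(1)[unfolded has_field_derivative_def]]
  by (simp add: has_grad_def algebra_simps)

lemma has_grad_of_x:
  assumes "(k has_real_derivative d) (at (fst z))"
  shows "has_grad (\<lambda>w. k (fst w)) d 0 z"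
  using has_derivative_compose[OF has_derivative_fst[OF has_derivative_ident]
      assms[unfolded has_field_derivative_def]]
  by (simp add: has_grad_def)

lemma has_grad_of_t:
  assumes "(k has_real_derivative d) (at (snd z))"
  shows "has_grad (\<lambda>w. k (snd w)) 0 d z"
  using has_derivative_compose[OF has_derivative_snd[OF has_derivative_ident]
      assms[unfolded has_field_derivative_def]]
  by (simp add: has_grad_def)

lemma has_grad_local_max:
  assumes "has_grad f p q z" "\<forall>\<^sub>F w in nhds z. f w \<le> f z"
  shows "p = 0" "q = 0"
proof -
  obtain S where S: "open S" "z \<in> S" "\<forall>w\<in>S. f w \<le> f z"
    using assms(2) unfolding eventually_nhds by blast
  have "(\<lambda>h. p * fst h + q * snd h) = (\<lambda>h. 0)"
    using differential_zero_maxmin[OF S(2,1) assms(1)[unfolded has_grad_def]] S(3) by blast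
  from fun_cong[OF this, of "(1, 0)"] fun_cong[OF this, of "(0, 1)"]
  show "p = 0" "q = 0" by simp_all
qed

text \<open>Gradients are handled as pairs of real functions; only here are they assembled, from the
  two coordinate projections, into the operator-valued derivative that \<open>C1_on\<close> asks
  for.\<close>

lemma C1_onI:
  assumes "continuous_on S p" "continuous_on S q"
    and "\<And>z. z \<in> S \<Longrightarrow> has_grad f (p z) (q z) z"
  shows "C1_on S f"
  unfolding C1_on_def
proof (intro exI conjI ballI)
  let ?D = "\<lambda>z. p z *\<^sub>R (fst_blinfun :: (real \<times> real) \<Rightarrow>\<^sub>L real) + q z *\<^sub>R snd_blinfun"
  show "continuous_on S ?D"
    by (intro continuous_intros assms)
  show "(f has_derivative blinfun_apply (?D z)) (at z)" if "z \<in> S" for z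
  proof -
    have "blinfun_apply (?D z) = (\<lambda>h. p z * fst h + q z * snd h)"
      by (auto simp: blinfun.bilinear_simps)
    then show ?thesis using assms(3)[OF that] unfolding has_grad_def by simp
  qed
qed

lemma C1_onE:
  assumes "C1_on S f" "z \<in> S"
  obtains p q where "has_grad f p q z"
proof -
  obtain D :: "(real \<times> real) \<Rightarrow>\<^sub>L real" where D: "(f has_derivative blinfun_apply D) (at z)"
    using assms unfolding C1_on_def by blast
  have "blinfun_apply D h = blinfun_apply D (1, 0) * fst h + blinfun_apply D (0, 1) * snd h" for h
  proof -
    have "h = fst h *\<^sub>R (1, 0) + snd h *\<^sub>R (0, 1)"
      by (simp add: prod_eq_iff)
    then have "blinfun_apply D h = blinfun_apply D (fst h *\<^sub>R (1, 0) + snd h *\<^sub>R (0, 1))"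
      by simp
    also have "\<dots> = fst h *\<^sub>R blinfun_apply D (1, 0) + snd h *\<^sub>R blinfun_apply D (0, 1)"
      by (simp only: blinfun.add_right blinfun.scaleR_right)
    finally show ?thesis by (simp add: mult.commute)
  qed
  then have "blinfun_apply D = (\<lambda>h. blinfun_apply D (1, 0) * fst h + blinfun_apply D (0, 1) * snd h)"
    by blast
  with D have "has_grad f (blinfun_apply D (1, 0)) (blinfun_apply D (0, 1)) z"
    unfolding has_grad_def by simp
  then show thesis by (rule that)
qed

text \<open>Where a test function touches a differentiable function, the two gradients coincide, so
  the pointwise inequality passes to the test function.\<close>

lemma viscosity_subsolutionI_classical:
  assumes "\<And>x t. t > 0 \<Longrightarrow> has_grad W (p (x, t)) (q (x, t)) (x, t)"
    and "\<And>x t. t > 0 \<Longrightarrow> q (x, t) + 1 / 2 * (p (x, t))\<^sup>2 + u x \<le> 0"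
  shows "viscosity_subsolution u W"
  unfolding viscosity_subsolution_def
proof (intro allI impI, elim conjE)
  fix \<phi> x t
  assume \<phi>: "C1_on (UNIV \<times> {0<..}) \<phi>" and t: "t > (0::real)"
    and max: "\<forall>\<^sub>F z in nhds (x, t). W z - \<phi> z \<le> W (x, t) - \<phi> (x, t)"
  obtain p' q' where g: "has_grad \<phi> p' q' (x, t)"
    using C1_onE[OF \<phi>, of "(x, t)"] t by auto
  have "p (x, t) - p' = 0" "q (x, t) - q' = 0"
    using has_grad_local_max[OF has_grad_diff[OF assms(1)[OF t] g] max] by auto
  then show "HJ_op u \<phi> x t \<le> 0"
    using HJ_op_has_grad[OF g, of u] assms(2)[OF t, of x] by simp
qed

lemma viscosity_supersolutionI_classical:
  assumes "\<And>x t. t > 0 \<Longrightarrow> has_grad W (p (x, t)) (q (x, t)) (x, t)"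
    and "\<And>x t. t > 0 \<Longrightarrow> q (x, t) + 1 / 2 * (p (x, t))\<^sup>2 + u x \<ge> 0"
  shows "viscosity_supersolution u W"
  unfolding viscosity_supersolution_def
proof (intro allI impI, elim conjE)
  fix \<phi> x t
  assume \<phi>: "C1_on (UNIV \<times> {0<..}) \<phi>" and t: "t > (0::real)"
    and min: "\<forall>\<^sub>F z in nhds (x, t). W z - \<phi> z \<ge> W (x, t) - \<phi> (x, t)"
  obtain p' q' where g: "has_grad \<phi> p' q' (x, t)"
    using C1_onE[OF \<phi>, of "(x, t)"] t by auto
  have "\<forall>\<^sub>F z in nhds (x, t). \<phi> z - W z \<le> \<phi> (x, t) - W (x, t)"
    using min by eventually_elim simp
  then have "p' - p (x, t) = 0" "q' - q (x, t) = 0"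
    using has_grad_local_max[OF has_grad_diff[OF g assms(1)[OF t]]] by auto
  then show "HJ_op u \<phi> x t \<ge> 0"
    using HJ_op_has_grad[OF g, of u] assms(2)[OF t, of x] by simp
qed

section \<open>Comparison with classical solutions\<close>

text \<open>Squaring removes the kink of \<open>max 0\<close>. This makes the spatial cutoff and the
  final-time penalty continuously differentiable, hence admissible in test functions.\<close>

lemma DERIV_max_0_sq: "((\<lambda>s. (max 0 s)\<^sup>2) has_real_derivative 2 * max 0 s) (at (s::real))"
proof (cases s "0::real" rule: linorder_cases)
  case less
  have "((\<lambda>s::real. 0) has_real_derivative 2 * max 0 s) (at s)" using less by simp
  then show ?thesis
    by (rule has_field_derivative_transform_within_open[of _ _ _ "{..<0}"]) (use less in auto)
next
  case greater
  have "((\<lambda>s::real. s\<^sup>2) has_real_derivative 2 * max 0 s) (at s)"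
    using greater by (auto intro!: derivative_eq_intros)
  then show ?thesis
    by (rule has_field_derivative_transform_within_open[of _ _ _ "{0<..}"]) (use greater in auto)
next
  case equal
  have "((\<lambda>h::real. (max 0 h)\<^sup>2 / h) \<longlongrightarrow> 0) (at 0)"
  proof (rule Lim_null_comparison)
    show "\<forall>\<^sub>F h in at 0. norm ((max 0 h)\<^sup>2 / h) \<le> \<bar>h::real\<bar>"
      by (rule always_eventually) (auto simp: max_def power2_eq_square)
    show "((\<lambda>h::real. \<bar>h\<bar>) \<longlongrightarrow> 0) (at 0)"
      by (intro tendsto_rabs_zero tendsto_ident_at)
  qed
  then show ?thesis using equal by (simp add: DERIV_def)
qed

text \<open>A C1 cutoff that vanishes for s \<le> 0, has slope between 0 and 1 and grows linearly.
  It leaves the point under study unpenalised, adds only a bounded slope, and still dominates linear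
  growth after scaling.\<close>

definition bump :: "real \<Rightarrow> real" where
  "bump s = sqrt (1 + (max 0 s)\<^sup>2) - 1"

definition bump' :: "real \<Rightarrow> real" where
  "bump' s = max 0 s / sqrt (1 + (max 0 s)\<^sup>2)"

lemma one_add_sq_pos: "0 < 1 + (r::real)\<^sup>2"
  by (simp add: add_pos_nonneg)

lemma sqrt_one_add_sq_nonzero: "sqrt (1 + (r::real)\<^sup>2) \<noteq> 0"
  using one_add_sq_pos[of r] by simp

lemma DERIV_bump: "(bump has_real_derivative bump' s) (at s)"
proof -
  have "((\<lambda>s. 1 + (max 0 s)\<^sup>2) has_real_derivative 2 * max 0 s) (at s)"
    using DERIV_add[OF DERIV_const DERIV_max_0_sq] by simp
  from DERIV_chain2[OF DERIV_real_sqrt[OF one_add_sq_pos] this]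
  have "((\<lambda>s. sqrt (1 + (max 0 s)\<^sup>2) - 1) has_real_derivative
      inverse (sqrt (1 + (max 0 s)\<^sup>2)) / 2 * (2 * max 0 s) - 0) (at s)"
    by (rule DERIV_diff[OF _ DERIV_const])
  then show ?thesis
    unfolding bump_def[abs_def] bump'_def by (simp add: field_simps)
qed

lemma bump_0 [simp]: "bump 0 = 0"
  and bump_nonneg: "0 \<le> bump s"
  and bump_ge: "s - 1 \<le> bump s"
proof -
  show "bump 0 = 0" by (simp add: bump_def)
  show "0 \<le> bump s" by (simp add: bump_def)
  have "max 0 s \<le> sqrt (1 + (max 0 s)\<^sup>2)" by (rule real_le_rsqrt) simp
  then show "s - 1 \<le> bump s" by (simp add: bump_def)
qed

lemma bump_ge_1:
  assumes "1 \<le> s"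
  shows "sqrt 2 - 1 \<le> bump s"
proof -
  have "1\<^sup>2 \<le> (max 0 s)\<^sup>2" using assms by (intro power_mono) auto
  then show ?thesis by (simp add: bump_def)
qed

lemma bump'_bounds: "0 \<le> bump' s" "bump' s \<le> 1"
proof -
  have "max 0 s \<le> sqrt (1 + (max 0 s)\<^sup>2)" by (rule real_le_rsqrt) simp
  then show "bump' s \<le> 1"
    using one_add_sq_pos[of "max 0 s"] by (simp add: bump'_def divide_le_eq)
  show "0 \<le> bump' s" by (simp add: bump'_def)
qed

lemma continuous_on_bump' [continuous_intros]:
  "continuous_on S f \<Longrightarrow> continuous_on S (\<lambda>z. bump' (f z))"
  unfolding bump'_def
  by (intro continuous_intros ballI sqrt_one_add_sq_nonzero)

lemma abs_le_sqrt_one_add_sq: "\<bar>x\<bar> \<le> sqrt (1 + x\<^sup>2)"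
  by (rule real_le_rsqrt) simp

lemma abs_div_sqrt_le_1: "\<bar>x / sqrt (1 + x\<^sup>2)\<bar> \<le> 1"
  using abs_le_sqrt_one_add_sq[of x] one_add_sq_pos[of x] by (simp add: abs_divide divide_le_eq)

text \<open>
  The penalty: it travels with speed \<open>M\<close> and confines the maximum point in space, while the
  term with \<open>\<epsilon>\<close> makes inequalities strict and the last one keeps the maximum away from the
  final time.
\<close>

definition barrier :: "real \<Rightarrow> real \<Rightarrow> real \<Rightarrow> real \<Rightarrow> real \<Rightarrow> real \<Rightarrow> real \<times> real \<Rightarrow> real" where
  "barrier K R M \<epsilon> L s = (\<lambda>z. K * bump (sqrt (1 + (fst z)\<^sup>2) - R + M * snd z)
     + \<epsilon> * snd z + L * (max 0 (snd z - s))\<^sup>2)"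

definition barrier_x :: "real \<Rightarrow> real \<Rightarrow> real \<Rightarrow> real \<times> real \<Rightarrow> real" where
  "barrier_x K R M = (\<lambda>z. K * bump' (sqrt (1 + (fst z)\<^sup>2) - R + M * snd z)
     * (fst z / sqrt (1 + (fst z)\<^sup>2)))"

definition barrier_t :: "real \<Rightarrow> real \<Rightarrow> real \<Rightarrow> real \<Rightarrow> real \<Rightarrow> real \<Rightarrow> real \<times> real \<Rightarrow> real" where
  "barrier_t K R M \<epsilon> L s = (\<lambda>z. K * bump' (sqrt (1 + (fst z)\<^sup>2) - R + M * snd z) * M
     + \<epsilon> + L * (2 * max 0 (snd z - s)))"

lemma has_grad_barrier:
  "has_grad (barrier K R M \<epsilon> L s) (barrier_x K R M z) (barrier_t K R M \<epsilon> L s z) z"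
proof -
  have r: "((\<lambda>y. sqrt (1 + y\<^sup>2) - R) has_real_derivative fst z / sqrt (1 + (fst z)\<^sup>2)) (at (fst z))"
  proof -
    have "((\<lambda>y. 1 + y\<^sup>2) has_real_derivative 2 * fst z) (at (fst z))"
      by (auto intro!: derivative_eq_intros)
    from DERIV_chain2[OF DERIV_real_sqrt[OF one_add_sq_pos] this]
    have "((\<lambda>y. sqrt (1 + y\<^sup>2) - R) has_real_derivative
        inverse (sqrt (1 + (fst z)\<^sup>2)) / 2 * (2 * fst z) - 0) (at (fst z))"
      by (rule DERIV_diff[OF _ DERIV_const])
    then show ?thesis by (simp add: field_simps)
  qed
  have "has_grad (\<lambda>w. sqrt (1 + (fst w)\<^sup>2) - R + M * snd w)
      (fst z / sqrt (1 + (fst z)\<^sup>2) + 0) (0 + M) z"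
    by (intro has_grad_add has_grad_of_x[OF r] has_grad_of_t) (auto intro!: derivative_eq_intros)
  note 1 = has_grad_cmult[OF has_grad_compose[where k = bump, OF DERIV_bump this], of K]
  have 2: "has_grad (\<lambda>w. \<epsilon> * snd w) 0 \<epsilon> z"
    by (rule has_grad_of_t) (auto intro!: derivative_eq_intros)
  have "((\<lambda>r. (max 0 (r - s))\<^sup>2) has_real_derivative 2 * max 0 (snd z - s) * 1) (at (snd z))"
    by (rule DERIV_chain2[OF DERIV_max_0_sq]) (auto intro!: derivative_eq_intros)
  then have 3: "has_grad (\<lambda>w. L * (max 0 (snd w - s))\<^sup>2) 0 (L * (2 * max 0 (snd z - s))) z"
    using has_grad_cmult[OF has_grad_of_t, of "\<lambda>r. (max 0 (r - s))\<^sup>2" _ z L] by simp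
  from has_grad_add[OF has_grad_add[OF 1 2] 3] show ?thesis
    unfolding barrier_def barrier_x_def barrier_t_def by (simp add: mult_ac)
qed

lemma continuous_on_barrier_grad:
  "continuous_on S (barrier_x K R M)" "continuous_on S (barrier_t K R M \<epsilon> L s)"
  unfolding barrier_x_def barrier_t_def
  by (intro continuous_intros ballI sqrt_one_add_sq_nonzero)+

lemma continuous_on_barrier: "continuous_on S (barrier K R M \<epsilon> L s)"
  by (intro continuous_at_imp_continuous_on ballI has_grad_isCont[OF has_grad_barrier])

text \<open>A positive value beats all values on the boundary of the box, so the maximum over the
  compact box lies inside. The top side has to be excluded as well, because the touching condition
  for viscosity solutions refers to a full neighbourhood, including later times.\<close>

lemma interior_max_exists:
  fixes g :: "real \<times> real \<Rightarrow> real"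
  assumes cont: "continuous_on ({-X..X} \<times> {0..T}) g"
    and bdry: "\<And>x t. \<bar>x\<bar> \<le> X \<Longrightarrow> 0 \<le> t \<Longrightarrow> t \<le> T \<Longrightarrow> \<bar>x\<bar> = X \<or> t = 0 \<or> t = T \<Longrightarrow> g (x, t) \<le> 0"
    and pos: "\<bar>x0\<bar> \<le> X" "0 \<le> t0" "t0 \<le> T" "g (x0, t0) > 0"
  obtains x t where "0 < t" "t < T" "\<forall>\<^sub>F z in nhds (x, t). g z \<le> g (x, t)"
proof -
  let ?Q = "{-X..X} \<times> {0..T}"
  have "compact ?Q" by (intro compact_Times compact_Icc)
  moreover have z0: "(x0, t0) \<in> ?Q" using pos by auto
  ultimately obtain z where z: "z \<in> ?Q" "\<forall>w\<in>?Q. g w \<le> g z"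
    using continuous_attains_sup[OF _ _ cont] by (metis empty_iff)
  obtain x t where xt: "z = (x, t)" by force
  have "g (x, t) > 0" using bspec[OF z(2) z0] pos(4) unfolding xt by linarith
  moreover have box: "\<bar>x\<bar> \<le> X" "0 \<le> t" "t \<le> T" using z(1) xt by auto
  ultimately have "\<bar>x\<bar> \<noteq> X" "t \<noteq> 0" "t \<noteq> T"
    using bdry[OF box] by linarith+
  then have in_box: "x \<in> {-X<..<X}" "t \<in> {0<..<T}" using box by auto
  have "\<forall>\<^sub>F w in nhds (x, t). w \<in> {-X<..<X} \<times> {0<..<T}"
    using in_box by (intro eventually_nhds_in_open open_Times) auto
  then have "\<forall>\<^sub>F w in nhds (x, t). g w \<le> g (x, t)"
    using z(2) xt by (auto elim!: eventually_mono)
  then show thesis using that in_box by auto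
qed

text \<open>With the barrier added, Z becomes a strict supersolution. The cross term of the expanded
  square is negative only where the gradient of Z points towards the origin, and there the time
  derivative of the moving barrier pays for it. This is why p is bounded from one side only. The
  barrier is zero on a backward cone that shrinks with speed \<open>M\<close>, and the argument
  stays inside one compact box.\<close>

theorem subsolution_le_classical_supersolution:
  assumes W: "continuous_on (UNIV \<times> {0..}) W" "viscosity_subsolution u W"
    and Z: "continuous_on (UNIV \<times> {0..}) Z"
      "continuous_on (UNIV \<times> {0<..}) p" "continuous_on (UNIV \<times> {0<..}) q"
      "\<And>x t. t > 0 \<Longrightarrow> has_grad Z (p (x, t)) (q (x, t)) (x, t)"
      "\<And>x t. t > 0 \<Longrightarrow> q (x, t) + 1 / 2 * (p (x, t))\<^sup>2 + u x \<ge> 0"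
      "\<And>T. T > 0 \<Longrightarrow> \<exists>M\<ge>0. \<forall>x. \<forall>t\<in>{0<..T}. p (x, t) * x \<ge> - M * \<bar>x\<bar>"
    and init: "\<And>x. W (x, 0) \<le> Z (x, 0)"
    and t: "t \<ge> 0"
  shows "W (x, t) \<le> Z (x, t)"
proof (rule ccontr)
  assume "\<not> W (x, t) \<le> Z (x, t)"
  then have gap: "W (x, t) - Z (x, t) > 0" (is "?d > 0") by simp
  with init[of x] t have t: "t > 0" by (cases "t = 0") auto
  \<comment> \<open>The extra unit of time is for the final-time penalty, which is zero up to
    \<open>t\<close> and reaches its full coefficient at \<open>T\<close>.\<close>
  define T where "T = t + 1"
  obtain M where M: "M \<ge> 0" "\<And>x s. s > 0 \<Longrightarrow> s \<le> T \<Longrightarrow> p (x, s) * x \<ge> - M * \<bar>x\<bar>"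
    using Z(6)[of T] t unfolding T_def by auto
  \<comment> \<open>Half of the gap is spent on strictness at time \<open>t\<close>; the other half
    keeps the penalised difference positive there.\<close>
  define \<epsilon> where "\<epsilon> = ?d / (2 * t)"
  have \<epsilon>: "\<epsilon> > 0" "\<epsilon> * t = ?d / 2" using gap t by (auto simp: \<epsilon>_def)
  \<comment> \<open>The argument of \<open>bump\<close> is then exactly 0 at the point
    \<open>(x, t)\<close>, and at least 1 on the sides of the box, where the absolute value of the
    position is \<open>R + 1\<close>.\<close>
  define R where "R = sqrt (1 + x\<^sup>2) + M * t"
  define X where "X = R + 1"
  let ?Q = "{-X..X} \<times> {0..T}"
  have sub: "?Q \<subseteq> UNIV \<times> {0..}" by auto
  have cWZ: "continuous_on ?Q (\<lambda>z. W z - Z z)"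
    by (intro continuous_intros continuous_on_subset[OF W(1) sub] continuous_on_subset[OF Z(1) sub])
  have "compact ((\<lambda>z. W z - Z z) ` ?Q)"
    by (intro compact_continuous_image cWZ compact_Times compact_Icc)
  then obtain A where A: "A > 0" "\<And>z. z \<in> ?Q \<Longrightarrow> \<bar>W z - Z z\<bar> \<le> A"
    by (auto dest!: compact_imp_bounded simp: bounded_pos)
  \<comment> \<open>On the sides of the box \<open>bump\<close> is at least
    \<open>sqrt 2 - 1\<close>, so this height makes the barrier dominate the bound \<open>A\<close>
    on the difference.\<close>
  define K where "K = A / (sqrt 2 - 1)"
  have s2: "sqrt 2 - 1 > (0::real)" by simp
  have K: "K \<ge> 0" "K * (sqrt 2 - 1) = A" using A s2 by (auto simp: K_def)
  define \<psi> where "\<psi> = barrier K R M \<epsilon> A t"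
  define \<phi> where "\<phi> = (\<lambda>z. Z z + \<psi> z)"
  have \<psi>_nonneg: "\<psi> (y, s) \<ge> 0" if "s \<ge> 0" for y s
    using that K A \<epsilon> bump_nonneg by (simp add: \<psi>_def barrier_def)
  have x_le: "\<bar>x\<bar> \<le> X"
    using abs_le_sqrt_one_add_sq[of x] M(1) t by (simp add: X_def R_def add_increasing2)
  obtain x1 t1 where 1: "0 < t1" "t1 < T"
    "\<forall>\<^sub>F z in nhds (x1, t1). W z - \<phi> z \<le> W (x1, t1) - \<phi> (x1, t1)"
  proof (rule interior_max_exists[where g = "\<lambda>z. W z - \<phi> z" and X = X and T = T and ?x0.0 = x and ?t0.0 = t])
    show "continuous_on ?Q (\<lambda>z. W z - \<phi> z)"
      unfolding \<phi>_def \<psi>_def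
      by (intro continuous_intros continuous_on_barrier continuous_on_subset[OF W(1) sub]
          continuous_on_subset[OF Z(1) sub])
    show "W (y, s) - \<phi> (y, s) \<le> 0"
      if ys: "\<bar>y\<bar> \<le> X" "0 \<le> s" "s \<le> T" "\<bar>y\<bar> = X \<or> s = 0 \<or> s = T" for y s
    proof -
      have "(y, s) \<in> ?Q" using ys(1-3) by (simp add: abs_le_iff)
      note A_ys = A(2)[OF this]
      from ys(4) show ?thesis
      proof (elim disjE)
        assume "\<bar>y\<bar> = X"
        then have "1 \<le> sqrt (1 + y\<^sup>2) - R + M * s"
          using abs_le_sqrt_one_add_sq[of y] M(1) ys by (simp add: X_def add_increasing2)
        then have "A \<le> K * bump (sqrt (1 + y\<^sup>2) - R + M * s)"
          using mult_left_mono[OF bump_ge_1 K(1)] unfolding K(2) by blast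
        moreover have "0 \<le> \<epsilon> * s + A * (max 0 (s - t))\<^sup>2" using \<epsilon> A ys by simp
        ultimately have "A \<le> \<psi> (y, s)" by (simp add: \<psi>_def barrier_def)
        then show ?thesis using A_ys by (simp add: \<phi>_def)
      next
        assume "s = 0"
        then show ?thesis using \<psi>_nonneg[of s y] init[of y] by (simp add: \<phi>_def)
      next
        assume "s = T"
        have "0 \<le> K * bump (sqrt (1 + y\<^sup>2) - R + M * s) + \<epsilon> * s"
          using K(1) \<epsilon>(1) ys(2) bump_nonneg by simp
        then have "A \<le> \<psi> (y, s)"
          using \<open>s = T\<close> by (simp add: \<psi>_def barrier_def T_def)
        then show ?thesis using A_ys by (simp add: \<phi>_def)
      qed
    qed
    show "W (x, t) - \<phi> (x, t) > 0"
      using gap \<epsilon>(2) by (simp add: \<phi>_def \<psi>_def barrier_def R_def)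
  qed (use x_le t in \<open>auto simp: T_def\<close>)
  have grad: "has_grad \<phi> (p z + barrier_x K R M z) (q z + barrier_t K R M \<epsilon> A t z) z"
    if "z \<in> UNIV \<times> {0<..}" for z
    using that unfolding \<phi>_def \<psi>_def
    by (cases z) (auto intro!: has_grad_add has_grad_barrier Z(4))
  have "C1_on (UNIV \<times> {0<..}) \<phi>"
    by (rule C1_onI[OF _ _ grad]) (intro continuous_intros Z continuous_on_barrier_grad)+
  then have "HJ_op u \<phi> x1 t1 \<le> 0"
    using W(2) 1 unfolding viscosity_subsolution_def by blast
  moreover have "HJ_op u \<phi> x1 t1 \<ge> \<epsilon>"
  proof -
    let ?r = "sqrt (1 + x1\<^sup>2)"
    define k where "k = K * bump' (?r - R + M * t1)"
    have k: "k \<ge> 0" using K(1) bump'_bounds by (simp add: k_def)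
    have bx: "barrier_x K R M (x1, t1) = k * (x1 / ?r)"
      by (simp add: barrier_x_def k_def)
    have bt: "barrier_t K R M \<epsilon> A t (x1, t1) \<ge> k * M + \<epsilon>"
      using A(1) by (simp add: barrier_t_def k_def)
    have "p (x1, t1) * (x1 / ?r) = (p (x1, t1) * x1) / ?r" by simp
    also have "\<dots> \<ge> (- M * \<bar>x1\<bar>) / ?r"
      using M(2)[of t1 x1] 1 one_add_sq_pos[of x1] by (intro divide_right_mono) auto
    also have "(- M * \<bar>x1\<bar>) / ?r = - M * \<bar>x1 / ?r\<bar>"
      using one_add_sq_pos[of x1] by simp
    also have "\<dots> \<ge> - M"
      using mult_left_mono[OF abs_div_sqrt_le_1[of x1] M(1)] by linarith
    finally have "k * (M + p (x1, t1) * (x1 / ?r)) \<ge> 0"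
      using k by simp
    moreover have "HJ_op u \<phi> x1 t1 = q (x1, t1) + barrier_t K R M \<epsilon> A t (x1, t1)
        + 1 / 2 * (p (x1, t1) + k * (x1 / ?r))\<^sup>2 + u x1"
      using HJ_op_has_grad[OF grad] 1 bx by simp
    \<comment> \<open>The square of the barrier slope is nonnegative and is dropped. Hence
      \<open>K\<close> may be as large as the box requires, while the speed \<open>M\<close> does
      not depend on it.\<close>
    moreover have "1 / 2 * (p (x1, t1) + k * (x1 / ?r))\<^sup>2
        \<ge> 1 / 2 * (p (x1, t1))\<^sup>2 + k * (p (x1, t1) * (x1 / ?r))"
      using zero_le_power2[of "k * (x1 / ?r)"] by (simp only: power2_sum) argo
    ultimately show ?thesis
      using bt Z(5)[OF 1(1), of x1] unfolding distrib_left by linarith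
  qed
  ultimately show False using \<epsilon>(1) by linarith
qed

text \<open>Here the barrier is subtracted, and the square of its slope works against the
  inequality, so the speed has to exceed the slope of Z by an amount depending on \<open>K\<close>.
  The size of the box depends on that speed, so \<open>K\<close> cannot be read off from the box as
  in the other comparison. It is taken from the linear lower bound on W and the linear upper bound
  on Z.\<close>

theorem supersolution_ge_classical_subsolution:
  assumes W: "continuous_on (UNIV \<times> {0..}) W" "viscosity_supersolution u W"
    and W_lower: "\<And>T. T > 0 \<Longrightarrow> \<exists>C. \<forall>x. \<forall>t\<in>{0..T}. W (x, t) - \<alpha> * x \<ge> C"
    and Z: "continuous_on (UNIV \<times> {0..}) Z"
      "continuous_on (UNIV \<times> {0<..}) p" "continuous_on (UNIV \<times> {0<..}) q"
      "\<And>x t. t > 0 \<Longrightarrow> has_grad Z (p (x, t)) (q (x, t)) (x, t)"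
      "\<And>x t. t > 0 \<Longrightarrow> q (x, t) + 1 / 2 * (p (x, t))\<^sup>2 + u x \<le> 0"
      "\<And>T. T > 0 \<Longrightarrow> \<exists>M\<ge>0. \<forall>x. \<forall>t\<in>{0<..T}. \<bar>p (x, t)\<bar> \<le> M"
      "\<And>T. T > 0 \<Longrightarrow> \<exists>A M. \<forall>x. \<forall>t\<in>{0..T}. Z (x, t) \<le> A + M * \<bar>x\<bar>"
    and init: "\<And>x. Z (x, 0) \<le> W (x, 0)"
    and t: "t \<ge> 0"
  shows "Z (x, t) \<le> W (x, t)"
proof (rule ccontr)
  assume "\<not> Z (x, t) \<le> W (x, t)"
  then have gap: "Z (x, t) - W (x, t) > 0" (is "?d > 0") by simp
  with init[of x] t have t: "t > 0" by (cases "t = 0") auto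
  define T where "T = t + 1"
  have T: "T > 0" using t by (simp add: T_def)
  obtain M where M: "M \<ge> 0" "\<And>y s. s > 0 \<Longrightarrow> s \<le> T \<Longrightarrow> \<bar>p (y, s)\<bar> \<le> M"
    using Z(6)[OF T] by auto
  obtain A B where AB: "\<And>y s. s \<ge> 0 \<Longrightarrow> s \<le> T \<Longrightarrow> Z (y, s) \<le> A + B * \<bar>y\<bar>"
    using Z(7)[OF T] by (metis atLeastAtMost_iff)
  obtain C where C: "\<And>y s. s \<ge> 0 \<Longrightarrow> s \<le> T \<Longrightarrow> C + \<alpha> * y \<le> W (y, s)"
    using W_lower[OF T] by (force simp: algebra_simps)
  define \<epsilon> where "\<epsilon> = ?d / (2 * t)"
  have \<epsilon>: "\<epsilon> > 0" "\<epsilon> * t = ?d / 2" using gap t by (auto simp: \<epsilon>_def)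
  \<comment> \<open>The first two summands absorb the linear growth of Z - W; the spare 1 makes the
    penalised difference tend to minus infinity in space.\<close>
  define K where "K = \<bar>\<alpha>\<bar> + \<bar>B\<bar> + 1"
  \<comment> \<open>\<open>M\<close> pays for the cross term, \<open>K\<close> for the square of the
    barrier slope.\<close>
  define v where "v = M + K"
  define R where "R = sqrt (1 + x\<^sup>2) + v * t"
  have K: "K \<ge> 1" by (simp add: K_def)
  have v: "v \<ge> 0" using K M by (simp add: v_def)
  \<comment> \<open>\<open>N\<close> collects the constants that remain once \<open>K\<close> has
    absorbed the linear terms, which leaves the bound \<open>N - \<bar>y\<bar>\<close>. So
    \<open>X \<ge> \<bar>N\<bar>\<close> settles the sides of the box and
    \<open>L = \<bar>N\<bar>\<close> settles its top.\<close>
  define N where "N = A - C + K * (R + 1)"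
  define X where "X = max \<bar>x\<bar> \<bar>N\<bar>"
  define L where "L = \<bar>N\<bar>"
  let ?Q = "{-X..X} \<times> {0..T}"
  have sub: "?Q \<subseteq> UNIV \<times> {0..}" by auto
  define \<psi> where "\<psi> = barrier K R v \<epsilon> L t"
  define \<phi> where "\<phi> = (\<lambda>z. Z z - \<psi> z)"
  have \<psi>_nonneg: "\<psi> (y, s) \<ge> 0" if "s \<ge> 0" for y s
    using that K \<epsilon> bump_nonneg by (simp add: \<psi>_def barrier_def L_def)
  have coercive: "\<phi> (y, s) - W (y, s) \<le> N - \<bar>y\<bar> - L * (max 0 (s - t))\<^sup>2" if s: "s \<ge> 0" "s \<le> T" for y s
  proof -
    have "K * (sqrt (1 + y\<^sup>2) - R + v * s - 1) \<le> K * bump (sqrt (1 + y\<^sup>2) - R + v * s)"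
      using K bump_ge by (intro mult_left_mono) auto
    moreover have "K * (\<bar>y\<bar> - R - 1) \<le> K * (sqrt (1 + y\<^sup>2) - R + v * s - 1)"
      using K abs_le_sqrt_one_add_sq[of y] v s by (intro mult_left_mono) (simp_all add: add_increasing2)
    moreover have "B * \<bar>y\<bar> \<le> \<bar>B\<bar> * \<bar>y\<bar>" by (intro mult_right_mono) auto
    moreover have "- (\<alpha> * y) \<le> \<bar>\<alpha>\<bar> * \<bar>y\<bar>" by (metis abs_ge_minus_self abs_mult)
    moreover have "0 \<le> \<epsilon> * s" using \<epsilon> s by simp
    ultimately show ?thesis
      using AB[OF s, of y] C[OF s, of y]
      by (simp add: \<phi>_def \<psi>_def barrier_def N_def K_def algebra_simps)
  qed
  obtain x1 t1 where 1: "0 < t1" "t1 < T"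
    "\<forall>\<^sub>F z in nhds (x1, t1). \<phi> z - W z \<le> \<phi> (x1, t1) - W (x1, t1)"
  proof (rule interior_max_exists[where g = "\<lambda>z. \<phi> z - W z" and X = X and T = T and ?x0.0 = x and ?t0.0 = t])
    show "continuous_on ?Q (\<lambda>z. \<phi> z - W z)"
      unfolding \<phi>_def \<psi>_def
      by (intro continuous_intros continuous_on_barrier continuous_on_subset[OF W(1) sub]
          continuous_on_subset[OF Z(1) sub])
    show "\<phi> (y, s) - W (y, s) \<le> 0"
      if ys: "\<bar>y\<bar> \<le> X" "0 \<le> s" "s \<le> T" "\<bar>y\<bar> = X \<or> s = 0 \<or> s = T" for y s
      using ys(4)
    proof (elim disjE)
      assume "\<bar>y\<bar> = X"
      moreover have "0 \<le> L * (max 0 (s - t))\<^sup>2" by (simp add: L_def)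
      ultimately show ?thesis using coercive[OF ys(2,3), of y] by (simp add: X_def)
    next
      assume "s = 0"
      then show ?thesis using \<psi>_nonneg[of s y] init[of y] by (simp add: \<phi>_def)
    next
      assume "s = T"
      then show ?thesis using coercive[OF ys(2,3), of y] by (simp add: T_def L_def)
    qed
    show "\<phi> (x, t) - W (x, t) > 0"
      using gap \<epsilon>(2) by (simp add: \<phi>_def \<psi>_def barrier_def R_def)
  qed (use t in \<open>auto simp: T_def X_def\<close>)
  have grad: "has_grad \<phi> (p z - barrier_x K R v z) (q z - barrier_t K R v \<epsilon> L t z) z"
    if "z \<in> UNIV \<times> {0<..}" for z
    using that unfolding \<phi>_def \<psi>_def
    by (cases z) (auto intro!: has_grad_diff has_grad_barrier Z(4))
  have C1: "C1_on (UNIV \<times> {0<..}) \<phi>"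
    by (rule C1_onI[OF _ _ grad]) (intro continuous_intros Z continuous_on_barrier_grad)+
  have "\<forall>\<^sub>F z in nhds (x1, t1). W z - \<phi> z \<ge> W (x1, t1) - \<phi> (x1, t1)"
    using 1(3) by eventually_elim linarith
  then have "HJ_op u \<phi> x1 t1 \<ge> 0"
    using W(2) 1 C1 unfolding viscosity_supersolution_def by blast
  moreover have "HJ_op u \<phi> x1 t1 \<le> - \<epsilon>"
  proof -
    let ?r = "sqrt (1 + x1\<^sup>2)"
    define k where "k = K * bump' (?r - R + v * t1)"
    define e where "e = x1 / ?r"
    have k: "0 \<le> k" "k \<le> K"
      using K bump'_bounds mult_left_mono[of "bump' (?r - R + v * t1)" 1 K] by (simp_all add: k_def)
    have e: "\<bar>e\<bar> \<le> 1" unfolding e_def by (rule abs_div_sqrt_le_1)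
    have bx: "barrier_x K R v (x1, t1) = k * e"
      by (simp add: barrier_x_def k_def e_def)
    have bt: "barrier_t K R v \<epsilon> L t (x1, t1) \<ge> k * v + \<epsilon>"
      by (simp add: barrier_t_def k_def L_def)
    have "\<bar>p (x1, t1) * e\<bar> \<le> M * 1"
      unfolding abs_mult using M(2)[of t1 x1] 1 e M(1) by (intro mult_mono) auto
    then have "k * - (p (x1, t1) * e) \<le> k * M"
      using k(1) by (intro mult_left_mono) auto
    \<comment> \<open>The square is bounded by a multiple of \<open>k\<close>, since what absorbs
      it, the time derivative of the barrier, is also proportional to \<open>k\<close>.\<close>
    moreover have "(k * e)\<^sup>2 \<le> k * K"
    proof -
      have "e\<^sup>2 \<le> 1" using e by (simp add: abs_square_le_1)
      then have "k\<^sup>2 * e\<^sup>2 \<le> k\<^sup>2 * 1" by (intro mult_left_mono) auto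
      also have "k\<^sup>2 * 1 \<le> k * K" using k by (simp add: power2_eq_square mult_left_mono)
      finally show ?thesis by (simp add: power_mult_distrib)
    qed
    moreover have "HJ_op u \<phi> x1 t1 = q (x1, t1) - barrier_t K R v \<epsilon> L t (x1, t1)
        + 1 / 2 * (p (x1, t1) - k * e)\<^sup>2 + u x1"
      using HJ_op_has_grad[OF grad] 1 bx by simp
    moreover have "(p (x1, t1) - k * e)\<^sup>2 = (p (x1, t1))\<^sup>2 - 2 * (k * (p (x1, t1) * e)) + (k * e)\<^sup>2"
      by (simp add: power2_diff)
    moreover have "0 \<le> k * K" using k(1) K by simp
    ultimately show ?thesis
      using bt Z(5)[OF 1(1), of x1] unfolding v_def distrib_left mult_minus_right by argo
  qed
  ultimately show False using \<epsilon>(1) by linarith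
qed

section \<open>The explicit solutions with linear initial data\<close>

text \<open>The odd extension of \<open>u powr (3 / 2)\<close> is continuously differentiable on the whole line.\<close>

definition pow32 :: "real \<Rightarrow> real" where
  "pow32 u = u * sqrt \<bar>u\<bar>"

lemma powr_three_halves:
  assumes "0 \<le> u"
  shows "u powr (3 / 2) = pow32 u"
proof (cases "u = 0")
  case False
  then have "u powr (1 + 1 / 2) = u powr 1 * u powr (1 / 2)" by (simp only: powr_add)
  then show ?thesis using assms False by (simp add: powr_half_sqrt pow32_def)
qed (simp add: pow32_def)

lemma DERIV_pow32: "(pow32 has_real_derivative 3 / 2 * sqrt \<bar>u\<bar>) (at u)"
proof (cases u "0::real" rule: linorder_cases)
  case less
  have "sqrt (- u) * sqrt (- u) = - u" using less by simp
  then have "((\<lambda>u. u * sqrt (- u)) has_real_derivative 3 / 2 * sqrt \<bar>u\<bar>) (at u)"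
    using less by (auto intro!: derivative_eq_intros simp: field_simps)
  then show ?thesis
    by (rule has_field_derivative_transform_within_open[of _ _ _ "{..<0}"])
       (use less in \<open>auto simp: pow32_def\<close>)
next
  case greater
  have "sqrt u * sqrt u = u" using greater by simp
  then have "((\<lambda>u. u * sqrt u) has_real_derivative 3 / 2 * sqrt \<bar>u\<bar>) (at u)"
    using greater by (auto intro!: derivative_eq_intros simp: field_simps)
  then show ?thesis
    by (rule has_field_derivative_transform_within_open[of _ _ _ "{0<..}"])
       (use greater in \<open>auto simp: pow32_def\<close>)
next
  case equal
  have "((\<lambda>h::real. sqrt \<bar>h\<bar>) \<longlongrightarrow> sqrt \<bar>0\<bar>) (at 0)"
    by (intro tendsto_real_sqrt tendsto_rabs tendsto_ident_at)
  then have "((\<lambda>h. (pow32 (0 + h) - pow32 0) / h) \<longlongrightarrow> sqrt \<bar>0\<bar>) (at 0)"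
    by (rule Lim_transform_eventually) (auto simp: pow32_def eventually_at intro!: exI[of _ 1])
  then show ?thesis using equal by (simp add: DERIV_def)
qed

lemma has_derivative_pow32 [derivative_intros]:
  assumes "(g has_derivative g') (at z within S)"
  shows "((\<lambda>z. pow32 (g z)) has_derivative (\<lambda>h. g' h * (3 / 2 * sqrt \<bar>g z\<bar>))) (at z within S)"
  using has_derivative_compose[OF assms DERIV_pow32[of "g z", unfolded has_field_derivative_def]]
  by (simp add: mult.commute)

lemma continuous_on_pow32 [continuous_intros]:
  "continuous_on S f \<Longrightarrow> continuous_on S (\<lambda>z. pow32 (f z))"
  unfolding pow32_def by (intro continuous_intros)

text \<open>As for \<open>F4\<close> and \<open>F5\<close> below, the power of the original formula
  is replaced by its odd extension. The formula is then differentiable on both sides of every edge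
  of its region, as gluing requires.\<close>

definition F3 :: "real \<Rightarrow> real \<Rightarrow> real \<Rightarrow> real \<Rightarrow> real \<Rightarrow> real" where
  "F3 a b x t p =
     (a + b) / (3 * (a + 2 * b)\<^sup>2) *
       ((b * t - p)^3 + pow32 ((b * t - p)\<^sup>2 + 2 * x * (a + 2 * b)))
     - b / (a + 2 * b) * (b * t - p) * x
     - b\<^sup>2 / 6 * t^3 + b / 2 * p * t\<^sup>2 - 1 / 2 * p\<^sup>2 * t"

definition F4 :: "real \<Rightarrow> real \<Rightarrow> real \<Rightarrow> real \<Rightarrow> real \<Rightarrow> real" where
  "F4 a b x t p = a\<^sup>2 / 3 * pow32 (2 * x / a) - p^3 / (6 * b)"

definition F5 :: "real \<Rightarrow> real \<Rightarrow> real \<Rightarrow> real \<Rightarrow> real \<Rightarrow> real" where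
  "F5 a b x t p = b\<^sup>2 / 3 * pow32 (- 2 * x / b) - p^3 / (6 * b)"

text \<open>The spatial derivatives of the five formulas.\<close>

definition m1 :: "real \<Rightarrow> real \<Rightarrow> real \<Rightarrow> real \<Rightarrow> real \<Rightarrow> real" where
  "m1 a b x t p = p + a * t"

definition m2 :: "real \<Rightarrow> real \<Rightarrow> real \<Rightarrow> real \<Rightarrow> real \<Rightarrow> real" where
  "m2 a b x t p = p - b * t"

definition m3 :: "real \<Rightarrow> real \<Rightarrow> real \<Rightarrow> real \<Rightarrow> real \<Rightarrow> real" where
  "m3 a b x t p =
     ((a + b) * sqrt \<bar>(b * t - p)\<^sup>2 + 2 * x * (a + 2 * b)\<bar> - b * (b * t - p)) / (a + 2 * b)"

definition m4 :: "real \<Rightarrow> real \<Rightarrow> real \<Rightarrow> real \<Rightarrow> real \<Rightarrow> real" where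
  "m4 a b x t p = a * sqrt \<bar>2 * x / a\<bar>"

definition m5 :: "real \<Rightarrow> real \<Rightarrow> real \<Rightarrow> real \<Rightarrow> real \<Rightarrow> real" where
  "m5 a b x t p = - b * sqrt \<bar>- 2 * x / b\<bar>"

text \<open>The momentum along a characteristic grows at rate a to the right of the origin and falls
  at rate b to the left. Regions 1 and 2 contain characteristics that have stayed on one side,
  region 3 those that crossed from left to right. Regions 4 and 5 are filled by trajectories that
  reach the unstable equilibrium 0 at rest at time p / b, wait there and leave with zero energy:
  \<open>m\<^sup>2 / 2 + U = 0\<close>.\<close>

definition momentum_nonneg :: "real \<Rightarrow> real \<Rightarrow> real \<Rightarrow> real \<Rightarrow> real \<Rightarrow> real" where
  "momentum_nonneg x t p a b =
    (if (x, t, p) \<in> Omega1 a b then m1 a b x t p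
     else if (x, t, p) \<in> Omega2 a b then m2 a b x t p
     else if (x, t, p) \<in> Omega3 a b then m3 a b x t p
     else if (x, t, p) \<in> Omega4 a b then m4 a b x t p
     else m5 a b x t p)"

text \<open>
  Closed versions of the regions, with denominators cleared. The formulas agree where they
  overlap.
\<close>

definition cell1 :: "real \<Rightarrow> real \<Rightarrow> (real \<times> real \<times> real) set" where
  "cell1 a b = {(x, t, p). 0 \<le> t \<and> 0 \<le> p \<and> p * t + a / 2 * t\<^sup>2 \<le> x}"

definition cell2 :: "real \<Rightarrow> real \<Rightarrow> (real \<times> real \<times> real) set" where
  "cell2 a b = {(x, t, p). 0 \<le> t \<and> 0 \<le> p \<and> x \<le> 0 \<and> (b * t \<le> p \<or> 2 * b * x \<le> - (b * t - p)\<^sup>2)}"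

definition cell3 :: "real \<Rightarrow> real \<Rightarrow> (real \<times> real \<times> real) set" where
  "cell3 a b = {(x, t, p). 0 \<le> t \<and> 0 \<le> p \<and> 0 \<le> x \<and> x \<le> p * t + a / 2 * t\<^sup>2 \<and>
     (b * t \<le> p \<or> a * (b * t - p)\<^sup>2 \<le> 2 * b\<^sup>2 * x)}"

definition cell4 :: "real \<Rightarrow> real \<Rightarrow> (real \<times> real \<times> real) set" where
  "cell4 a b = {(x, t, p). 0 \<le> t \<and> 0 \<le> p \<and> 0 \<le> x \<and> p \<le> b * t \<and> 2 * b\<^sup>2 * x \<le> a * (b * t - p)\<^sup>2}"

definition cell5 :: "real \<Rightarrow> real \<Rightarrow> (real \<times> real \<times> real) set" where
  "cell5 a b = {(x, t, p). 0 \<le> t \<and> 0 \<le> p \<and> x \<le> 0 \<and> p \<le> b * t \<and> - (b * t - p)\<^sup>2 \<le> 2 * b * x}"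

lemmas cell_defs = cell1_def cell2_def cell3_def cell4_def cell5_def

lemma Omega_mem:
  assumes "a > 0" "b > 0"
  shows "(x, t, p) \<in> Omega1 a b \<longleftrightarrow> 0 \<le> t \<and> 0 \<le> p \<and> p * t + a / 2 * t\<^sup>2 \<le> x"
    and "(x, t, p) \<in> Omega2 a b \<longleftrightarrow> 0 \<le> t \<and> 0 \<le> p \<and>
      (x < 0 \<and> b * t < p \<or> 2 * b * x < - (b * t - p)\<^sup>2 \<and> p \<le> b * t)"
    and "(x, t, p) \<in> Omega3 a b \<longleftrightarrow> 0 \<le> t \<and> 0 \<le> p \<and> x < p * t + a / 2 * t\<^sup>2 \<and>
      (0 \<le> x \<and> b * t < p \<or> a * (b * t - p)\<^sup>2 \<le> 2 * b\<^sup>2 * x \<and> p \<le> b * t)"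
    and "(x, t, p) \<in> Omega4 a b \<longleftrightarrow> 0 \<le> t \<and> 0 \<le> p \<and>
      0 \<le> x \<and> 2 * b\<^sup>2 * x < a * (b * t - p)\<^sup>2 \<and> p \<le> b * t"
    and "(x, t, p) \<in> Omega5 a b \<longleftrightarrow> 0 \<le> t \<and> 0 \<le> p \<and>
      - (b * t - p)\<^sup>2 \<le> 2 * b * x \<and> x < 0 \<and> p \<le> b * t"
proof -
  have 1: "t < p / b \<longleftrightarrow> b * t < p" "p / b \<le> t \<longleftrightarrow> p \<le> b * t"
    using assms by (simp_all add: field_simps)
  have sq: "(t - p / b)\<^sup>2 = (b * t - p)\<^sup>2 / b\<^sup>2"
    using assms by (simp add: field_simps power2_eq_square)
  have 2: "- (b / 2) * (t - p / b)\<^sup>2 = - (b * t - p)\<^sup>2 / (2 * b)"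
    unfolding sq using assms by (simp add: field_simps power2_eq_square)
  have 3: "a / 2 * (t - p / b)\<^sup>2 = a * (b * t - p)\<^sup>2 / (2 * b\<^sup>2)"
    unfolding sq using assms by (simp add: field_simps)
  have 4: "x < - (b * t - p)\<^sup>2 / (2 * b) \<longleftrightarrow> 2 * b * x < - (b * t - p)\<^sup>2"
    "- (b * t - p)\<^sup>2 / (2 * b) \<le> x \<longleftrightarrow> - (b * t - p)\<^sup>2 \<le> 2 * b * x"
    using assms by (simp_all add: field_simps)
  have 5: "x < a * (b * t - p)\<^sup>2 / (2 * b\<^sup>2) \<longleftrightarrow> 2 * b\<^sup>2 * x < a * (b * t - p)\<^sup>2"
    "a * (b * t - p)\<^sup>2 / (2 * b\<^sup>2) \<le> x \<longleftrightarrow> a * (b * t - p)\<^sup>2 \<le> 2 * b\<^sup>2 * x"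
    using assms by (simp_all add: pos_less_divide_eq pos_divide_le_eq mult_ac)
  note defs = Omega1_def Omega2_def Omega3_def Omega4_def Omega5_def mem_Collect_eq case_prod_conv
    1 2 3 4 5
  show "(x, t, p) \<in> Omega1 a b \<longleftrightarrow> 0 \<le> t \<and> 0 \<le> p \<and> p * t + a / 2 * t\<^sup>2 \<le> x"
    "(x, t, p) \<in> Omega2 a b \<longleftrightarrow> 0 \<le> t \<and> 0 \<le> p \<and>
      (x < 0 \<and> b * t < p \<or> 2 * b * x < - (b * t - p)\<^sup>2 \<and> p \<le> b * t)"
    "(x, t, p) \<in> Omega3 a b \<longleftrightarrow> 0 \<le> t \<and> 0 \<le> p \<and> x < p * t + a / 2 * t\<^sup>2 \<and>
      (0 \<le> x \<and> b * t < p \<or> a * (b * t - p)\<^sup>2 \<le> 2 * b\<^sup>2 * x \<and> p \<le> b * t)"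
    "(x, t, p) \<in> Omega4 a b \<longleftrightarrow> 0 \<le> t \<and> 0 \<le> p \<and>
      0 \<le> x \<and> 2 * b\<^sup>2 * x < a * (b * t - p)\<^sup>2 \<and> p \<le> b * t"
    "(x, t, p) \<in> Omega5 a b \<longleftrightarrow> 0 \<le> t \<and> 0 \<le> p \<and>
      - (b * t - p)\<^sup>2 \<le> 2 * b * x \<and> x < 0 \<and> p \<le> b * t"
    unfolding defs by blast+
qed

lemma f3_eq_F3:
  assumes "a > 0" "b > 0" "0 \<le> x"
  shows "f3 a b x t p = F3 a b x t p"
  using assms by (simp add: f3_def F3_def powr_three_halves)

lemma f4_eq_F4:
  assumes "a > 0" "0 \<le> x"
  shows "f4 a b x t p = F4 a b x t p"
  using assms by (simp add: f4_def F4_def powr_three_halves)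

lemma f5_eq_F5:
  assumes "b > 0" "x \<le> 0"
  shows "f5 a b x t p = F5 a b x t p"
proof -
  have "0 \<le> - 2 * x / b" using assms by (intro divide_nonneg_pos) auto
  from powr_three_halves[OF this] show ?thesis unfolding f5_def F5_def by simp
qed

section \<open>Agreement of values and slopes on shared edges\<close>

lemma overlap_12:
  "x = 0 \<Longrightarrow> t = 0 \<Longrightarrow> f1 a b x t p = f2 a b x t p \<and> m1 a b x t p = m2 a b x t p"
  by (simp add: f1_def f2_def m1_def m2_def)

text \<open>On this edge the radicand is a perfect square, so that values and slopes become rational
  expressions. The same happens on the other edges where a root survives.\<close>

lemma overlap_13:
  assumes "a > 0" "b > 0" "0 \<le> t" "0 \<le> p" "x = p * t + a / 2 * t\<^sup>2"
  shows "f1 a b x t p = F3 a b x t p \<and> m1 a b x t p = m3 a b x t p"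
proof -
  have D: "(b * t - p)\<^sup>2 + 2 * x * (a + 2 * b) = (p + (a + b) * t)\<^sup>2"
    unfolding assms(5) by (simp add: power2_eq_square algebra_simps)
  have s: "sqrt \<bar>(p + (a + b) * t)\<^sup>2\<bar> = p + (a + b) * t" using assms by simp
  have n: "a + 2 * b \<noteq> 0" using assms by simp
  have "m1 a b x t p = m3 a b x t p"
    unfolding m3_def D s m1_def using n by (simp add: field_simps)
  moreover have "f1 a b x t p = F3 a b x t p"
    unfolding F3_def D pow32_def s f1_def unfolding assms(5) using n
    by (simp add: divide_simps) algebra
  ultimately show ?thesis by simp
qed

lemma overlap_14:
  assumes "a > 0" "0 \<le> t" "p = 0" "x = a / 2 * t\<^sup>2"
  shows "f1 a b x t p = F4 a b x t p \<and> m1 a b x t p = m4 a b x t p"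
proof -
  have D: "2 * x / a = t\<^sup>2" unfolding assms(4) using assms(1) by simp
  have s: "sqrt \<bar>t\<^sup>2\<bar> = t" using assms by simp
  show ?thesis
    unfolding F4_def m4_def D pow32_def s f1_def m1_def unfolding assms(3,4)
    by (simp add: power2_eq_square power3_eq_cube)
qed

lemma overlap_15:
  "x = 0 \<Longrightarrow> t = 0 \<Longrightarrow> p = 0 \<Longrightarrow> f1 a b x t p = F5 a b x t p \<and> m1 a b x t p = m5 a b x t p"
  by (simp add: f1_def F5_def m1_def m5_def pow32_def)

lemma overlap_23:
  assumes "a > 0" "b > 0" "x = 0" "b * t \<le> p"
  shows "F3 a b x t p = f2 a b x t p \<and> m3 a b x t p = m2 a b x t p"
proof -
  have D: "(b * t - p)\<^sup>2 + 2 * x * (a + 2 * b) = (p - b * t)\<^sup>2"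
    unfolding assms(3) by (simp add: power2_eq_square algebra_simps)
  have s: "sqrt \<bar>(p - b * t)\<^sup>2\<bar> = p - b * t" using assms by simp
  have n: "a + 2 * b \<noteq> 0" using assms by simp
  have "m3 a b x t p = m2 a b x t p"
    unfolding m3_def D s m2_def using n by (simp add: field_simps)
  moreover have "F3 a b x t p = f2 a b x t p"
    unfolding F3_def D pow32_def s f2_def unfolding assms(3) using n
    by (simp add: divide_simps) algebra
  ultimately show ?thesis by simp
qed

lemma overlap_25:
  assumes "b > 0" "p \<le> b * t" "2 * b * x = - (b * t - p)\<^sup>2"
  shows "F5 a b x t p = f2 a b x t p \<and> m5 a b x t p = m2 a b x t p"
proof -
  have x: "x = - (b * t - p)\<^sup>2 / (2 * b)" using assms by (simp add: field_simps)
  have D: "- 2 * x / b = ((b * t - p) / b)\<^sup>2"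
    unfolding x using assms by (simp add: power_divide) (simp add: power2_eq_square)
  have s: "sqrt \<bar>((b * t - p) / b)\<^sup>2\<bar> = (b * t - p) / b" using assms by simp
  have "m5 a b x t p = m2 a b x t p"
    unfolding m5_def D s m2_def using assms by (simp add: field_simps)
  moreover have "F5 a b x t p = f2 a b x t p"
    unfolding F5_def D pow32_def s f2_def unfolding x using assms(1)
    by (simp add: divide_simps) algebra
  ultimately show ?thesis by simp
qed

lemma overlap_34:
  assumes "a > 0" "b > 0" "p \<le> b * t" "2 * b\<^sup>2 * x = a * (b * t - p)\<^sup>2"
  shows "F3 a b x t p = F4 a b x t p \<and> m3 a b x t p = m4 a b x t p"
proof -
  \<comment> \<open>\<open>r = t - p / b\<close> is the time elapsed since the momentum vanished;
    the edge is the parabola \<open>x = a / 2 * r\<^sup>2\<close> of acceleration from rest at the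
    origin.\<close>
  define r where "r = (b * t - p) / b"
  have B: "b * t - p = b * r" using assms by (simp add: r_def)
  have p: "p = b * t - b * r" using B by simp
  have r: "r \<ge> 0" using assms by (simp add: r_def)
  have x: "x = a / 2 * r\<^sup>2"
    using assms(1,2) assms(4)[unfolded B] by (simp add: power_mult_distrib)
  have D: "(b * r)\<^sup>2 + 2 * x * (a + 2 * b) = ((a + b) * r)\<^sup>2"
    unfolding x by (simp add: power2_eq_square algebra_simps)
  have s: "sqrt \<bar>((a + b) * r)\<^sup>2\<bar> = (a + b) * r" using assms r by simp
  have D': "2 * x / a = r\<^sup>2" using assms by (simp add: x)
  have s': "sqrt \<bar>r\<^sup>2\<bar> = r" using r by simp
  have n: "a + 2 * b \<noteq> 0" using assms by simp
  have "m3 a b x t p = m4 a b x t p"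
    unfolding m3_def m4_def B D s D' s' using n by (simp add: field_simps)
  moreover have "F3 a b x t p = F4 a b x t p"
    unfolding F3_def F4_def B D D' pow32_def s s' unfolding x p using n assms(1,2)
    by (simp add: divide_simps) algebra
  ultimately show ?thesis by simp
qed

lemma overlap_35:
  assumes "b > 0" "x = 0" "p = b * t"
  shows "F3 a b x t p = F5 a b x t p \<and> m3 a b x t p = m5 a b x t p"
  using assms by (simp add: F3_def F5_def pow32_def m3_def m5_def) (simp add: power2_eq_square power3_eq_cube)

lemma overlap_45:
  "x = 0 \<Longrightarrow> F4 a b x t p = F5 a b x t p \<and> m4 a b x t p = m5 a b x t p"
  by (simp add: F4_def F5_def pow32_def m4_def m5_def)

text \<open>A point of a closed cell lies in the region of the same number or on an edge shared with
  another region, where the overlap identities apply. From here on the strict inequalities in the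
  regions can be forgotten: continuity, differentiability and monotonicity are all glued along the
  cells.\<close>

lemma V_nonneg_on_cells:
  assumes "a > 0" "b > 0"
  shows "(x, t, p) \<in> cell1 a b \<Longrightarrow>
      V_nonneg x t p a b = f1 a b x t p \<and> momentum_nonneg x t p a b = m1 a b x t p"
    and "(x, t, p) \<in> cell2 a b \<Longrightarrow>
      V_nonneg x t p a b = f2 a b x t p \<and> momentum_nonneg x t p a b = m2 a b x t p"
    and "(x, t, p) \<in> cell3 a b \<Longrightarrow>
      V_nonneg x t p a b = F3 a b x t p \<and> momentum_nonneg x t p a b = m3 a b x t p"
    and "(x, t, p) \<in> cell4 a b \<Longrightarrow>
      V_nonneg x t p a b = F4 a b x t p \<and> momentum_nonneg x t p a b = m4 a b x t p"
    and "(x, t, p) \<in> cell5 a b \<Longrightarrow>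
      V_nonneg x t p a b = F5 a b x t p \<and> momentum_nonneg x t p a b = m5 a b x t p"
proof -
  note mem = Omega_mem[OF assms]
  let ?V = "V_nonneg x t p a b" and ?m = "momentum_nonneg x t p a b"
  let ?O1 = "(x, t, p) \<in> Omega1 a b" and ?O2 = "(x, t, p) \<in> Omega2 a b"
  let ?O3 = "(x, t, p) \<in> Omega3 a b" and ?O4 = "(x, t, p) \<in> Omega4 a b"
  let ?O5 = "(x, t, p) \<in> Omega5 a b"
  have disj: "?O1 \<and> ?O2 \<longrightarrow> False" "?O1 \<and> ?O3 \<longrightarrow> False" "?O1 \<and> ?O4 \<longrightarrow> False"
    "?O1 \<and> ?O5 \<longrightarrow> False" "?O2 \<and> ?O3 \<longrightarrow> False" "?O2 \<and> ?O4 \<longrightarrow> False"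
    "?O2 \<and> ?O5 \<longrightarrow> False" "?O3 \<and> ?O4 \<longrightarrow> False" "?O3 \<and> ?O5 \<longrightarrow> False"
    "?O4 \<and> ?O5 \<longrightarrow> False"
  proof -
    have "i \<noteq> j \<longrightarrow> i < 5 \<longrightarrow> j < 5 \<longrightarrow>
        [Omega1 a b, Omega2 a b, Omega3 a b, Omega4 a b, Omega5 a b] ! i
        \<inter> [Omega1 a b, Omega2 a b, Omega3 a b, Omega4 a b, Omega5 a b] ! j = {}" for i j
      using Omega_partition(2)[OF assms] by (auto simp: disjoint_family_on_def)
    from this[of 0 1] this[of 0 2] this[of 0 3] this[of 0 4] this[of 1 2] this[of 1 3]
      this[of 1 4] this[of 2 3] this[of 2 4] this[of 3 4]
    show "?O1 \<and> ?O2 \<longrightarrow> False" "?O1 \<and> ?O3 \<longrightarrow> False" "?O1 \<and> ?O4 \<longrightarrow> False"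
      "?O1 \<and> ?O5 \<longrightarrow> False" "?O2 \<and> ?O3 \<longrightarrow> False" "?O2 \<and> ?O4 \<longrightarrow> False"
      "?O2 \<and> ?O5 \<longrightarrow> False" "?O3 \<and> ?O4 \<longrightarrow> False" "?O3 \<and> ?O5 \<longrightarrow> False"
      "?O4 \<and> ?O5 \<longrightarrow> False"
      by auto
  qed
  have cases: "?O1 \<or> ?O2 \<or> ?O3 \<or> ?O4 \<or> ?O5" if "0 \<le> t" "0 \<le> p"
  proof -
    have "(x, t, p) \<in> Omega1 a b \<union> Omega2 a b \<union> Omega3 a b \<union> Omega4 a b \<union> Omega5 a b"
      unfolding Omega_partition(1)[OF assms] using that by simp
    then show ?thesis by blast
  qed
  have V1: "?V = f1 a b x t p \<and> ?m = m1 a b x t p" if ?O1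
    using that disj by (simp add: V_nonneg_def momentum_nonneg_def)
  have V2: "?V = f2 a b x t p \<and> ?m = m2 a b x t p" if ?O2
    using that disj by (auto simp: V_nonneg_def momentum_nonneg_def)
  have V3: "?V = F3 a b x t p \<and> ?m = m3 a b x t p" if ?O3
  proof -
    have "0 \<le> x"
    proof (cases "b * t < p")
      case False
      then have "a * (b * t - p)\<^sup>2 \<le> 2 * b\<^sup>2 * x" using that mem(3) by blast
      moreover have "0 \<le> a * (b * t - p)\<^sup>2" using assms by simp
      ultimately have "0 \<le> 2 * b\<^sup>2 * x" by linarith
      then show ?thesis using assms by (simp add: zero_le_mult_iff)
    qed (use that mem(3) in auto)
    then show ?thesis
      using that disj by (auto simp: V_nonneg_def momentum_nonneg_def f3_eq_F3[OF assms])
  qed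
  have V4: "?V = F4 a b x t p \<and> ?m = m4 a b x t p" if ?O4
    using that disj mem(4) by (auto simp: V_nonneg_def momentum_nonneg_def f4_eq_F4[OF assms(1)])
  have V5: "?V = F5 a b x t p \<and> ?m = m5 a b x t p" if ?O5
    using that disj mem(5) by (auto simp: V_nonneg_def momentum_nonneg_def f5_eq_F5[OF assms(2)])
  have bx: "b * x \<le> 0 \<longleftrightarrow> x \<le> 0" "b * x < 0 \<longleftrightarrow> x < 0"
    using assms by (simp_all add: mult_le_0_iff mult_less_0_iff)
  have O1D: "t = 0" "x = 0" if "?O1" "x \<le> 0"
  proof -
    have "0 \<le> p * t" "0 \<le> a / 2 * t\<^sup>2" using that mem(1) assms by auto
    moreover have "p * t + a / 2 * t\<^sup>2 \<le> x" using that(1) unfolding mem(1) by blast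
    ultimately have "a / 2 * t\<^sup>2 = 0" "x = 0" using that(2) by linarith+
    then show "t = 0" "x = 0" using assms by auto
  qed
  show "?V = f1 a b x t p \<and> ?m = m1 a b x t p" if "(x, t, p) \<in> cell1 a b"
    using that V1 mem(1) by (simp add: cell1_def)
  show "?V = f2 a b x t p \<and> ?m = m2 a b x t p" if c: "(x, t, p) \<in> cell2 a b"
  proof -
    have c: "0 \<le> t" "0 \<le> p" "x \<le> 0" "b * t \<le> p \<or> 2 * b * x \<le> - (b * t - p)\<^sup>2"
      using c by (auto simp: cell2_def)
    from cases[OF c(1,2)] consider ?O1 | ?O2 | ?O3 | ?O4 | ?O5 by blast
    then show ?thesis
    proof cases
      case 1
      then show ?thesis using V1 O1D[OF 1 c(3)] overlap_12 by metis
    next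
      case 2
      then show ?thesis by (rule V2)
    next
      case 3
      from 3 have "0 \<le> x \<and> b * t < p \<or> a * (b * t - p)\<^sup>2 \<le> 2 * b\<^sup>2 * x \<and> p \<le> b * t"
        unfolding mem(3) by blast
      then have "x = 0 \<and> b * t \<le> p"
      proof
        assume *: "a * (b * t - p)\<^sup>2 \<le> 2 * b\<^sup>2 * x \<and> p \<le> b * t"
        moreover have "0 \<le> a * (b * t - p)\<^sup>2" using assms by simp
        moreover have "2 * b\<^sup>2 * x \<le> 0" using c(3) by (simp add: mult_le_0_iff)
        ultimately have "a * (b * t - p)\<^sup>2 = 0" "2 * b\<^sup>2 * x = 0" by linarith+
        then show ?thesis using assms by simp
      qed (use c(3) in simp)
      then show ?thesis using V3[OF 3] overlap_23[OF assms] by simp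
    next
      case 4
      then have "x = 0" "p \<le> b * t" "0 < a * (b * t - p)\<^sup>2" using mem(4) c(3) by auto
      then have "b * t \<noteq> p" "0 < (b * t - p)\<^sup>2" by auto
      then show ?thesis using \<open>x = 0\<close> \<open>p \<le> b * t\<close> c(4) by simp
    next
      case 5
      then have 5: "x < 0" "p \<le> b * t" "- (b * t - p)\<^sup>2 \<le> 2 * b * x" "?O5" using mem(5) by auto
      have "b * t \<noteq> p" using 5 bx by auto
      then have "2 * b * x = - (b * t - p)\<^sup>2" using 5 c(4) by linarith
      then show ?thesis using V5[OF 5(4)] overlap_25[OF assms(2) 5(2)] by simp
    qed
  qed
  show "?V = F3 a b x t p \<and> ?m = m3 a b x t p" if c: "(x, t, p) \<in> cell3 a b"
  proof -
    have c: "0 \<le> t" "0 \<le> p" "0 \<le> x" "x \<le> p * t + a / 2 * t\<^sup>2"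
      "b * t \<le> p \<or> a * (b * t - p)\<^sup>2 \<le> 2 * b\<^sup>2 * x"
      using c by (auto simp: cell3_def)
    show ?thesis
    proof (cases "x = p * t + a / 2 * t\<^sup>2")
      case True
      then have "?O1" using mem(1) c by simp
      then show ?thesis using V1 overlap_13[OF assms c(1,2) True] by simp
    next
      case False
      have "b * t < p \<or> a * (b * t - p)\<^sup>2 \<le> 2 * b\<^sup>2 * x \<and> p \<le> b * t"
        using c(3,5) by (cases "b * t = p") auto
      then have "?O3" using False mem(3) c by auto
      then show ?thesis by (rule V3)
    qed
  qed
  show "?V = F4 a b x t p \<and> ?m = m4 a b x t p" if c: "(x, t, p) \<in> cell4 a b"
  proof -
    have c: "0 \<le> t" "0 \<le> p" "0 \<le> x" "p \<le> b * t" "2 * b\<^sup>2 * x \<le> a * (b * t - p)\<^sup>2"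
      using c by (auto simp: cell4_def)
    show ?thesis
    proof (cases "2 * b\<^sup>2 * x = a * (b * t - p)\<^sup>2")
      case False
      then have "?O4" using mem(4) c by auto
      then show ?thesis by (rule V4)
    next
      case True
      show ?thesis
      proof (cases ?O1)
        case False
        then have "?O3" using True mem(1,3) c by auto
        then show ?thesis using V3 overlap_34[OF assms c(4) True] by simp
      next
        case 1: True
        \<comment> \<open>The edge parabola of \<open>cell4\<close> lies on or below that of
          \<open>Omega1\<close> and can meet it only for p = 0, which is the case treated by
          \<open>overlap_14\<close>.\<close>
        have "(b * t - p)\<^sup>2 \<le> (b * t)\<^sup>2" using c by (intro power_mono) auto
        then have "2 * b\<^sup>2 * x \<le> a * (b * t)\<^sup>2"
          using True assms by (simp add: mult_left_mono)
        then have "b\<^sup>2 * (2 * x) \<le> b\<^sup>2 * (a * t\<^sup>2)" by (simp add: power_mult_distrib algebra_simps)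
        then have "2 * x \<le> a * t\<^sup>2" using assms by simp
        moreover have "0 \<le> p * t" using c by simp
        moreover have "p * t + a / 2 * t\<^sup>2 \<le> x" using 1 mem(1) by simp
        ultimately have "p * t = 0" "x = a / 2 * t\<^sup>2" by linarith+
        moreover have "p = 0" if "t = 0" using that c by simp
        ultimately have "p = 0" "x = a / 2 * t\<^sup>2" by auto
        then show ?thesis using V1[OF 1] overlap_14[OF assms(1) c(1)] by simp
      qed
    qed
  qed
  show "?V = F5 a b x t p \<and> ?m = m5 a b x t p" if c: "(x, t, p) \<in> cell5 a b"
  proof -
    have c: "0 \<le> t" "0 \<le> p" "x \<le> 0" "p \<le> b * t" "- (b * t - p)\<^sup>2 \<le> 2 * b * x"
      using c by (auto simp: cell5_def)
    show ?thesis
    proof (cases "x = 0")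
      case False
      then have "?O5" using mem(5) c by auto
      then show ?thesis by (rule V5)
    next
      case True
      consider ?O1 | "\<not> ?O1" "p = b * t" | "\<not> ?O1" "p < b * t" using c(4) by linarith
      then show ?thesis
      proof cases
        case 1
        have "p = 0" using c O1D[OF 1 c(3)] by simp
        then show ?thesis using V1[OF 1] O1D[OF 1 c(3)] overlap_15 by simp
      next
        case 2
        then have "?O3" using mem(1,3) c True by auto
        then show ?thesis using V3 overlap_35[OF assms(2) True 2(2)] by simp
      next
        case 3
        then have "?O4" using mem(4) c True assms by auto
        then show ?thesis using V4 overlap_45[OF True] by simp
      qed
    qed
  qed
qed

lemma cells_cover:
  assumes "b > 0"
  shows "cell1 a b \<union> cell2 a b \<union> cell3 a b \<union> cell4 a b \<union> cell5 a b = {(x, t, p). 0 \<le> t \<and> 0 \<le> p}"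
proof -
  have *: "b * x \<le> 0 \<longleftrightarrow> x \<le> 0" for x using assms by (simp add: mult_le_0_iff)
  show ?thesis unfolding cell_defs by auto
qed

lemma closed_cells:
  "closed (cell1 a b)" "closed (cell2 a b)" "closed (cell3 a b)" "closed (cell4 a b)" "closed (cell5 a b)"
  unfolding cell_defs case_prod_unfold
  by (intro closed_Collect_conj closed_Collect_disj closed_Collect_le continuous_intros)+

text \<open>The time derivative is written as the value that the equation dictates. Two pieces with
  the same x-slope at a shared point then automatically have the same full gradient there.\<close>

lemma pieces_solve_HJ:
  fixes x t p :: real
  assumes "a > 0" "b > 0"
  shows has_grad_f1: "has_grad (\<lambda>z. f1 a b (fst z) (snd z) p) (m1 a b x t p)
      (- 1 / 2 * (m1 a b x t p)\<^sup>2 + a * x) (x, t)"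
    and has_grad_f2: "has_grad (\<lambda>z. f2 a b (fst z) (snd z) p) (m2 a b x t p)
      (- 1 / 2 * (m2 a b x t p)\<^sup>2 - b * x) (x, t)"
    and has_grad_F3: "0 \<le> x \<Longrightarrow> has_grad (\<lambda>z. F3 a b (fst z) (snd z) p) (m3 a b x t p)
      (- 1 / 2 * (m3 a b x t p)\<^sup>2 + a * x) (x, t)"
    and has_grad_F4: "0 \<le> x \<Longrightarrow> has_grad (\<lambda>z. F4 a b (fst z) (snd z) p) (m4 a b x t p)
      (- 1 / 2 * (m4 a b x t p)\<^sup>2 + a * x) (x, t)"
    and has_grad_F5: "x \<le> 0 \<Longrightarrow> has_grad (\<lambda>z. F5 a b (fst z) (snd z) p) (m5 a b x t p)
      (- 1 / 2 * (m5 a b x t p)\<^sup>2 - b * x) (x, t)"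
proof -
  show "has_grad (\<lambda>z. f1 a b (fst z) (snd z) p) (m1 a b x t p)
      (- 1 / 2 * (m1 a b x t p)\<^sup>2 + a * x) (x, t)"
    unfolding has_grad_def f1_def m1_def
    by (auto intro!: derivative_eq_intros simp: fun_eq_iff power2_eq_square field_simps)
  show "has_grad (\<lambda>z. f2 a b (fst z) (snd z) p) (m2 a b x t p)
      (- 1 / 2 * (m2 a b x t p)\<^sup>2 - b * x) (x, t)"
    unfolding has_grad_def f2_def m2_def
    by (auto intro!: derivative_eq_intros simp: fun_eq_iff power2_eq_square field_simps)
  show "has_grad (\<lambda>z. F4 a b (fst z) (snd z) p) (m4 a b x t p)
      (- 1 / 2 * (m4 a b x t p)\<^sup>2 + a * x) (x, t)" if "0 \<le> x"
  proof -
    have "(m4 a b x t p)\<^sup>2 = 2 * a * x"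
      using that assms by (simp add: m4_def power_mult_distrib) (simp add: power2_eq_square)
    then show ?thesis
      unfolding has_grad_def F4_def m4_def using assms
      by (auto intro!: derivative_eq_intros simp: fun_eq_iff power2_eq_square field_simps)
  qed
  show "has_grad (\<lambda>z. F5 a b (fst z) (snd z) p) (m5 a b x t p)
      (- 1 / 2 * (m5 a b x t p)\<^sup>2 - b * x) (x, t)" if "x \<le> 0"
  proof -
    have "\<bar>- 2 * x / b\<bar> = - 2 * x / b" using that assms by (simp add: divide_nonpos_pos)
    then have "(m5 a b x t p)\<^sup>2 = - 2 * b * x"
      using that assms by (simp add: m5_def power_mult_distrib divide_nonpos_pos) (simp add: power2_eq_square)
    then show ?thesis
      unfolding has_grad_def F5_def m5_def using assms
      by (auto intro!: derivative_eq_intros simp: fun_eq_iff power2_eq_square field_simps)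
  qed
  show "has_grad (\<lambda>z. F3 a b (fst z) (snd z) p) (m3 a b x t p)
      (- 1 / 2 * (m3 a b x t p)\<^sup>2 + a * x) (x, t)" if "0 \<le> x"
  proof -
    define n where "n = a + 2 * b"
    define B where "B = b * t - p"
    define r where "r = sqrt \<bar>B\<^sup>2 + 2 * x * n\<bar>"
    have n: "n > 0" using assms by (simp add: n_def)
    have "0 \<le> B\<^sup>2 + 2 * x * n" using that n by simp
    then have r: "r\<^sup>2 = B\<^sup>2 + 2 * x * n" by (simp add: r_def)
    then have x: "x = (r\<^sup>2 - B\<^sup>2) / (2 * n)" using n by (simp add: field_simps)
    have m: "m3 a b x t p = ((a + b) * r - b * B) / n"
      by (simp add: m3_def r_def B_def n_def)
    \<comment> \<open>This is the time derivative in the form the differentiation rules give.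
      Eliminating \<open>x\<close> and \<open>p\<close> in favour of the root \<open>r\<close> and
      of \<open>B\<close> turns its agreement with the equation into a rational identity.\<close>
    define q where "q = (a + b) / (3 * n\<^sup>2) * (3 * B\<^sup>2 * b + 3 / 2 * r * (2 * B * b))
       - b / n * b * x - b\<^sup>2 / 2 * t\<^sup>2 + b * p * t - 1 / 2 * p\<^sup>2"
    have "has_grad (\<lambda>z. F3 a b (fst z) (snd z) p) (((a + b) * r - b * B) / n) q (x, t)"
      unfolding has_grad_def F3_def n_def[symmetric]
      apply (rule derivative_eq_intros refl)+
      unfolding fst_conv snd_conv B_def[symmetric] r_def[symmetric]
      using n by (auto simp: fun_eq_iff q_def) (simp add: field_simps power2_eq_square)
    moreover have "q = - 1 / 2 * (((a + b) * r - b * B) / n)\<^sup>2 + a * x"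
    proof -
      have p: "p = b * t - B" by (simp add: B_def)
      show ?thesis
        unfolding q_def x p using n unfolding n_def
        by (simp add: divide_simps) algebra
    qed
    ultimately show ?thesis unfolding m by simp
  qed
qed

text \<open>The remainder quotient tends to 0 along each of finitely many pieces, hence along their
  union. Pieces through the point share the derivative; a piece that misses the point does not
  accumulate there, because it is closed.\<close>

lemma has_derivative_glue:
  fixes g :: "'a::real_normed_vector \<Rightarrow> 'b::real_normed_vector"
  assumes "finite I" and closed: "\<And>S f. (S, f) \<in> I \<Longrightarrow> closed S"
    and N: "open N" "z \<in> N" "N \<subseteq> (\<Union>(S, f)\<in>I. S)"
    and eq: "\<And>S f w. (S, f) \<in> I \<Longrightarrow> w \<in> S \<Longrightarrow> g w = f w"
    and deriv: "\<And>S f. (S, f) \<in> I \<Longrightarrow> z \<in> S \<Longrightarrow> (f has_derivative D) (at z)"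
  shows "(g has_derivative D) (at z)"
proof -
  obtain S0 f0 where "(S0, f0) \<in> I" "z \<in> S0" using N by blast
  then have bl: "bounded_linear D" using deriv has_derivative_bounded_linear by blast
  let ?q = "\<lambda>y. ((g y - g z) - D (y - z)) /\<^sub>R norm (y - z)"
  have piece: "(?q \<longlongrightarrow> 0) (at z within S)" if "(S, f) \<in> I" for S f
  proof (cases "z \<in> S")
    case True
    have "(g has_derivative D) (at z within S)"
      by (rule has_derivative_transform[OF True _ has_derivative_at_withinI[OF deriv[OF that True]]])
         (rule eq[OF that])
    then show ?thesis by (simp add: has_derivative_at_within)
  next
    case False
    then have "at z within S = bot"
      using closed[OF that] by (simp add: at_within_eq_bot_iff)
    then show ?thesis by simp
  qed
  have "(?q \<longlongrightarrow> 0) (at z within (\<Union>(S, f)\<in>J. S))" if "finite J" "J \<subseteq> I" for J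
    using that
  proof (induction J rule: finite_induct)
    case (insert j J)
    obtain S f where "j = (S, f)" by force
    then show ?case
      using insert piece[of S f] by (simp add: Lim_within_Un)
  qed simp
  from tendsto_within_subset[OF this[OF \<open>finite I\<close> order_refl] N(3)]
  have "(g has_derivative D) (at z within N)"
    using bl by (simp add: has_derivative_at_within)
  then show ?thesis using at_within_open[OF N(2,1)] by simp
qed

text \<open>For t > 0 the sections of the cells cover a full neighbourhood of the point, so the
  glued derivative is two-sided in time as well.\<close>

lemma has_grad_V_nonneg:
  assumes ab: "a > 0" "b > 0" and "0 \<le> p" "0 < t"
  shows "has_grad (\<lambda>z. V_nonneg (fst z) (snd z) p a b) (momentum_nonneg x t p a b)
    (- 1 / 2 * (momentum_nonneg x t p a b)\<^sup>2 - U a b x) (x, t)"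
proof -
  let ?sec = "\<lambda>C. {z. (fst z, snd z, p) \<in> C}"
  let ?I = "{(?sec (cell1 a b), \<lambda>z. f1 a b (fst z) (snd z) p),
    (?sec (cell2 a b), \<lambda>z. f2 a b (fst z) (snd z) p),
    (?sec (cell3 a b), \<lambda>z. F3 a b (fst z) (snd z) p),
    (?sec (cell4 a b), \<lambda>z. F4 a b (fst z) (snd z) p),
    (?sec (cell5 a b), \<lambda>z. F5 a b (fst z) (snd z) p)}"
  let ?m = "momentum_nonneg x t p a b"
  have sec: "closed (?sec C)" if "closed C" for C :: "(real \<times> real \<times> real) set"
  proof -
    have "closed ((\<lambda>z. (fst z, snd z, p)) -` C)"
      by (intro closed_vimage[OF that] continuous_intros)
    then show ?thesis by (simp add: vimage_def)
  qed
  show ?thesis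
    unfolding has_grad_def
  proof (rule has_derivative_glue[where I = ?I and N = "UNIV \<times> {0<..}"])
    show "closed S" if "(S, f) \<in> ?I" for S f
      using that sec closed_cells by auto
    show "UNIV \<times> {0<..} \<subseteq> (\<Union>(S, f)\<in>?I. S)"
    proof
      fix w :: "real \<times> real" assume "w \<in> UNIV \<times> {0<..}"
      then have "(fst w, snd w, p) \<in> {(x, t, p). 0 \<le> t \<and> 0 \<le> p}" using assms by auto
      then show "w \<in> (\<Union>(S, f)\<in>?I. S)" unfolding cells_cover[OF ab(2), of a, symmetric] by auto
    qed
    show "V_nonneg (fst w) (snd w) p a b = f w" if "(S, f) \<in> ?I" "w \<in> S" for S f w
      using that V_nonneg_on_cells[OF ab] by auto
    show "(f has_derivative (\<lambda>h. ?m * fst h + (- 1 / 2 * ?m\<^sup>2 - U a b x) * snd h)) (at (x, t))"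
      if "(S, f) \<in> ?I" "(x, t) \<in> S" for S f
    proof -
      have Un: "- U a b x = a * x" if "0 \<le> x" using that by (simp add: U_def)
      have Up: "U a b x = b * x" if "x \<le> 0" using that by (simp add: U_def)
      have pos: "(f has_derivative (\<lambda>h. ?m * fst h + (- 1 / 2 * ?m\<^sup>2 - U a b x) * snd h)) (at (x, t))"
        if "has_grad f m (- 1 / 2 * m\<^sup>2 + a * x) (x, t)" "0 \<le> x" "?m = m" for m
        using that(1) unfolding has_grad_def that(3) Un[OF that(2), symmetric]
        by (simp only: add_uminus_conv_diff)
      have neg: "(f has_derivative (\<lambda>h. ?m * fst h + (- 1 / 2 * ?m\<^sup>2 - U a b x) * snd h)) (at (x, t))"
        if "has_grad f m (- 1 / 2 * m\<^sup>2 - b * x) (x, t)" "x \<le> 0" "?m = m" for m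
        using that(1) unfolding has_grad_def that(3) Up[OF that(2)] .
      have c1: "0 \<le> x" if "(x, t, p) \<in> cell1 a b"
      proof -
        have "p * t + a / 2 * t\<^sup>2 \<le> x" "0 \<le> p * t" "0 \<le> a / 2 * t\<^sup>2"
          using that assms by (auto simp: cell1_def)
        then show ?thesis by linarith
      qed
      from that consider
          "f = (\<lambda>z. f1 a b (fst z) (snd z) p)" "(x, t, p) \<in> cell1 a b"
        | "f = (\<lambda>z. f2 a b (fst z) (snd z) p)" "(x, t, p) \<in> cell2 a b"
        | "f = (\<lambda>z. F3 a b (fst z) (snd z) p)" "(x, t, p) \<in> cell3 a b"
        | "f = (\<lambda>z. F4 a b (fst z) (snd z) p)" "(x, t, p) \<in> cell4 a b"
        | "f = (\<lambda>z. F5 a b (fst z) (snd z) p)" "(x, t, p) \<in> cell5 a b"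
        by auto
      then show ?thesis
      proof cases
        case 1
        have xs: "0 \<le> x" using c1 1(2) by blast
        have "has_grad f (m1 a b x t p) (- 1 / 2 * (m1 a b x t p)\<^sup>2 + a * x) (x, t)"
          unfolding 1(1) by (rule has_grad_f1[OF ab])
        then show ?thesis by (rule pos) (use 1(2) xs V_nonneg_on_cells(1)[OF ab] in auto)
      next
        case 2
        have xs: "x \<le> 0" using 2(2) by (simp add: cell2_def)
        have "has_grad f (m2 a b x t p) (- 1 / 2 * (m2 a b x t p)\<^sup>2 - b * x) (x, t)"
          unfolding 2(1) by (rule has_grad_f2[OF ab])
        then show ?thesis by (rule neg) (use 2(2) xs V_nonneg_on_cells(2)[OF ab] in auto)
      next
        case 3
        have xs: "0 \<le> x" using 3(2) by (simp add: cell3_def)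
        have "has_grad f (m3 a b x t p) (- 1 / 2 * (m3 a b x t p)\<^sup>2 + a * x) (x, t)"
          unfolding 3(1) by (rule has_grad_F3[OF ab xs])
        then show ?thesis by (rule pos) (use 3(2) xs V_nonneg_on_cells(3)[OF ab] in auto)
      next
        case 4
        have xs: "0 \<le> x" using 4(2) by (simp add: cell4_def)
        have "has_grad f (m4 a b x t p) (- 1 / 2 * (m4 a b x t p)\<^sup>2 + a * x) (x, t)"
          unfolding 4(1) by (rule has_grad_F4[OF ab xs])
        then show ?thesis by (rule pos) (use 4(2) xs V_nonneg_on_cells(4)[OF ab] in auto)
      next
        case 5
        have xs: "x \<le> 0" using 5(2) by (simp add: cell5_def)
        have "has_grad f (m5 a b x t p) (- 1 / 2 * (m5 a b x t p)\<^sup>2 - b * x) (x, t)"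
          unfolding 5(1) by (rule has_grad_F5[OF ab xs])
        then show ?thesis by (rule neg) (use 5(2) xs V_nonneg_on_cells(5)[OF ab] in auto)
      qed
    qed
  qed (use assms in \<open>auto intro!: open_Times\<close>)
qed

text \<open>Continuity is joint in all three variables, because the maximising p will move with the
  point.\<close>

lemma continuous_on_V_nonneg:
  assumes ab: "a > 0" "b > 0"
  shows "continuous_on {(x, t, p). 0 \<le> t \<and> 0 \<le> p} (\<lambda>(x, t, p). V_nonneg x t p a b)" (is ?V)
    and "continuous_on {(x, t, p). 0 \<le> t \<and> 0 \<le> p} (\<lambda>(x, t, p). momentum_nonneg x t p a b)" (is ?M)
proof -
  let ?C = "{cell1 a b, cell2 a b, cell3 a b, cell4 a b, cell5 a b}"
  have cover: "{(x, t, p). 0 \<le> t \<and> 0 \<le> p} = (\<Union>C\<in>?C. C)"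
    unfolding cells_cover[OF ab(2), of a, symmetric] by auto
  have n: "a + 2 * b \<noteq> 0" using ab by simp
  have closed: "closed C" if "C \<in> ?C" for C using that closed_cells by auto
  have cV: "continuous_on UNIV (\<lambda>(x, t, p). f1 a b x t p)"
    "continuous_on UNIV (\<lambda>(x, t, p). f2 a b x t p)"
    "continuous_on UNIV (\<lambda>(x, t, p). F3 a b x t p)"
    "continuous_on UNIV (\<lambda>(x, t, p). F4 a b x t p)"
    "continuous_on UNIV (\<lambda>(x, t, p). F5 a b x t p)"
    unfolding f1_def f2_def F3_def F4_def F5_def case_prod_unfold
    by (intro continuous_intros; use ab n in simp)+
  have cm: "continuous_on UNIV (\<lambda>(x, t, p). m1 a b x t p)"
    "continuous_on UNIV (\<lambda>(x, t, p). m2 a b x t p)"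
    "continuous_on UNIV (\<lambda>(x, t, p). m3 a b x t p)"
    "continuous_on UNIV (\<lambda>(x, t, p). m4 a b x t p)"
    "continuous_on UNIV (\<lambda>(x, t, p). m5 a b x t p)"
    unfolding m1_def m2_def m3_def m4_def m5_def case_prod_unfold
    by (intro continuous_intros; use ab n in simp)+
  have transfer: "continuous_on C g"
    if "continuous_on UNIV f" "\<And>x t p. (x, t, p) \<in> C \<Longrightarrow> g (x, t, p) = f (x, t, p)"
    for C :: "(real \<times> real \<times> real) set" and f g :: "real \<times> real \<times> real \<Rightarrow> real"
    using continuous_on_subset[OF that(1) subset_UNIV, of C] that(2)
    by (subst continuous_on_cong[where g = f, OF refl]) auto
  show ?V
    unfolding cover
  proof (rule continuous_on_closed_Union)
    show "continuous_on C (\<lambda>(x, t, p). V_nonneg x t p a b)" if "C \<in> ?C" for C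
      using that V_nonneg_on_cells[OF ab]
      by (elim insertE emptyE) (simp_all add: transfer[OF cV(1)] transfer[OF cV(2)]
          transfer[OF cV(3)] transfer[OF cV(4)] transfer[OF cV(5)])
  qed (use closed in auto)
  show ?M
    unfolding cover
  proof (rule continuous_on_closed_Union)
    show "continuous_on C (\<lambda>(x, t, p). momentum_nonneg x t p a b)" if "C \<in> ?C" for C
      using that V_nonneg_on_cells[OF ab]
      by (elim insertE emptyE) (simp_all add: transfer[OF cm(1)] transfer[OF cm(2)]
          transfer[OF cm(3)] transfer[OF cm(4)] transfer[OF cm(5)])
  qed (use closed in auto)
qed

section \<open>Convexity in space and bounds on the slope\<close>

lemma mono_on_glue:
  fixes f :: "real \<Rightarrow> real"
  assumes "mono_on A f" "mono_on B f" "\<And>x. x \<in> A \<Longrightarrow> x \<le> c" "\<And>x. x \<in> B \<Longrightarrow> c \<le> x"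
    "c \<in> A" "c \<in> B"
  shows "mono_on (A \<union> B) f"
proof (rule mono_onI)
  fix x y assume "x \<in> A \<union> B" "y \<in> A \<union> B" and xy: "x \<le> y"
  then consider "x \<in> A" "y \<in> A" | "x \<in> B" "y \<in> B" | "x \<in> A" "y \<in> B" | "x \<in> B" "y \<in> A" by blast
  then show "f x \<le> f y"
  proof cases
    case 3
    then have "f x \<le> f c" "f c \<le> f y" using assms by (auto dest: mono_onD)
    then show ?thesis by simp
  next
    case 4
    then have "x = c" "y = c" using assms(3,4) xy by force+
    then show ?thesis by simp
  qed (use assms xy in \<open>auto dest: mono_onD\<close>)
qed

text \<open>For t > 0 this is convexity in x. Each slope formula is monotone on its own cell, and
  for fixed t and p the cells cut the line into consecutive closed intervals, so monotonicity is
  passed on through the common endpoints.\<close>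

lemma mono_momentum_nonneg:
  assumes ab: "a > 0" "b > 0" and t: "0 \<le> t" and p: "0 \<le> p"
  shows "mono (\<lambda>x. momentum_nonneg x t p a b)"
proof -
  let ?m = "\<lambda>x. momentum_nonneg x t p a b"
  let ?sec = "\<lambda>C. {x. (x, t, p) \<in> C}"
  define B where "B = b * t - p"
  define X where "X = p * t + a / 2 * t\<^sup>2"
  have X: "0 \<le> X" using ab t p by (simp add: X_def)
  have mono_transfer: "mono_on (?sec C) ?m" if "mono_on (?sec C) f" "\<And>x. (x, t, p) \<in> C \<Longrightarrow> ?m x = f x" for C f
    using that by (auto simp: monotone_on_def)
  have mono: "mono_on (?sec (cell1 a b)) ?m" "mono_on (?sec (cell2 a b)) ?m"
    "mono_on (?sec (cell3 a b)) ?m" "mono_on (?sec (cell4 a b)) ?m" "mono_on (?sec (cell5 a b)) ?m"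
  proof -
    show "mono_on (?sec (cell1 a b)) ?m"
    proof (rule mono_transfer)
      show "mono_on (?sec (cell1 a b)) (\<lambda>x. m1 a b x t p)" by (simp add: m1_def monotone_on_def)
    qed (use V_nonneg_on_cells(1)[OF ab] in auto)
    show "mono_on (?sec (cell2 a b)) ?m"
    proof (rule mono_transfer)
      show "mono_on (?sec (cell2 a b)) (\<lambda>x. m2 a b x t p)" by (simp add: m2_def monotone_on_def)
    qed (use V_nonneg_on_cells(2)[OF ab] in auto)
    show "mono_on (?sec (cell3 a b)) ?m"
    proof (rule mono_transfer)
      show "mono_on (?sec (cell3 a b)) (\<lambda>x. m3 a b x t p)"
      proof (rule mono_onI)
        fix x y assume "x \<in> ?sec (cell3 a b)" "y \<in> ?sec (cell3 a b)" "x \<le> y"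
        then have "0 \<le> x" "x \<le> y" by (auto simp: cell3_def)
        then have "\<bar>(b * t - p)\<^sup>2 + 2 * x * (a + 2 * b)\<bar> \<le> \<bar>(b * t - p)\<^sup>2 + 2 * y * (a + 2 * b)\<bar>"
          using ab by (simp add: mult_right_mono)
        then show "m3 a b x t p \<le> m3 a b y t p"
          unfolding m3_def using ab
          by (intro divide_right_mono diff_right_mono mult_left_mono real_sqrt_le_mono) auto
      qed
    qed (use V_nonneg_on_cells(3)[OF ab] in auto)
    show "mono_on (?sec (cell4 a b)) ?m"
    proof (rule mono_transfer)
      show "mono_on (?sec (cell4 a b)) (\<lambda>x. m4 a b x t p)"
      proof (rule mono_onI)
        fix x y assume "x \<in> ?sec (cell4 a b)" "y \<in> ?sec (cell4 a b)" "x \<le> y"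
        then have "0 \<le> x" "x \<le> y" by (auto simp: cell4_def)
        then have "\<bar>2 * x / a\<bar> \<le> \<bar>2 * y / a\<bar>"
          using ab by (simp add: divide_right_mono)
        then show "m4 a b x t p \<le> m4 a b y t p"
          unfolding m4_def using ab by (intro mult_left_mono real_sqrt_le_mono) auto
      qed
    qed (use V_nonneg_on_cells(4)[OF ab] in auto)
    show "mono_on (?sec (cell5 a b)) ?m"
    proof (rule mono_transfer)
      show "mono_on (?sec (cell5 a b)) (\<lambda>x. m5 a b x t p)"
      proof (rule mono_onI)
        fix x y assume "x \<in> ?sec (cell5 a b)" "y \<in> ?sec (cell5 a b)" "x \<le> y"
        then have "y \<le> 0" "x \<le> y" by (auto simp: cell5_def)
        then have "\<bar>- 2 * y / b\<bar> \<le> \<bar>- 2 * x / b\<bar>"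
          using ab by (simp add: divide_right_mono)
        then have "b * sqrt \<bar>- 2 * y / b\<bar> \<le> b * sqrt \<bar>- 2 * x / b\<bar>"
          using ab by (intro mult_left_mono real_sqrt_le_mono) auto
        then show "m5 a b x t p \<le> m5 a b y t p"
          unfolding m5_def by simp
      qed
    qed (use V_nonneg_on_cells(5)[OF ab] in auto)
  qed
  have sec1: "?sec (cell1 a b) = {X..}" using t p by (auto simp: cell1_def X_def)
  show ?thesis
  proof (cases "b * t \<le> p")
    case True
    have sec2: "?sec (cell2 a b) = {..0}" using t p True by (auto simp: cell2_def)
    have sec3: "?sec (cell3 a b) = {0..X}" using t p True by (auto simp: cell3_def X_def)
    have "mono_on ({..0} \<union> {0..X}) ?m"
      using mono(2,3) X unfolding sec2 sec3 by - (rule mono_on_glue[where c = 0]; auto)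
    then have "mono_on (({..0} \<union> {0..X}) \<union> {X..}) ?m"
      using mono(1) X unfolding sec1 by - (rule mono_on_glue[where c = X]; auto)
    moreover have "({..0} \<union> {0..X}) \<union> {X..} = UNIV" using X by auto
    ultimately show ?thesis by simp
  next
    case False
    \<comment> \<open>For p < b t the cut points are Z \<le> 0 \<le> Y \<le> X, and the cells occur
      from left to right in the order 2, 5, 4, 3, 1.\<close>
    define Y where "Y = a * B\<^sup>2 / (2 * b\<^sup>2)"
    define Z where "Z = - (B\<^sup>2 / (2 * b))"
    have Y: "0 \<le> Y" and Z: "Z \<le> 0" using ab by (auto simp: Y_def Z_def)
    have YX: "Y \<le> X"
    proof -
      have "B\<^sup>2 \<le> (b * t)\<^sup>2" using p False unfolding B_def by (intro power_mono) auto
      then have "a * B\<^sup>2 / (2 * b\<^sup>2) \<le> a * (b * t)\<^sup>2 / (2 * b\<^sup>2)"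
        using ab by (intro divide_right_mono mult_left_mono) auto
      also have "\<dots> = a / 2 * t\<^sup>2" using ab by (simp add: power_mult_distrib)
      also have "\<dots> \<le> X" using t p by (simp add: X_def)
      finally show ?thesis by (simp add: Y_def)
    qed
    have iffY: "a * B\<^sup>2 \<le> 2 * b\<^sup>2 * x \<longleftrightarrow> Y \<le> x" "2 * b\<^sup>2 * x \<le> a * B\<^sup>2 \<longleftrightarrow> x \<le> Y" for x
      using ab by (simp_all add: Y_def field_simps)
    have iffZ: "2 * b * x \<le> - B\<^sup>2 \<longleftrightarrow> x \<le> Z" "- B\<^sup>2 \<le> 2 * b * x \<longleftrightarrow> Z \<le> x" for x
      using ab by (simp_all add: Z_def field_simps)
    have "\<not> b * t \<le> p" "p \<le> b * t" using False by auto
    then have sec2: "?sec (cell2 a b) = {..Z}" and sec3: "?sec (cell3 a b) = {Y..X}"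
      and sec4: "?sec (cell4 a b) = {0..Y}" and sec5: "?sec (cell5 a b) = {Z..0}"
      unfolding cell_defs B_def[symmetric] X_def[symmetric] mem_Collect_eq case_prod_conv iffY iffZ
      using t p Y Z by auto
    have "mono_on ({..Z} \<union> {Z..0}) ?m"
      using mono(2,5) Z unfolding sec2 sec5 by - (rule mono_on_glue[where c = Z]; auto)
    then have "mono_on (({..Z} \<union> {Z..0}) \<union> {0..Y}) ?m"
      using mono(4) Y Z unfolding sec4 by - (rule mono_on_glue[where c = 0]; auto)
    then have "mono_on ((({..Z} \<union> {Z..0}) \<union> {0..Y}) \<union> {Y..X}) ?m"
      using mono(3) Y YX Z unfolding sec3 by - (rule mono_on_glue[where c = Y]; auto)
    then have "mono_on (((({..Z} \<union> {Z..0}) \<union> {0..Y}) \<union> {Y..X}) \<union> {X..}) ?m"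
      using mono(1) X Y YX Z unfolding sec1 by - (rule mono_on_glue[where c = X]; auto)
    moreover have "((({..Z} \<union> {Z..0}) \<union> {0..Y}) \<union> {Y..X}) \<union> {X..} = UNIV" using X Y YX Z by auto
    ultimately show ?thesis by simp
  qed
qed

text \<open>By monotonicity it is enough to look far to the left and far to the right, where cells 2
  and 1 have slopes that do not depend on x.\<close>

lemma momentum_nonneg_bounds:
  assumes ab: "a > 0" "b > 0" and t: "0 \<le> t" and p: "0 \<le> p"
  shows "p - b * t \<le> momentum_nonneg x t p a b" "momentum_nonneg x t p a b \<le> p + a * t"
proof -
  have m: "momentum_nonneg y t p a b \<le> momentum_nonneg z t p a b" if "y \<le> z" for y z
    using mono_momentum_nonneg[OF assms] that by (rule monoD)
  let ?y = "min x (- (b * t - p)\<^sup>2 / (2 * b))"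
  have "2 * b * ?y \<le> 2 * b * (- (b * t - p)\<^sup>2 / (2 * b))"
    using ab by (intro mult_left_mono) auto
  also have "\<dots> = - (b * t - p)\<^sup>2" using ab by simp
  finally have "2 * b * ?y \<le> - (b * t - p)\<^sup>2" .
  moreover have "- (b * t - p)\<^sup>2 / (2 * b) \<le> 0" using ab by simp
  ultimately have "(?y, t, p) \<in> cell2 a b" using t p by (auto simp: cell2_def min_le_iff_disj)
  then show "p - b * t \<le> momentum_nonneg x t p a b"
    using m[of ?y x] V_nonneg_on_cells(2)[OF ab] by (auto simp: m2_def)
  let ?z = "max x (p * t + a / 2 * t\<^sup>2)"
  have "(?z, t, p) \<in> cell1 a b" using t p by (auto simp: cell1_def)
  then show "momentum_nonneg x t p a b \<le> p + a * t"
    using m[of x ?z] V_nonneg_on_cells(1)[OF ab] by (auto simp: m1_def)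
qed

lemma V_nonneg_initial:
  assumes "a > 0" "b > 0" "0 \<le> p"
  shows "V_nonneg x 0 p a b = p * x"
proof (cases "0 \<le> x")
  case True
  then have "(x, 0, p) \<in> cell1 a b" using assms by (simp add: cell1_def)
  then show ?thesis using V_nonneg_on_cells(1)[OF assms(1,2)] by (simp add: f1_def)
next
  case False
  then have "(x, 0, p) \<in> cell2 a b" using assms by (simp add: cell2_def)
  then show ?thesis using V_nonneg_on_cells(2)[OF assms(1,2)] by (simp add: f2_def)
qed

text \<open>Both the formula for p \<ge> 0 and its mirror image for p < 0 extend to p = 0; their
  agreement there is what makes the complete function continuous in p.\<close>

lemma V_nonneg_reflect:
  assumes ab: "a > 0" "b > 0" and t: "0 \<le> t"
  shows "V_nonneg x t 0 a b = V_nonneg (- x) t 0 b a \<and>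
    momentum_nonneg x t 0 a b = - momentum_nonneg (- x) t 0 b a"
proof -
  have *: "V_nonneg x t 0 a b = V_nonneg (- x) t 0 b a \<and>
    momentum_nonneg x t 0 a b = - momentum_nonneg (- x) t 0 b a"
    if ab: "a > 0" "b > 0" and x: "0 \<le> x" for a b x
  proof (cases "a / 2 * t\<^sup>2 \<le> x")
    case True
    then have "2 * a * - x \<le> - (a * t)\<^sup>2"
      using mult_left_mono[OF True, of "2 * a"] ab by (simp add: power2_eq_square algebra_simps)
    then have "(- x, t, 0) \<in> cell2 b a" using x t by (simp add: cell2_def)
    moreover have "(x, t, 0) \<in> cell1 a b" using True x t by (simp add: cell1_def)
    ultimately show ?thesis
      using V_nonneg_on_cells(1)[OF ab] V_nonneg_on_cells(2)[OF ab(2,1)]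
      by (simp add: f1_def f2_def m1_def m2_def)
  next
    case False
    then have "a * (2 * x) \<le> a * (a * t\<^sup>2)" "b\<^sup>2 * (2 * x) \<le> b\<^sup>2 * (a * t\<^sup>2)"
      using ab by (auto intro!: mult_left_mono)
    then have "- (a * t)\<^sup>2 \<le> 2 * a * - x" "2 * b\<^sup>2 * x \<le> a * (b * t)\<^sup>2"
      by (auto simp: power2_eq_square algebra_simps)
    then have "(- x, t, 0) \<in> cell5 b a" "(x, t, 0) \<in> cell4 a b"
      using x t ab by (simp_all add: cell4_def cell5_def)
    then show ?thesis
      using V_nonneg_on_cells(4)[OF ab] V_nonneg_on_cells(5)[OF ab(2,1)]
      by (simp add: F4_def F5_def m4_def m5_def)
  qed
  show ?thesis
    using *[OF ab, of x] *[OF ab(2,1), of "- x"] by (cases "0 \<le> x") auto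
qed

section \<open>Extension to negative p by reflection\<close>

definition momentum :: "real \<Rightarrow> real \<Rightarrow> real \<Rightarrow> real \<Rightarrow> real \<Rightarrow> real" where
  "momentum x t p a b =
    (if 0 \<le> p then momentum_nonneg x t p a b else - momentum_nonneg (- x) t (- p) b a)"

lemma V_explicit_nonneg:
  assumes "0 \<le> p"
  shows "V_explicit x t p a b = V_nonneg x t p a b" "momentum x t p a b = momentum_nonneg x t p a b"
  using assms by (simp_all add: V_explicit_def momentum_def)

lemma V_explicit_nonpos:
  assumes "a > 0" "b > 0" "0 \<le> t" "p \<le> 0"
  shows "V_explicit x t p a b = V_nonneg (- x) t (- p) b a"
    "momentum x t p a b = - momentum_nonneg (- x) t (- p) b a"
  using V_nonneg_reflect[OF assms(1-3), of x] assms(4)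
  by (cases "p = 0"; simp add: V_explicit_def momentum_def)+

context
  fixes a b :: real
  assumes ab: "a > 0" "b > 0"
begin

lemma continuous_on_V_explicit:
  "continuous_on {(x, t, p). 0 \<le> t} (\<lambda>(x, t, p). V_explicit x t p a b)" (is ?V)
  "continuous_on {(x, t, p). 0 \<le> t} (\<lambda>(x, t, p). momentum x t p a b)" (is ?M)
proof -
  let ?P = "{(x, t, p). 0 \<le> (t::real) \<and> 0 \<le> (p::real)} :: (real \<times> real \<times> real) set"
  let ?N = "{(x, t, p). 0 \<le> (t::real) \<and> (p::real) \<le> 0} :: (real \<times> real \<times> real) set"
  let ?r = "\<lambda>(x, t, p). (- x, t, - p) :: real \<times> real \<times> real"
  have cl: "closed ?P" "closed ?N"
    unfolding case_prod_unfold
    by (intro closed_Collect_conj closed_Collect_le continuous_intros)+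
  have un: "{(x, t, p). 0 \<le> t} = ?P \<union> ?N" by auto
  have r: "continuous_on ?N ?r" unfolding case_prod_unfold by (intro continuous_intros)
  have img: "?r ` ?N \<subseteq> ?P" by auto
  note refl_V = continuous_on_compose2[OF continuous_on_V_nonneg(1)[OF ab(2,1)] r img]
  note refl_M = continuous_on_minus[OF continuous_on_compose2[OF continuous_on_V_nonneg(2)[OF ab(2,1)] r img]]
  show ?V
    unfolding un
  proof (rule continuous_on_closed_Un[OF cl])
    show "continuous_on ?P (\<lambda>(x, t, p). V_explicit x t p a b)"
      using continuous_on_V_nonneg(1)[OF ab]
      by (rule continuous_on_eq) (auto simp: V_explicit_nonneg)
    show "continuous_on ?N (\<lambda>(x, t, p). V_explicit x t p a b)"
      using refl_V by (rule continuous_on_eq) (auto simp: V_explicit_nonpos[OF ab])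
  qed
  show ?M
    unfolding un
  proof (rule continuous_on_closed_Un[OF cl])
    show "continuous_on ?P (\<lambda>(x, t, p). momentum x t p a b)"
      using continuous_on_V_nonneg(2)[OF ab]
      by (rule continuous_on_eq) (auto simp: V_explicit_nonneg)
    show "continuous_on ?N (\<lambda>(x, t, p). momentum x t p a b)"
      using refl_M by (rule continuous_on_eq) (auto simp: V_explicit_nonpos[OF ab])
  qed
qed

lemma has_grad_V_explicit:
  assumes "0 < t"
  shows "has_grad (\<lambda>z. V_explicit (fst z) (snd z) p a b) (momentum x t p a b)
    (- 1 / 2 * (momentum x t p a b)\<^sup>2 - U a b x) (x, t)"
proof (cases "0 \<le> p")
  case True
  then show ?thesis
    using has_grad_V_nonneg[OF ab True assms] by (simp add: V_explicit_nonneg)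
next
  case False
  have "((\<lambda>z. (- fst z, snd z)) has_derivative (\<lambda>h. (- fst h, snd h))) (at (x, t))"
    by (auto intro!: derivative_eq_intros)
  from has_derivative_compose[OF this]
  have "has_grad (\<lambda>z. V_nonneg (- fst z) (snd z) (- p) b a) (- momentum_nonneg (- x) t (- p) b a)
    (- 1 / 2 * (momentum_nonneg (- x) t (- p) b a)\<^sup>2 - U b a (- x)) (x, t)"
    using has_grad_V_nonneg[OF ab(2,1), of "- p" t "- x"] False assms
    unfolding has_grad_def by fastforce
  moreover have "U b a (- x) = U a b x" by (simp add: U_def)
  ultimately show ?thesis
    using False by (simp add: V_explicit_def momentum_def)
qed

lemma mono_momentum:
  assumes "0 \<le> t"
  shows "mono (\<lambda>x. momentum x t p a b)"
proof (cases "0 \<le> p")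
  case True
  then show ?thesis using mono_momentum_nonneg[OF ab assms True] by (simp add: V_explicit_nonneg)
next
  case False
  then show ?thesis
    using mono_momentum_nonneg[OF ab(2,1) assms, of "- p"]
    by (auto simp: momentum_def mono_def)
qed

lemma momentum_bounds:
  assumes "0 \<le> t"
  shows "p - b * t \<le> momentum x t p a b" "momentum x t p a b \<le> p + a * t"
  using momentum_nonneg_bounds[OF ab assms, of p x] momentum_nonneg_bounds[OF ab(2,1) assms, of "- p" "- x"]
  by (auto simp: momentum_def)

lemma abs_momentum_le:
  assumes "0 \<le> t"
  shows "\<bar>momentum x t p a b\<bar> \<le> \<bar>p\<bar> + (a + b) * t"
proof -
  have "0 \<le> a * t" "0 \<le> b * t" using ab assms by auto
  then show ?thesis
    using momentum_bounds[OF assms, where x = x and p = p] unfolding distrib_right by linarith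
qed

lemma V_explicit_initial: "V_explicit x 0 p a b = p * x"
  using V_nonneg_initial[OF ab, of p x] V_nonneg_initial[OF ab(2,1), of "- p" "- x"]
  by (simp add: V_explicit_def)

end

section \<open>Growth bounds and strict concavity in p\<close>

lemma U_eq: "U a b x = - a * max 0 x - b * max 0 (- x)"
  by (simp add: U_def max_def)

lemma continuous_on_U [continuous_intros]:
  "continuous_on S f \<Longrightarrow> continuous_on S (\<lambda>z. U a b (f z))"
  unfolding U_eq by (intro continuous_intros)

context
  fixes a b :: real
  assumes ab: "a > 0" "b > 0"
begin

lemma continuous_on_V_explicit_fixed_p:
  "continuous_on (UNIV \<times> {0..}) (\<lambda>z. V_explicit (fst z) (snd z) p a b)"
  "continuous_on (UNIV \<times> {0<..}) (\<lambda>z. momentum (fst z) (snd z) p a b)"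
proof -
  have e: "continuous_on S (\<lambda>z. (fst z, snd z, p))" for S :: "(real \<times> real) set"
    by (intro continuous_intros)
  show "continuous_on (UNIV \<times> {0..}) (\<lambda>z. V_explicit (fst z) (snd z) p a b)"
    using continuous_on_compose2[OF continuous_on_V_explicit(1)[OF ab] e, of "UNIV \<times> {0..}"]
    by (simp add: image_subset_iff)
  show "continuous_on (UNIV \<times> {0<..}) (\<lambda>z. momentum (fst z) (snd z) p a b)"
    using continuous_on_compose2[OF continuous_on_V_explicit(2)[OF ab] e, of "UNIV \<times> {0<..}"]
    by (simp add: image_subset_iff)
qed

text \<open>Comparison with \<open>F\<^sub>p\<close> as the classical supersolution; its slope is
  bounded on every time strip. The applications replace calculations with the five formulas by a
  choice of \<open>w\<close>.\<close>

lemma le_V_explicit: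
  assumes w: "continuous_on (UNIV \<times> {0..}) w"
    "\<And>x t. t > 0 \<Longrightarrow> has_grad w (wx (x, t)) (wt (x, t)) (x, t)"
    "\<And>x t. t > 0 \<Longrightarrow> wt (x, t) + 1 / 2 * (wx (x, t))\<^sup>2 + U a b x \<le> 0"
    and init: "\<And>x. w (x, 0) \<le> p * x" and t: "0 \<le> t"
  shows "w (x, t) \<le> V_explicit x t p a b"
proof -
  let ?G = "\<lambda>z. momentum (fst z) (snd z) p a b"
  let ?H = "\<lambda>z. - 1 / 2 * (?G z)\<^sup>2 - U a b (fst z)"
  let ?F = "\<lambda>z. V_explicit (fst z) (snd z) p a b"
  note w_sub = viscosity_subsolutionI_classical[OF w(2,3)]
  have "w (x, t) \<le> ?F (x, t)"
  proof (rule subsolution_le_classical_supersolution[OF w(1) w_sub, where p = ?G and q = ?H])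
    show "continuous_on (UNIV \<times> {0..}) ?F" "continuous_on (UNIV \<times> {0<..}) ?G"
      by (rule continuous_on_V_explicit_fixed_p)+
    show "continuous_on (UNIV \<times> {0<..}) ?H"
      by (intro continuous_intros continuous_on_V_explicit_fixed_p)
    show "has_grad ?F (?G (x, t)) (?H (x, t)) (x, t)" if "t > 0" for x t
      using has_grad_V_explicit[OF ab that] by simp
    show "?H (x, t) + 1 / 2 * (?G (x, t))\<^sup>2 + U a b x \<ge> 0" for x t
      by simp
    show "\<exists>M\<ge>0. \<forall>x. \<forall>t\<in>{0<..T}. ?G (x, t) * x \<ge> - M * \<bar>x\<bar>" if "T > 0" for T
    proof (intro exI conjI allI ballI)
      show "0 \<le> \<bar>p\<bar> + (a + b) * T" using ab that by simp
      fix x t assume t: "t \<in> {0<..T}"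
      have "\<bar>?G (x, t)\<bar> \<le> \<bar>p\<bar> + (a + b) * t" using abs_momentum_le[OF ab, of t x p] t by simp
      also have "\<dots> \<le> \<bar>p\<bar> + (a + b) * T" using t ab by (simp add: mult_left_mono)
      finally have "\<bar>?G (x, t)\<bar> * \<bar>x\<bar> \<le> (\<bar>p\<bar> + (a + b) * T) * \<bar>x\<bar>" by (rule mult_right_mono) simp
      then show "?G (x, t) * x \<ge> - (\<bar>p\<bar> + (a + b) * T) * \<bar>x\<bar>"
        unfolding abs_mult[symmetric] by linarith
    qed
    show "w (x, 0) \<le> ?F (x, 0)" for x
      using init[of x] by (simp add: V_explicit_initial[OF ab])
  qed (use t in auto)
  then show ?thesis by simp
qed

text \<open>The left side is the solution for zero potential; since U \<le> 0, it is a subsolution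
  here.\<close>

lemma V_explicit_lower:
  assumes "0 \<le> t"
  shows "p * x - 1 / 2 * p\<^sup>2 * t \<le> V_explicit x t p a b"
proof -
  let ?w = "\<lambda>z. p * fst z - 1 / 2 * p\<^sup>2 * snd z"
  have "?w (x, t) \<le> V_explicit x t p a b"
  proof (rule le_V_explicit[where wx = "\<lambda>z. p" and wt = "\<lambda>z. - 1 / 2 * p\<^sup>2"])
    show "continuous_on (UNIV \<times> {0..}) ?w" by (intro continuous_intros)
    show "has_grad ?w p (- 1 / 2 * p\<^sup>2) (x, t)" for x t
      unfolding has_grad_def by (auto intro!: derivative_eq_intros simp: fun_eq_iff)
    show "- 1 / 2 * p\<^sup>2 + 1 / 2 * p\<^sup>2 + U a b x \<le> 0" for x
      using ab by (simp add: U_def mult_nonneg_nonpos)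
  qed (use assms in auto)
  then show ?thesis by simp
qed

text \<open>The equation gives a time derivative of at most -U, and integration in time does the
  rest. The bound depends on p only through p x, so the superlinear conjugate can beat it.\<close>

lemma V_explicit_upper:
  assumes t: "0 \<le> t"
  shows "V_explicit x t p a b \<le> p * x + (a + b) * t * \<bar>x\<bar>"
proof -
  let ?g = "\<lambda>s. V_explicit x s p a b - (a + b) * \<bar>x\<bar> * s"
  have "?g t \<le> ?g 0"
  proof (rule DERIV_nonpos_imp_decreasing_open[OF t])
    fix s assume s: "0 < s" "s < t"
    have "((\<lambda>s. V_explicit x s p a b) has_real_derivative
        - 1 / 2 * (momentum x s p a b)\<^sup>2 - U a b x) (at s)"
      using has_grad_partial_t[OF has_grad_V_explicit[OF ab s(1)]] by simp
    then have "(?g has_real_derivative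
        - 1 / 2 * (momentum x s p a b)\<^sup>2 - U a b x - (a + b) * \<bar>x\<bar>) (at s)"
      by (auto intro!: derivative_eq_intros)
    moreover have "- U a b x \<le> (a + b) * \<bar>x\<bar>"
      using ab by (cases "0 \<le> x") (auto simp: U_def algebra_simps mult_nonneg_nonpos)
    moreover have "0 \<le> 1 / 2 * (momentum x s p a b)\<^sup>2" by simp
    ultimately show "\<exists>y. (?g has_real_derivative y) (at s) \<and> y \<le> 0"
      by (intro exI conjI) (assumption, linarith)
  next
    have "continuous_on {0..t} (\<lambda>s. (x, s))" by (intro continuous_intros)
    from continuous_on_compose2[OF continuous_on_V_explicit_fixed_p(1) this]
    have "continuous_on {0..t} (\<lambda>s. V_explicit x s p a b)" by (simp add: image_subset_iff)
    then show "continuous_on {0..t} ?g" by (intro continuous_intros)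
  qed
  then show ?thesis by (simp add: V_explicit_initial[OF ab] mult_ac)
qed

lemma V_explicit_above_tangent:
  assumes t: "0 < t"
  shows "V_explicit x t p a b + momentum x t p a b * (y - x) \<le> V_explicit y t p a b"
proof -
  have D: "((\<lambda>x. V_explicit x t p a b) has_real_derivative momentum x t p a b) (at x)" for x
    using has_grad_partial_x[OF has_grad_V_explicit[OF ab t]] by simp
  have "convex_on UNIV (\<lambda>x. V_explicit x t p a b)"
    using D mono_momentum[OF ab, of t p] t
    by (intro convex_on_realI[where f' = "\<lambda>x. momentum x t p a b"]) (auto dest: monoD)
  from convex_on_imp_above_tangent[OF this _ _ _ D, of x y] show ?thesis by simp
qed

lemma V_explicit_lipschitz:
  assumes t: "0 \<le> t"
  shows "\<bar>V_explicit x t p a b - V_explicit y t p a b\<bar> \<le> (\<bar>p\<bar> + (a + b) * t) * \<bar>x - y\<bar>"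
proof (cases "t = 0")
  case True
  then show ?thesis
    by (simp add: V_explicit_initial[OF ab] flip: right_diff_distrib abs_mult)
next
  case False
  have le: "V_explicit x t p a b - V_explicit y t p a b \<le> (\<bar>p\<bar> + (a + b) * t) * \<bar>x - y\<bar>" for x y
  proof -
    have "V_explicit x t p a b - V_explicit y t p a b \<le> momentum x t p a b * (x - y)"
      using V_explicit_above_tangent[of t x p y] t False by (simp add: algebra_simps)
    also have "\<dots> \<le> \<bar>momentum x t p a b\<bar> * \<bar>x - y\<bar>" by (metis abs_ge_self abs_mult)
    also have "\<dots> \<le> (\<bar>p\<bar> + (a + b) * t) * \<bar>x - y\<bar>"
      using abs_momentum_le[OF ab t] by (intro mult_right_mono) auto
    finally show ?thesis .
  qed
  show ?thesis using le[of x y] le[of y x] by (simp add: abs_le_iff abs_minus_commute)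
qed

text \<open>
  The average of two solutions is a subsolution because the Hamiltonian is convex in the
  momentum. The two momenta stay apart for a short time, which leaves room for adding a
  function of time that is positive for all positive times.
\<close>

lemma V_explicit_strictly_concave:
  assumes "p1 \<noteq> p2" and t: "0 < t"
  shows "(V_explicit x t p1 a b + V_explicit x t p2 a b) / 2 < V_explicit x t ((p1 + p2) / 2) a b"
proof -
  define d where "d = \<bar>p1 - p2\<bar>"
  \<comment> \<open>Up to this time each momentum has moved by at most d / 4 from its initial value,
    so the two still differ by at least d / 2.\<close>
  define t1 where "t1 = d / (4 * (a + b))"
  \<comment> \<open>Chosen so that 8 \<eta> is the square of d / 2.\<close>
  define \<eta> where "\<eta> = d\<^sup>2 / 32"
  \<comment> \<open>\<open>k\<close> starts at 0, its slope falls linearly from \<eta> to 0 at time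
    \<open>t1\<close>, and it is constant afterwards. It is thus C1 and remains positive at all
    later times.\<close>
  define k where "k = (\<lambda>s. \<eta> / (2 * t1) * (t1\<^sup>2 - (max 0 (t1 - s))\<^sup>2))"
  define k' where "k' = (\<lambda>s. \<eta> / t1 * max 0 (t1 - s))"
  have d: "d > 0" using assms by (simp add: d_def)
  have t1: "t1 > 0" using d ab by (simp add: t1_def)
  have \<eta>: "\<eta> > 0" using d by (simp add: \<eta>_def)
  have k_deriv: "(k has_real_derivative k' s) (at s)" for s
  proof -
    have "((\<lambda>s. (max 0 (t1 - s))\<^sup>2) has_real_derivative 2 * max 0 (t1 - s) * (- 1)) (at s)"
      by (rule DERIV_chain2[OF DERIV_max_0_sq]) (auto intro!: derivative_eq_intros)
    from DERIV_cmult[OF DERIV_diff[OF DERIV_const this], of "\<eta> / (2 * t1)"] show ?thesis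
      by (simp add: k_def k'_def)
  qed
  have k_pos: "k t > 0"
  proof -
    have "(max 0 (t1 - t))\<^sup>2 < t1\<^sup>2" using t t1 by (intro power_strict_mono) auto
    then show ?thesis using \<eta> t1 by (simp add: k_def)
  qed
  let ?F = "\<lambda>p z. V_explicit (fst z) (snd z) p a b"
  let ?G = "\<lambda>p z. momentum (fst z) (snd z) p a b"
  let ?H = "\<lambda>p z. - 1 / 2 * (?G p z)\<^sup>2 - U a b (fst z)"
  let ?w = "\<lambda>z. 1 / 2 * ?F p1 z + 1 / 2 * ?F p2 z + k (snd z)"
  have "?w (x, t) \<le> V_explicit x t ((p1 + p2) / 2) a b"
  proof (rule le_V_explicit[where wx = "\<lambda>z. 1 / 2 * ?G p1 z + 1 / 2 * ?G p2 z + 0"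
        and wt = "\<lambda>z. 1 / 2 * ?H p1 z + 1 / 2 * ?H p2 z + k' (snd z)"])
    show "continuous_on (UNIV \<times> {0..}) ?w"
      unfolding k_def by (intro continuous_intros continuous_on_V_explicit_fixed_p)
    show "has_grad ?w (1 / 2 * ?G p1 (x, t) + 1 / 2 * ?G p2 (x, t) + 0)
        (1 / 2 * ?H p1 (x, t) + 1 / 2 * ?H p2 (x, t) + k' (snd (x, t))) (x, t)" if "t > 0" for x t
      using has_grad_V_explicit[OF ab that]
      by (intro has_grad_add has_grad_cmult has_grad_of_t k_deriv) auto
    show "1 / 2 * ?H p1 (x, s) + 1 / 2 * ?H p2 (x, s) + k' (snd (x, s))
        + 1 / 2 * (1 / 2 * ?G p1 (x, s) + 1 / 2 * ?G p2 (x, s) + 0)\<^sup>2 + U a b x \<le> 0"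
      if s: "s > 0" for x s
    proof -
      let ?m1 = "momentum x s p1 a b" and ?m2 = "momentum x s p2 a b"
      \<comment> \<open>Averaging the two equations leaves the convexity defect of half the square,
        which is an eighth of the squared difference of the momenta.\<close>
      have "8 * k' s \<le> (?m1 - ?m2)\<^sup>2"
      proof (cases "s \<le> t1")
        case True
        have "0 \<le> a * s" "0 \<le> b * s" using ab s by auto
        then have "\<bar>?m1 - p1\<bar> \<le> (a + b) * s" "\<bar>?m2 - p2\<bar> \<le> (a + b) * s"
          using momentum_bounds[OF ab, of s] s unfolding distrib_right abs_le_iff
          by (smt (verit))+
        moreover have "(a + b) * s \<le> d / 4"
        proof -
          have "(a + b) * s \<le> (a + b) * t1" using True ab by (intro mult_left_mono) auto
          also have "\<dots> = d / 4" using ab by (simp add: t1_def field_simps)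
          finally show ?thesis .
        qed
        moreover have "\<bar>p1 - p2\<bar> \<le> \<bar>?m1 - ?m2\<bar> + \<bar>?m1 - p1\<bar> + \<bar>?m2 - p2\<bar>" by arith
        ultimately have "d / 2 \<le> \<bar>?m1 - ?m2\<bar>" using d_def by argo
        then have "(d / 2)\<^sup>2 \<le> \<bar>?m1 - ?m2\<bar>\<^sup>2" using d by (intro power_mono) auto
        then have "8 * \<eta> \<le> (?m1 - ?m2)\<^sup>2" by (simp add: \<eta>_def power_divide)
        moreover have "k' s \<le> \<eta>"
        proof -
          have "max 0 (t1 - s) / t1 \<le> 1" using s t1 by simp
          from mult_left_mono[OF this, of \<eta>] \<eta> show ?thesis by (simp add: k'_def)
        qed
        ultimately show ?thesis by linarith
      next
        case False
        then show ?thesis by (simp add: k'_def)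
      qed
      then show ?thesis
        by (simp add: power2_diff power2_sum field_simps)
    qed
    show "?w (x, 0) \<le> (p1 + p2) / 2 * x" for x
      using t1 by (simp add: V_explicit_initial[OF ab] k_def field_simps)
  qed (use t in simp)
  then show ?thesis using k_pos by (simp add: add_divide_distrib)
qed

end

section \<open>The envelope of the explicit solutions\<close>

text \<open>Envelope theorem: optimality at \<open>z\<close> bounds the increment of V from below by
  that of \<open>F (P z)\<close>, and optimality at \<open>w\<close> bounds it from above by that of
  \<open>F (P w)\<close>. By the mean value theorem and joint continuity of the gradients, both
  increments have the same linear part as \<open>w\<close> tends to \<open>z\<close>.\<close>

lemma has_grad_envelope:
  fixes F :: "'p::metric_space \<Rightarrow> real \<times> real \<Rightarrow> real"
  assumes S: "open S" "z \<in> S"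
    and grad: "\<And>p w. w \<in> S \<Longrightarrow> has_grad (F p) (G (w, p)) (H (w, p)) w"
    and cont: "isCont G (z, P z)" "isCont H (z, P z)" "isCont P z"
    and lower: "\<And>w. w \<in> S \<Longrightarrow> V z + F (P z) w - F (P z) z \<le> V w"
    and upper: "\<And>w. w \<in> S \<Longrightarrow> V w \<le> V z + F (P w) w - F (P w) z"
  shows "has_grad V (G (z, P z)) (H (z, P z)) z"
proof -
  let ?L = "\<lambda>h. G (z, P z) * fst h + H (z, P z) * snd h"
  obtain r where r: "r > 0" "ball z r \<subseteq> S" using S open_contains_ball by blast
  have main: "\<exists>d>0. \<forall>w. norm (w - z) < d \<longrightarrow> norm (V w - V z - ?L (w - z)) \<le> e * norm (w - z)"
    if e: "e > 0" for e
  proof -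
    obtain dG where dG: "dG > 0" "\<And>y. dist y (z, P z) < dG \<Longrightarrow> dist (G y) (G (z, P z)) < e / 2"
      using cont(1) e unfolding continuous_at_eps_delta by (metis half_gt_zero)
    obtain dH where dH: "dH > 0" "\<And>y. dist y (z, P z) < dH \<Longrightarrow> dist (H y) (H (z, P z)) < e / 2"
      using cont(2) e unfolding continuous_at_eps_delta by (metis half_gt_zero)
    define d1 where "d1 = min dG dH"
    have d1: "d1 > 0" "\<And>y. dist y (z, P z) < d1 \<Longrightarrow>
        dist (G y) (G (z, P z)) < e / 2 \<and> dist (H y) (H (z, P z)) < e / 2"
      using dG dH by (auto simp: d1_def)
    obtain d2 where d2: "d2 > 0" "\<And>w. dist w z < d2 \<Longrightarrow> dist (P w) (P z) < d1 / 2"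
      using cont(3) d1(1) unfolding continuous_at_eps_delta
      by (metis half_gt_zero)
    \<comment> \<open>The distance allowed in joint continuity is shared equally between the base
      point and the parameter; \<open>r\<close> keeps the whole segment inside
      \<open>S\<close>.\<close>
    define d where "d = min r (min d2 (d1 / 2))"
    have d: "d > 0" using r d1 d2 by (simp add: d_def)
    have increment: "\<bar>F q w - F q z - ?L (w - z)\<bar> \<le> e * norm (w - z)"
      if w: "norm (w - z) < d" and q: "dist q (P z) < d1 / 2" for w q
    proof -
      define y where "y = (\<lambda>s. z + s *\<^sub>R (w - z))"
      have y_near: "norm (y s - z) < d" if "0 \<le> s" "s \<le> 1" for s
      proof -
        have "norm (y s - z) = s * norm (w - z)" using that by (simp add: y_def)
        also have "\<dots> \<le> 1 * norm (w - z)" using that by (intro mult_right_mono) auto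
        finally show ?thesis using w by simp
      qed
      have y_S: "y s \<in> S" if "0 \<le> s" "s \<le> 1" for s
      proof -
        have "y s \<in> ball z r"
          using y_near[OF that] by (simp add: d_def dist_norm norm_minus_commute)
        then show ?thesis using r by blast
      qed
      have "((\<lambda>s. F q (y s)) has_real_derivative
          G (y s, q) * fst (w - z) + H (y s, q) * snd (w - z)) (at s)" if "0 \<le> s" "s \<le> 1" for s
      proof -
        have "(y has_derivative (\<lambda>h. h *\<^sub>R (w - z))) (at s)"
          unfolding y_def by (auto intro!: derivative_eq_intros)
        note has_derivative_compose[OF this grad[OF y_S[OF that], unfolded has_grad_def]]
        then show ?thesis
          unfolding has_field_derivative_def
          by (rule has_derivative_eq_rhs) (simp add: fun_eq_iff algebra_simps)
      qed
      from MVT2[OF zero_less_one this] obtain s where s: "0 < s" "s < 1"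
        and eq: "F q (y 1) - F q (y 0) = G (y s, q) * fst (w - z) + H (y s, q) * snd (w - z)"
        by auto
      have "dist (y s, q) (z, P z) \<le> dist (y s) z + dist q (P z)"
        unfolding dist_Pair_Pair by (rule sqrt_sum_squares_le_sum) auto
      also have "\<dots> < d1"
        using y_near[of s] s q by (simp add: d_def dist_norm)
      finally have "dist (y s, q) (z, P z) < d1" .
      from d1(2)[OF this]
      have near: "\<bar>G (y s, q) - G (z, P z)\<bar> \<le> e / 2" "\<bar>H (y s, q) - H (z, P z)\<bar> \<le> e / 2"
        by (simp_all add: dist_real_def)
      have "F q w - F q z - ?L (w - z)
          = (G (y s, q) - G (z, P z)) * fst (w - z) + (H (y s, q) - H (z, P z)) * snd (w - z)"
        using eq by (simp add: y_def algebra_simps)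
      also have "\<bar>\<dots>\<bar> \<le> \<bar>G (y s, q) - G (z, P z)\<bar> * \<bar>fst (w - z)\<bar>
          + \<bar>H (y s, q) - H (z, P z)\<bar> * \<bar>snd (w - z)\<bar>"
        unfolding abs_mult[symmetric] by (rule abs_triangle_ineq)
      also have "\<dots> \<le> e / 2 * norm (w - z) + e / 2 * norm (w - z)"
        using near dist_fst_le[of w z] dist_snd_le[of w z] e
        by (intro add_mono mult_mono) (auto simp: dist_norm)
      finally show ?thesis by simp
    qed
    have "norm (V w - V z - ?L (w - z)) \<le> e * norm (w - z)" if w: "norm (w - z) < d" for w
    proof -
      have wS: "w \<in> S" using w r by (auto simp: d_def dist_norm norm_minus_commute)
      have "\<bar>F (P z) w - F (P z) z - ?L (w - z)\<bar> \<le> e * norm (w - z)"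
        using increment[OF w, of "P z"] d1 by simp
      moreover have "\<bar>F (P w) w - F (P w) z - ?L (w - z)\<bar> \<le> e * norm (w - z)"
        using increment[OF w, of "P w"] d2(2)[of w] w by (simp add: d_def dist_norm)
      ultimately show ?thesis using lower[OF wS] upper[OF wS] by (simp add: abs_le_iff)
    qed
    then show ?thesis using d by blast
  qed
  have "bounded_linear ?L"
    by (intro bounded_linear_add bounded_linear_const_mult bounded_linear_fst bounded_linear_snd)
  then show ?thesis unfolding has_grad_def has_derivative_at_alt using main by blast
qed

lemma convex_on_UNIV_subgradient:
  fixes f :: "real \<Rightarrow> real"
  assumes "convex_on UNIV f"
  obtains p where "\<And>y. f x + p * (y - x) \<le> f y"
  using convex_le_Inf_differential[OF assms, of x] by auto

text \<open>A small step in the direction of the sign of q makes the quotient at most L - |q|,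
  whereas its lower limit must be nonnegative.\<close>

lemma frechet_subdiff_bounded:
  assumes lip: "\<And>y. \<bar>y - x\<bar> \<le> 1 \<Longrightarrow> \<bar>g y - g x\<bar> \<le> L * \<bar>y - x\<bar>"
    and q: "q \<in> frechet_subdiff g x"
  shows "\<bar>q\<bar> \<le> L"
proof (rule ccontr)
  assume "\<not> \<bar>q\<bar> \<le> L"
  define e where "e = (\<bar>q\<bar> - L) / 2"
  have e: "e > 0" using \<open>\<not> \<bar>q\<bar> \<le> L\<close> by (simp add: e_def)
  let ?Q = "\<lambda>y. (g y - g x - q * (y - x)) / \<bar>y - x\<bar>"
  have "ereal (- e) < 0 \<longrightarrow> (\<forall>\<^sub>F y in at x. ereal (- e) < ereal (?Q y))"
    using q unfolding frechet_subdiff_def mem_Collect_eq le_Liminf_iff by blast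
  then have "\<forall>\<^sub>F y in at x. - e < ?Q y" using e by simp
  then obtain d where d: "d > 0" "\<And>y. y \<noteq> x \<Longrightarrow> dist y x < d \<Longrightarrow> - e < ?Q y"
    unfolding eventually_at by auto
  define r where "r = min (d / 2) 1"
  have r: "r > 0" "r \<le> 1" "r < d" using d by (auto simp: r_def)
  define y where "y = (if q \<ge> 0 then x + r else x - r)"
  have y: "y \<noteq> x" "\<bar>y - x\<bar> = r" "q * (y - x) = \<bar>q\<bar> * r" using r by (auto simp: y_def)
  have "g y - g x - q * (y - x) \<le> L * r - \<bar>q\<bar> * r"
    using lip[of y] y r by (simp add: abs_le_iff)
  then have "?Q y \<le> (L * r - \<bar>q\<bar> * r) / r"
    unfolding y(2) using r by (intro divide_right_mono) auto
  also have "\<dots> = L - \<bar>q\<bar>" using r by (simp add: field_simps)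
  also have "\<dots> = - 2 * e" by (simp add: e_def)
  finally show False using d(2)[of y] y r e by (simp add: dist_real_def)
qed

section \<open>Conjugate duality and the maximising parameter\<close>

context
  fixes a b :: real and \<Phi> :: "real \<Rightarrow> real"
  assumes ab: "a > 0" "b > 0" and convex: "convex_on UNIV \<Phi>"
begin

text \<open>
  The epigraph of the conjugate: working with pairs \<open>(p, c)\<close>, \<open>c \<ge> \<Phi>\<^sup>*(p)\<close>, avoids
  infinite values.
\<close>

definition conj_epi :: "(real \<times> real) set" where
  "conj_epi = {(p, c). \<forall>y. p * y - \<Phi> y \<le> c}"

definition payoff :: "real \<times> real \<Rightarrow> real \<times> real \<Rightarrow> real" where
  "payoff z q = V_explicit (fst z) (snd z) (fst q) a b - snd q"

text \<open>The payoff decreases in the second component, so an optimal pair has the conjugate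
  itself there.\<close>

definition optimal :: "real \<times> real \<Rightarrow> real \<times> real \<Rightarrow> bool" where
  "optimal z q \<longleftrightarrow> q \<in> conj_epi \<and> (\<forall>q'\<in>conj_epi. payoff z q' \<le> payoff z q)"

text \<open>For t = 0 the maximising slopes are the subgradients of \<Phi> at x and need not be
  unique, hence the choice operator. Uniqueness is available for t > 0.\<close>

definition opt :: "real \<times> real \<Rightarrow> real \<times> real" where
  "opt z = (SOME q. optimal z q)"

lemma closed_conj_epi: "closed conj_epi"
proof -
  have "conj_epi = (\<Inter>y. {q. fst q * y - \<Phi> y \<le> snd q})" by (auto simp: conj_epi_def)
  also have "closed \<dots>" by (intro closed_INT ballI closed_Collect_le continuous_intros)
  finally show ?thesis .
qed

lemma conj_epi_midpoint:
  assumes "q \<in> conj_epi" "q' \<in> conj_epi"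
  shows "((fst q + fst q') / 2, (snd q + snd q') / 2) \<in> conj_epi"
proof -
  have "(fst q + fst q') / 2 * y - \<Phi> y \<le> (snd q + snd q') / 2" for y
  proof -
    have "fst q * y - \<Phi> y \<le> snd q" "fst q' * y - \<Phi> y \<le> snd q'"
      using assms by (auto simp: conj_epi_def)
    then show ?thesis by (simp add: field_simps)
  qed
  then show ?thesis by (simp add: conj_epi_def)
qed

text \<open>Equality case of the Fenchel-Young inequality, attained at a subgradient of
  \<Phi>.\<close>

lemma conj_epi_subgradient:
  obtains p where "(p, p * x - \<Phi> x) \<in> conj_epi"
proof -
  obtain p where "\<And>y. \<Phi> x + p * (y - x) \<le> \<Phi> y"
    using convex_on_UNIV_subgradient[OF convex] by blast
  then have "(p, p * x - \<Phi> x) \<in> conj_epi" by (force simp: conj_epi_def algebra_simps)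
  then show thesis by (rule that)
qed

lemma conj_epi_nonempty: "conj_epi \<noteq> {}"
  using conj_epi_subgradient by blast

lemma continuous_on_payoff:
  "continuous_on ((UNIV \<times> {0..}) \<times> UNIV) (\<lambda>(z, q). payoff z q)"
proof -
  have "continuous_on ((UNIV \<times> {0..}) \<times> UNIV)
      (\<lambda>w. (fst (fst w), snd (fst w), fst (snd w)) :: real \<times> real \<times> real)"
    by (intro continuous_intros)
  from continuous_on_compose2[OF continuous_on_V_explicit(1)[OF ab] this]
  have "continuous_on ((UNIV \<times> {0..}) \<times> UNIV)
      (\<lambda>w. V_explicit (fst (fst w)) (snd (fst w)) (fst (snd w)) a b)"
    by (simp add: image_subset_iff)
  then show ?thesis unfolding payoff_def case_prod_unfold by (intro continuous_intros)
qed

text \<open>Any pair doing at least as well as a fixed reference pair on a bounded box lies in a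
  fixed compact set. This coercivity drives existence, continuity and the local Lipschitz
  bound.\<close>

lemma competitive_bounded:
  assumes q0: "q0 \<in> conj_epi" and \<rho>: "\<rho> > 0"
  obtains \<Lambda> where "\<And>x t q. \<bar>x\<bar> \<le> \<rho> \<Longrightarrow> 0 \<le> t \<Longrightarrow> t \<le> \<rho> \<Longrightarrow> q \<in> conj_epi \<Longrightarrow>
    payoff (x, t) q0 \<le> payoff (x, t) q \<Longrightarrow> \<bar>fst q\<bar> \<le> \<Lambda> \<and> \<bar>snd q\<bar> \<le> \<Lambda>"
proof -
  define K where "K = \<bar>fst q0\<bar> * \<rho> + 1 / 2 * (fst q0)\<^sup>2 * \<rho> + \<bar>snd q0\<bar>"
  \<comment> \<open>The conjugate is tested one unit outside the box: there it grows at rate \<rho>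
    + 1 in the size of p, against the rate \<rho> of the explicit solutions inside.\<close>
  define A where "A = max (\<Phi> (\<rho> + 1)) (\<Phi> (- (\<rho> + 1)))"
  define N where "N = K + (a + b) * \<rho> * \<rho> + \<bar>A\<bar>"
  define \<Lambda> where "\<Lambda> = N * \<rho> + N + \<bar>\<Phi> 0\<bar>"
  have ab_pos: "0 \<le> (a + b) * \<rho> * \<rho>" using ab \<rho> by simp
  have K: "0 \<le> K" using \<rho> by (simp add: K_def)
  have N: "0 \<le> N" using K ab_pos by (simp add: N_def)
  have "\<bar>fst q\<bar> \<le> \<Lambda> \<and> \<bar>snd q\<bar> \<le> \<Lambda>"
    if x: "\<bar>x\<bar> \<le> \<rho>" and t: "0 \<le> t" "t \<le> \<rho>" and q: "q \<in> conj_epi"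
      and le: "payoff (x, t) q0 \<le> payoff (x, t) q" for x t q
  proof -
    obtain p c where pc: "q = (p, c)" by force
    have q_le: "p * y - \<Phi> y \<le> c" for y using q by (auto simp: conj_epi_def pc)
    have "- (\<bar>fst q0\<bar> * \<rho>) \<le> fst q0 * x"
    proof -
      have "\<bar>fst q0 * x\<bar> \<le> \<bar>fst q0\<bar> * \<rho>" unfolding abs_mult by (intro mult_left_mono x) simp
      then show ?thesis by linarith
    qed
    moreover have "1 / 2 * (fst q0)\<^sup>2 * t \<le> 1 / 2 * (fst q0)\<^sup>2 * \<rho>"
      by (intro mult_left_mono t) simp
    moreover have "fst q0 * x - 1 / 2 * (fst q0)\<^sup>2 * t - snd q0 \<le> payoff (x, t) q0"
      using V_explicit_lower[OF ab t(1), of "fst q0" x] by (simp add: payoff_def)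
    ultimately have lower: "- K \<le> payoff (x, t) q0" unfolding K_def by linarith
    have "V_explicit x t p a b \<le> p * x + (a + b) * t * \<bar>x\<bar>"
      by (rule V_explicit_upper[OF ab t(1)])
    moreover have "p * x \<le> \<bar>p\<bar> * \<rho>"
    proof -
      have "\<bar>p * x\<bar> \<le> \<bar>p\<bar> * \<rho>" unfolding abs_mult by (intro mult_left_mono x) simp
      then show ?thesis by linarith
    qed
    moreover have "(a + b) * t * \<bar>x\<bar> \<le> (a + b) * \<rho> * \<rho>"
      using ab t x \<rho> by (intro mult_mono mult_left_mono) auto
    ultimately have upper: "V_explicit x t p a b \<le> \<bar>p\<bar> * \<rho> + (a + b) * \<rho> * \<rho>" by linarith
    have "\<bar>p\<bar> * (\<rho> + 1) - A \<le> c"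
    proof (cases "0 \<le> p")
      case True
      then show ?thesis using q_le[of "\<rho> + 1"] by (simp add: A_def)
    next
      case False
      then show ?thesis using q_le[of "- (\<rho> + 1)"] by (simp add: A_def algebra_simps)
    qed
    moreover have diff: "- K \<le> V_explicit x t p a b - c"
      using lower le by (simp add: payoff_def pc)
    ultimately have p: "\<bar>p\<bar> \<le> N"
      using upper unfolding N_def distrib_left by linarith
    then have pr: "\<bar>p\<bar> * \<rho> \<le> N * \<rho>" using \<rho> by (intro mult_right_mono) auto
    have "c \<le> N * \<rho> + N" using diff upper pr by (simp add: N_def)
    moreover have "- \<bar>\<Phi> 0\<bar> \<le> c" using q_le[of 0] by simp
    moreover have "0 \<le> N * \<rho>" using N \<rho> by simp
    ultimately show ?thesis using p N by (auto simp: pc \<Lambda>_def abs_le_iff)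
  qed
  then show thesis by (rule that) blast+
qed

lemma optimal_exists:
  assumes "0 \<le> t"
  shows "\<exists>q. optimal (x, t) q"
proof -
  obtain q0 where q0: "q0 \<in> conj_epi" using conj_epi_nonempty by blast
  define \<rho> where "\<rho> = \<bar>x\<bar> + t + 1"
  have \<rho>: "\<rho> > 0" "\<bar>x\<bar> \<le> \<rho>" "t \<le> \<rho>" using assms by (auto simp: \<rho>_def)
  obtain \<Lambda> where "\<And>y s q. \<bar>y\<bar> \<le> \<rho> \<Longrightarrow> 0 \<le> s \<Longrightarrow> s \<le> \<rho> \<Longrightarrow> q \<in> conj_epi \<Longrightarrow>
      payoff (y, s) q0 \<le> payoff (y, s) q \<Longrightarrow> \<bar>fst q\<bar> \<le> \<Lambda> \<and> \<bar>snd q\<bar> \<le> \<Lambda>"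
    using competitive_bounded[OF q0 \<rho>(1)] by blast
  note \<Lambda> = this[OF \<rho>(2) assms \<rho>(3)]
  define B where "B = conj_epi \<inter> ({-\<Lambda>..\<Lambda>} \<times> {-\<Lambda>..\<Lambda>})"
  have "compact B"
    unfolding B_def by (intro closed_Int_compact closed_conj_epi compact_Times compact_Icc)
  moreover have q0B: "q0 \<in> B"
    using q0 \<Lambda>[OF q0] by (cases q0) (auto simp: B_def abs_le_iff)
  moreover have "continuous_on B (payoff (x, t))"
  proof -
    have "continuous_on B (\<lambda>q. ((x, t), q))" by (intro continuous_intros)
    from continuous_on_compose2[OF continuous_on_payoff this] show ?thesis
      using assms by (simp add: image_subset_iff)
  qed
  ultimately obtain q where q: "q \<in> B" "\<And>q'. q' \<in> B \<Longrightarrow> payoff (x, t) q' \<le> payoff (x, t) q"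
    using continuous_attains_sup[of B "payoff (x, t)"] by blast
  have "payoff (x, t) q' \<le> payoff (x, t) q" if "q' \<in> conj_epi" for q'
  proof (cases "payoff (x, t) q0 \<le> payoff (x, t) q'")
    case True
    then have "q' \<in> B" using \<Lambda>[OF that] that by (cases q') (auto simp: B_def abs_le_iff)
    then show ?thesis by (rule q(2))
  next
    case False
    then show ?thesis using q(2)[OF q0B] by linarith
  qed
  then have "optimal (x, t) q" using q(1) by (auto simp: optimal_def B_def)
  then show ?thesis ..
qed

lemma optimal_opt: "0 \<le> t \<Longrightarrow> optimal (x, t) (opt (x, t))"
  unfolding opt_def using optimal_exists by (rule someI_ex)

lemma opt_in_conj_epi: "0 \<le> t \<Longrightarrow> opt (x, t) \<in> conj_epi"
  and payoff_le_opt: "0 \<le> t \<Longrightarrow> q \<in> conj_epi \<Longrightarrow> payoff (x, t) q \<le> payoff (x, t) (opt (x, t))"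
  using optimal_opt by (auto simp: optimal_def)

text \<open>The midpoint of two optimal pairs is admissible, and strict concavity would make it
  better unless the slopes agree; equal payoffs then force equal second components.\<close>

lemma optimal_unique:
  assumes t: "0 < t" and q: "optimal (x, t) q" "optimal (x, t) q'"
  shows "q = q'"
proof -
  have eq: "payoff (x, t) q = payoff (x, t) q'"
    using q by (auto simp: optimal_def intro: antisym)
  have "fst q = fst q'"
  proof (rule ccontr)
    assume ne: "fst q \<noteq> fst q'"
    have "payoff (x, t) ((fst q + fst q') / 2, (snd q + snd q') / 2) \<le> payoff (x, t) q"
      using q conj_epi_midpoint by (auto simp: optimal_def)
    then show False
      using V_explicit_strictly_concave[OF ab ne t, of x] eq by (simp add: payoff_def field_simps)
  qed
  then show ?thesis using eq by (simp add: payoff_def prod_eq_iff)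
qed

lemma opt_bounded:
  assumes "\<rho> > 0"
  obtains \<Lambda> where "\<And>x t. \<bar>x\<bar> \<le> \<rho> \<Longrightarrow> 0 \<le> t \<Longrightarrow> t \<le> \<rho> \<Longrightarrow>
    \<bar>fst (opt (x, t))\<bar> \<le> \<Lambda> \<and> \<bar>snd (opt (x, t))\<bar> \<le> \<Lambda>"
proof -
  obtain q0 where q0: "q0 \<in> conj_epi" using conj_epi_nonempty by blast
  show thesis
    using competitive_bounded[OF q0 assms] that opt_in_conj_epi payoff_le_opt[OF _ q0] by metis
qed

text \<open>Closed inequalities between payoffs cut out the set of optimal pairs. By uniqueness this
  set is the graph of \<open>opt\<close>, and a closed graph with values in a compact set belongs to
  a continuous function.\<close>

lemma continuous_on_opt: "continuous_on (UNIV \<times> {0<..}) opt"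
proof -
  have "isCont opt (x, t)" if t: "0 < t" for x t
  proof -
    define \<rho> where "\<rho> = \<bar>x\<bar> + t + 1"
    define S where "S = {-\<rho><..<\<rho>} \<times> {0<..<\<rho>}"
    have \<rho>: "\<rho> > 0" using t by (simp add: \<rho>_def)
    have open_S: "open S" by (simp add: S_def open_Times)
    have xt: "(x, t) \<in> S" using t by (auto simp: S_def \<rho>_def)
    obtain \<Lambda> where \<Lambda>: "\<And>x t. \<bar>x\<bar> \<le> \<rho> \<Longrightarrow> 0 \<le> t \<Longrightarrow> t \<le> \<rho> \<Longrightarrow>
        \<bar>fst (opt (x, t))\<bar> \<le> \<Lambda> \<and> \<bar>snd (opt (x, t))\<bar> \<le> \<Lambda>"
      using opt_bounded[OF \<rho>] by blast
    define T where "T = conj_epi \<inter> ({-\<Lambda>..\<Lambda>} \<times> {-\<Lambda>..\<Lambda>})"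
    have "compact T"
      unfolding T_def by (intro closed_Int_compact closed_conj_epi compact_Times compact_Icc)
    moreover have in_T: "opt \<in> S \<rightarrow> T"
    proof
      fix z assume "z \<in> S"
      then obtain y s where z: "z = (y, s)" "\<bar>y\<bar> \<le> \<rho>" "0 < s" "s \<le> \<rho>" by (force simp: S_def)
      then have "\<bar>fst (opt z)\<bar> \<le> \<Lambda>" "\<bar>snd (opt z)\<bar> \<le> \<Lambda>" using \<Lambda>[of y s] by auto
      then show "opt z \<in> T"
        using opt_in_conj_epi[of s y] z
        by (cases "opt z") (auto simp: T_def abs_le_iff)
    qed
    moreover have "closedin (top_of_set (S \<times> T)) ((\<lambda>z. (z, opt z)) ` S)"
    proof -
      let ?C = "\<lambda>q'. (S \<times> T) \<inter> (\<lambda>w. payoff (fst w) (snd w) - payoff (fst w) q') -` {0..}"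
      have "(\<lambda>z. (z, opt z)) ` S = (\<Inter>q'\<in>conj_epi. ?C q')" (is "?L = ?R")
      proof
        show "?L \<subseteq> ?R"
        proof
          fix w assume "w \<in> ?L"
          then obtain y s where w: "w = ((y, s), opt (y, s))" and ys: "(y, s) \<in> S" by auto
          then have "0 \<le> s" by (simp add: S_def)
          then show "w \<in> ?R"
            using payoff_le_opt in_T ys by (auto simp: Pi_def w)
        qed
        show "?R \<subseteq> ?L"
        proof
          fix w assume w: "w \<in> ?R"
          obtain y s q where wq: "w = ((y, s), q)" by (metis surj_pair)
          have ysq: "(y, s) \<in> S" "q \<in> conj_epi"
            using w conj_epi_nonempty by (auto simp: wq T_def)
          moreover have "payoff (y, s) q' \<le> payoff (y, s) q" if "q' \<in> conj_epi" for q'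
          proof -
            have "w \<in> ?C q'" using w that by blast
            then show ?thesis by (simp add: wq)
          qed
          ultimately have "optimal (y, s) q" by (simp add: optimal_def)
          moreover have "0 < s" using ysq by (simp add: S_def)
          ultimately have "q = opt (y, s)" using optimal_unique optimal_opt by simp
          then show "w \<in> ?L" using ysq wq by simp
        qed
      qed
      moreover have "closedin (top_of_set (S \<times> T)) (?C q')" if "q' \<in> conj_epi" for q'
      proof (rule continuous_closedin_preimage)
        have sub: "S \<times> T \<subseteq> (UNIV \<times> {0..}) \<times> UNIV" by (auto simp: S_def)
        have 1: "continuous_on (S \<times> T) (\<lambda>w. payoff (fst w) (snd w))"
          using continuous_on_subset[OF continuous_on_payoff sub] by (simp add: case_prod_unfold)
        have "continuous_on (S \<times> T) (\<lambda>w. (fst w, q'))" by (intro continuous_intros)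
        from continuous_on_compose2[OF continuous_on_payoff this]
        have "continuous_on (S \<times> T) (\<lambda>w. payoff (fst w) q')"
          using sub by (force simp: image_subset_iff)
        with 1 show "continuous_on (S \<times> T) (\<lambda>w. payoff (fst w) (snd w) - payoff (fst w) q')"
          by (intro continuous_intros)
      qed simp
      ultimately show ?thesis
        using conj_epi_nonempty by (simp only:) (rule closedin_INT; blast)
    qed
    ultimately have "continuous_on S opt" by (simp add: continuous_closed_graph_eq)
    then show ?thesis using open_S xt continuous_on_eq_continuous_at by blast
  qed
  then show ?thesis
    by (intro continuous_at_imp_continuous_on) auto
qed

text \<open>Gives finiteness and attainment at once by passing from the extended-valued supremum to
  the maximum over the epigraph. An infinite conjugate contributes minus infinity and so cannot
  matter.\<close>

lemma V_sup_eq: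
  assumes t: "0 \<le> t"
  shows "V_sup \<Phi> a b x t = ereal (payoff (x, t) (opt (x, t)))"
proof (rule antisym)
  obtain p c where pc: "opt (x, t) = (p, c)" by force
  have epi_iff: "legendre \<Phi> p' \<le> ereal c' \<longleftrightarrow> (p', c') \<in> conj_epi" for p' c'
    by (simp add: legendre_def SUP_le_iff conj_epi_def)
  show "V_sup \<Phi> a b x t \<le> ereal (payoff (x, t) (opt (x, t)))"
    unfolding V_sup_def
  proof (rule SUP_least)
    fix p'
    \<comment> \<open>Testing at 0 shows that the conjugate is never minus infinity.\<close>
    have "ereal (p' * 0 - \<Phi> 0) \<le> legendre \<Phi> p'"
      unfolding legendre_def by (rule SUP_upper) simp
    then have "legendre \<Phi> p' \<noteq> - \<infinity>" by auto
    show "ereal (V_explicit x t p' a b) - legendre \<Phi> p' \<le> ereal (payoff (x, t) (opt (x, t)))"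
    proof (cases "legendre \<Phi> p'")
      case (real c')
      then have "(p', c') \<in> conj_epi" using epi_iff[of p' c'] real by simp
      from payoff_le_opt[OF t this, of x] show ?thesis by (simp add: real payoff_def)
    qed (use \<open>legendre \<Phi> p' \<noteq> - \<infinity>\<close> in auto)
  qed
  have "legendre \<Phi> p \<le> ereal c" using opt_in_conj_epi[OF t, of x] by (simp add: epi_iff pc)
  then have "ereal (V_explicit x t p a b) - ereal c \<le> ereal (V_explicit x t p a b) - legendre \<Phi> p"
    by (intro ereal_minus_mono) auto
  also have "\<dots> \<le> V_sup \<Phi> a b x t" unfolding V_sup_def by (rule SUP_upper) simp
  finally show "ereal (payoff (x, t) (opt (x, t))) \<le> V_sup \<Phi> a b x t" by (simp add: payoff_def pc)
qed

lemma V_fun_eq: "0 \<le> t \<Longrightarrow> V_fun \<Phi> a b (x, t) = payoff (x, t) (opt (x, t))"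
  by (simp add: V_fun_def V_sup_eq)

lemma payoff_le_V_fun: "0 \<le> t \<Longrightarrow> q \<in> conj_epi \<Longrightarrow> payoff (x, t) q \<le> V_fun \<Phi> a b (x, t)"
  by (simp add: V_fun_eq payoff_le_opt)

text \<open>At t = 0 this is the biconjugate theorem: Fenchel-Young in one direction, a subgradient
  at x in the other.\<close>

lemma V_fun_initial: "V_fun \<Phi> a b (x, 0) = \<Phi> x"
proof (rule antisym)
  obtain p c where pc: "opt (x, 0) = (p, c)" by force
  then have "p * x - \<Phi> x \<le> c" using opt_in_conj_epi[of 0 x] by (simp add: conj_epi_def)
  then show "V_fun \<Phi> a b (x, 0) \<le> \<Phi> x"
    by (simp add: V_fun_eq payoff_def pc V_explicit_initial[OF ab])
  obtain p where "(p, p * x - \<Phi> x) \<in> conj_epi" using conj_epi_subgradient by blast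
  from payoff_le_V_fun[OF order_refl this, of x] show "\<Phi> x \<le> V_fun \<Phi> a b (x, 0)"
    by (simp add: payoff_def V_explicit_initial[OF ab])
qed

text \<open>The initial time is included, where \<open>opt\<close> may jump, so continuity of
  \<open>opt\<close> cannot be used. Instead the optimal pair of one point is kept as a competitor
  at the other, and the payoff is uniformly continuous on compact sets.\<close>

lemma continuous_on_V_fun: "continuous_on (UNIV \<times> {0..}) (V_fun \<Phi> a b)"
  unfolding continuous_on_iff
proof (intro ballI allI impI)
  fix z :: "real \<times> real" and e :: real
  assume z: "z \<in> UNIV \<times> {0..}" and e: "e > 0"
  define \<rho> where "\<rho> = \<bar>fst z\<bar> + snd z + 1"
  have \<rho>: "\<rho> > 0" using z by (auto simp: \<rho>_def)
  obtain \<Lambda> where \<Lambda>: "\<And>x t. \<bar>x\<bar> \<le> \<rho> \<Longrightarrow> 0 \<le> t \<Longrightarrow> t \<le> \<rho> \<Longrightarrow>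
      \<bar>fst (opt (x, t))\<bar> \<le> \<Lambda> \<and> \<bar>snd (opt (x, t))\<bar> \<le> \<Lambda>"
    using opt_bounded[OF \<rho>] by blast
  let ?Q = "{-\<rho>..\<rho>} \<times> {0..\<rho>}" and ?T = "{-\<Lambda>..\<Lambda>} \<times> {-\<Lambda>..\<Lambda>}"
  have in_T: "opt w \<in> ?T" if "w \<in> ?Q" for w
    using \<Lambda>[of "fst w" "snd w"] that by (cases w; cases "opt w") (auto simp: abs_le_iff)
  have "uniformly_continuous_on (?Q \<times> ?T) (\<lambda>(z, q). payoff z q)"
    by (intro compact_uniformly_continuous compact_Times compact_Icc
        continuous_on_subset[OF continuous_on_payoff]) auto
  then obtain d where d: "d > 0" "\<And>w w'. w \<in> ?Q \<times> ?T \<Longrightarrow> w' \<in> ?Q \<times> ?T \<Longrightarrow> dist w' w < d \<Longrightarrow>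
      dist (payoff (fst w') (snd w')) (payoff (fst w) (snd w)) < e"
    unfolding uniformly_continuous_on_def using e by (metis (no_types, lifting) case_prod_unfold)
  have step: "V_fun \<Phi> a b w' < V_fun \<Phi> a b w + e"
    if w: "w \<in> ?Q" "w' \<in> ?Q" "dist w' w < d" for w w'
  proof -
    have "dist (payoff w (opt w')) (payoff w' (opt w')) < e"
      using d(2)[of "(w', opt w')" "(w, opt w')"] w in_T[of w']
      by (simp add: dist_Pair_Pair dist_commute mem_Times_iff)
    moreover have "payoff w (opt w') \<le> V_fun \<Phi> a b w"
      using w by (cases w; cases w') (auto intro!: payoff_le_V_fun opt_in_conj_epi)
    moreover have "V_fun \<Phi> a b w' = payoff w' (opt w')"
      using w by (cases w') (auto simp: V_fun_eq)
    ultimately show ?thesis by (simp add: dist_real_def)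
  qed
  show "\<exists>d>0. \<forall>w\<in>UNIV \<times> {0..}. dist w z < d \<longrightarrow> dist (V_fun \<Phi> a b w) (V_fun \<Phi> a b z) < e"
  proof (intro exI conjI ballI impI)
    show "0 < min d 1" using d by simp
    fix w :: "real \<times> real" assume w: "w \<in> UNIV \<times> {0..}" "dist w z < min d 1"
    have "\<bar>fst w - fst z\<bar> < 1" "\<bar>snd w - snd z\<bar> < 1"
      using w(2) dist_fst_le[of w z] dist_snd_le[of w z] by (auto simp: dist_real_def)
    then have "w \<in> ?Q" using w(1) z by (cases w; cases z) (auto simp: \<rho>_def)
    moreover have "z \<in> ?Q" using z by (cases z) (auto simp: \<rho>_def)
    ultimately show "dist (V_fun \<Phi> a b w) (V_fun \<Phi> a b z) < e"
      using step[of z w] step[of w z] w(2) by (simp add: dist_real_def abs_less_iff dist_commute)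
  qed
qed

section \<open>The supremum as a classical solution\<close>

definition V_x :: "real \<times> real \<Rightarrow> real" where
  "V_x z = momentum (fst z) (snd z) (fst (opt z)) a b"

definition V_t :: "real \<times> real \<Rightarrow> real" where
  "V_t z = - 1 / 2 * (V_x z)\<^sup>2 - U a b (fst z)"

lemma continuous_on_V_x: "continuous_on (UNIV \<times> {0<..}) V_x"
proof -
  have "continuous_on (UNIV \<times> {0<..}) (\<lambda>z. (fst z, snd z, fst (opt z)))"
    by (intro continuous_intros continuous_on_opt)
  from continuous_on_compose2[OF continuous_on_V_explicit(2)[OF ab] this]
  show ?thesis unfolding V_x_def by (simp add: image_subset_iff)
qed

lemma continuous_on_V_t: "continuous_on (UNIV \<times> {0<..}) V_t"
  unfolding V_t_def by (intro continuous_intros continuous_on_V_x)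

text \<open>The envelope theorem with the first component of \<open>opt\<close> as parameter. The
  conjugate term of each pair cancels in the increments, so no regularity of the conjugate
  enters.\<close>

lemma has_grad_V_fun:
  assumes t: "0 < t"
  shows "has_grad (V_fun \<Phi> a b) (V_x (x, t)) (V_t (x, t)) (x, t)"
proof -
  let ?S = "UNIV \<times> {0<..} :: (real \<times> real) set"
  let ?G = "\<lambda>(w, p). momentum (fst w) (snd w) p a b"
  let ?H = "\<lambda>(w, p). - 1 / 2 * (momentum (fst w) (snd w) p a b)\<^sup>2 - U a b (fst w)"
  let ?P = "\<lambda>z. fst (opt z)"
  have open_S: "open ?S" by (simp add: open_Times)
  have "continuous_on (?S \<times> UNIV) (\<lambda>w. (fst (fst w), snd (fst w), snd w) :: real \<times> real \<times> real)"
    by (intro continuous_intros)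
  from continuous_on_compose2[OF continuous_on_V_explicit(2)[OF ab] this]
  have G: "continuous_on (?S \<times> UNIV) ?G" by (simp add: image_subset_iff case_prod_unfold)
  then have H: "continuous_on (?S \<times> UNIV) ?H"
    unfolding case_prod_unfold by (intro continuous_intros)
  have "has_grad (V_fun \<Phi> a b) (?G ((x, t), ?P (x, t))) (?H ((x, t), ?P (x, t))) (x, t)"
  proof (rule has_grad_envelope[where S = ?S and F = "\<lambda>p w. V_explicit (fst w) (snd w) p a b"])
    note opn = open_Times[OF open_S open_UNIV]
    show "isCont ?G ((x, t), ?P (x, t))"
      by (rule bspec[OF G[unfolded continuous_on_eq_continuous_at[OF opn]]]) (use t in simp)
    show "isCont ?H ((x, t), ?P (x, t))"
      by (rule bspec[OF H[unfolded continuous_on_eq_continuous_at[OF opn]]]) (use t in simp)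
    have "continuous_on ?S ?P" by (intro continuous_intros continuous_on_opt)
    then show "isCont ?P (x, t)" using t open_S by (auto simp: continuous_on_eq_continuous_at)
    fix w :: "real \<times> real" assume w: "w \<in> ?S"
    then obtain y s where ys: "w = (y, s)" "0 < s" by force
    show "has_grad (\<lambda>w. V_explicit (fst w) (snd w) p a b) (?G (w, p)) (?H (w, p)) w" for p
      using has_grad_V_explicit[OF ab ys(2), of p y] ys by simp
    show "V_fun \<Phi> a b (x, t) + V_explicit (fst w) (snd w) (?P (x, t)) a b
        - V_explicit (fst (x, t)) (snd (x, t)) (?P (x, t)) a b \<le> V_fun \<Phi> a b w"
      using payoff_le_V_fun[of s "opt (x, t)" y] opt_in_conj_epi[of t x] t ys
      by (simp add: V_fun_eq payoff_def)
    show "V_fun \<Phi> a b w \<le> V_fun \<Phi> a b (x, t) + V_explicit (fst w) (snd w) (?P w) a b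
        - V_explicit (fst (x, t)) (snd (x, t)) (?P w) a b"
      using payoff_le_V_fun[of t "opt (y, s)" x] opt_in_conj_epi[of s y] t ys
      by (simp add: V_fun_eq payoff_def)
  qed (use open_S t in auto)
  then show ?thesis by (simp add: V_x_def V_t_def)
qed

lemma C1_solution_V_fun: "C1_solution (U a b) \<Phi> (V_fun \<Phi> a b)"
  unfolding C1_solution_def
proof (intro conjI allI impI)
  show "C1_on (UNIV \<times> {0<..}) (V_fun \<Phi> a b)"
    by (rule C1_onI[OF continuous_on_V_x continuous_on_V_t]) (auto intro: has_grad_V_fun)
  show "HJ_op (U a b) (V_fun \<Phi> a b) x t = 0" if "t > 0" for x t
    using HJ_op_has_grad[OF has_grad_V_fun[OF that]] by (simp add: V_t_def)
qed (rule continuous_on_V_fun V_fun_initial)+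

lemma viscosity_solution_V_fun: "viscosity_solution (U a b) \<Phi> (V_fun \<Phi> a b)"
  unfolding viscosity_solution_def
proof (intro conjI allI)
  show "viscosity_subsolution (U a b) (V_fun \<Phi> a b)"
    by (rule viscosity_subsolutionI_classical[OF has_grad_V_fun]) (simp_all add: V_t_def)
  show "viscosity_supersolution (U a b) (V_fun \<Phi> a b)"
    by (rule viscosity_supersolutionI_classical[OF has_grad_V_fun]) (simp_all add: V_t_def)
qed (rule continuous_on_V_fun V_fun_initial)+

section \<open>Membership in the uniqueness class, and uniqueness\<close>

lemma V_fun_locally_lipschitz:
  assumes "\<rho> > 0"
  obtains L where "\<And>x y t. \<bar>x\<bar> \<le> \<rho> \<Longrightarrow> \<bar>y\<bar> \<le> \<rho> \<Longrightarrow> 0 \<le> t \<Longrightarrow> t \<le> \<rho> \<Longrightarrow>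
    \<bar>V_fun \<Phi> a b (x, t) - V_fun \<Phi> a b (y, t)\<bar> \<le> L * \<bar>x - y\<bar>"
proof -
  obtain \<Lambda> where \<Lambda>: "\<And>x t. \<bar>x\<bar> \<le> \<rho> \<Longrightarrow> 0 \<le> t \<Longrightarrow> t \<le> \<rho> \<Longrightarrow>
      \<bar>fst (opt (x, t))\<bar> \<le> \<Lambda> \<and> \<bar>snd (opt (x, t))\<bar> \<le> \<Lambda>"
    using opt_bounded[OF assms] by blast
  define L where "L = \<Lambda> + (a + b) * \<rho>"
  have le: "V_fun \<Phi> a b (x, t) - V_fun \<Phi> a b (y, t) \<le> L * \<bar>x - y\<bar>"
    if x: "\<bar>x\<bar> \<le> \<rho>" and t: "0 \<le> t" "t \<le> \<rho>" for x y t
  proof -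
    \<comment> \<open>The maximiser at \<open>x\<close> competes at \<open>y\<close> too, which
      reduces the estimate to the increment of one explicit solution. This covers t = 0 as
      well.\<close>
    let ?p = "fst (opt (x, t))"
    have "V_fun \<Phi> a b (x, t) - V_fun \<Phi> a b (y, t) \<le> V_explicit x t ?p a b - V_explicit y t ?p a b"
      using payoff_le_V_fun[OF t(1) opt_in_conj_epi[OF t(1)], of y x] V_fun_eq[OF t(1), of x]
      by (simp add: payoff_def)
    also have "\<dots> \<le> (\<bar>?p\<bar> + (a + b) * t) * \<bar>x - y\<bar>"
      using V_explicit_lipschitz[OF ab t(1), of x ?p y] by linarith
    also have "\<dots> \<le> L * \<bar>x - y\<bar>"
      unfolding L_def using \<Lambda>[OF x t] ab t by (intro mult_right_mono add_mono mult_left_mono) auto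
    finally show ?thesis .
  qed
  show thesis
  proof (rule that)
    fix x y t assume "\<bar>x\<bar> \<le> \<rho>" "\<bar>y\<bar> \<le> \<rho>" "0 \<le> t" "t \<le> \<rho>"
    then show "\<bar>V_fun \<Phi> a b (x, t) - V_fun \<Phi> a b (y, t)\<bar> \<le> L * \<bar>x - y\<bar>"
      using le[of x t y] le[of y t x] by (simp add: abs_le_iff abs_minus_commute)
  qed
qed

lemma V_fun_in_uniqueness_class: "V_fun \<Phi> a b \<in> uniqueness_class"
  unfolding uniqueness_class_def mem_Collect_eq
proof (intro conjI allI impI)
  show "norm_R R (V_fun \<Phi> a b) < \<infinity>" if R: "R > 0" for R
  proof -
    \<comment> \<open>The radius is R + 1 because the bound on subgradients looks at neighbours up
      to distance 1.\<close>
    obtain L where L: "\<And>x y t. \<bar>x\<bar> \<le> R + 1 \<Longrightarrow> \<bar>y\<bar> \<le> R + 1 \<Longrightarrow> 0 \<le> t \<Longrightarrow> t \<le> R + 1 \<Longrightarrow>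
        \<bar>V_fun \<Phi> a b (x, t) - V_fun \<Phi> a b (y, t)\<bar> \<le> L * \<bar>x - y\<bar>"
      using V_fun_locally_lipschitz[of "R + 1"] R by auto
    have "compact (V_fun \<Phi> a b ` (cball 0 R \<times> {0..R}))"
      by (intro compact_continuous_image compact_Times compact_cball compact_Icc
          continuous_on_subset[OF continuous_on_V_fun]) auto
    then have "bounded (V_fun \<Phi> a b ` (cball 0 R \<times> {0..R}))" by (rule compact_imp_bounded)
    then obtain A where "\<forall>v\<in>V_fun \<Phi> a b ` (cball 0 R \<times> {0..R}). norm v \<le> A"
      unfolding bounded_iff by blast
    then have A: "\<bar>V_fun \<Phi> a b z\<bar> \<le> A" if "z \<in> cball 0 R \<times> {0..R}" for z
      using that by force
    have "norm_R R (V_fun \<Phi> a b) \<le> ereal (A + L)"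
      unfolding norm_R_def
    proof (rule Sup_least, clarify)
      fix x t q assume x: "x \<in> cball 0 R" and t: "t \<in> {0..R}"
        and q: "q \<in> frechet_subdiff (\<lambda>y. V_fun \<Phi> a b (y, t)) x"
      have "\<bar>q\<bar> \<le> L"
      proof (rule frechet_subdiff_bounded[OF _ q])
        fix y assume "\<bar>y - x\<bar> \<le> 1"
        then show "\<bar>V_fun \<Phi> a b (y, t) - V_fun \<Phi> a b (x, t)\<bar> \<le> L * \<bar>y - x\<bar>"
          using x t by (intro L) auto
      qed
      then show "ereal (\<bar>V_fun \<Phi> a b (x, t)\<bar> + \<bar>q\<bar>) \<le> ereal (A + L)"
        using A[of "(x, t)"] x t by (simp add: add_mono)
    qed
    then show ?thesis by (rule order.strict_trans1) simp
  qed
  \<comment> \<open>The slope of any one admissible pair serves as \<alpha> for all T; only the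
    constant depends on T.\<close>
  obtain q0 where q0: "q0 \<in> conj_epi" using conj_epi_nonempty by blast
  show "\<exists>\<alpha>. \<forall>T>0. \<exists>C. \<forall>x. \<forall>t\<in>{0..T}. V_fun \<Phi> a b (x, t) - \<alpha> * x \<ge> C"
  proof (intro exI allI impI ballI)
    fix T x t :: real assume t: "t \<in> {0..T}"
    have "1 / 2 * (fst q0)\<^sup>2 * t \<le> 1 / 2 * (fst q0)\<^sup>2 * T"
      using t by (intro mult_left_mono) auto
    then show "V_fun \<Phi> a b (x, t) - fst q0 * x \<ge> - (1 / 2 * (fst q0)\<^sup>2 * T) - snd q0"
      using V_explicit_lower[OF ab, of t "fst q0" x] payoff_le_V_fun[OF _ q0, of t x] t
      by (simp add: payoff_def)
  qed
qed (rule continuous_on_V_fun)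

text \<open>
  Since \<open>V(\<cdot>, t)\<close> is convex, \<open>V_x\<close> can be large only in the outward direction, where it does not
  speed up propagation into bounded sets.
\<close>

lemma V_x_inward_bounded:
  assumes T: "T > 0"
  shows "\<exists>M\<ge>0. \<forall>x. \<forall>t\<in>{0<..T}. V_x (x, t) * x \<ge> - M * \<bar>x\<bar>"
proof -
  obtain \<Lambda> where \<Lambda>: "\<And>x t. \<bar>x\<bar> \<le> T \<Longrightarrow> 0 \<le> t \<Longrightarrow> t \<le> T \<Longrightarrow>
      \<bar>fst (opt (x, t))\<bar> \<le> \<Lambda> \<and> \<bar>snd (opt (x, t))\<bar> \<le> \<Lambda>"
    using opt_bounded[OF T] by blast
  have "V_x (x, t) * x \<ge> - (\<bar>\<Lambda>\<bar> + (a + b) * T) * \<bar>x\<bar>" if t: "0 < t" "t \<le> T" for x t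
  proof -
    \<comment> \<open>The maximiser at \<open>(x, t)\<close> need not stay bounded as x varies, but
      the one at \<open>(0, t)\<close> does. The chain goes from the slope at x to the increment of
      V by convexity and optimality at x, and from there to \<open>?r\<close> by optimality at
      0.\<close>
    let ?p = "fst (opt (x, t))" and ?r = "fst (opt (0, t))"
    have t0: "0 \<le> t" using t by simp
    have "V_explicit x t ?p a b - V_explicit 0 t ?p a b \<le> V_x (x, t) * x"
      using V_explicit_above_tangent[OF ab t(1), of x ?p 0] by (simp add: V_x_def)
    moreover have "V_fun \<Phi> a b (x, t) - V_fun \<Phi> a b (0, t)
        \<le> V_explicit x t ?p a b - V_explicit 0 t ?p a b"
      using payoff_le_V_fun[OF t0 opt_in_conj_epi[OF t0], of 0 x] V_fun_eq[OF t0, of x]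
      by (simp add: payoff_def)
    moreover have "V_explicit x t ?r a b - V_explicit 0 t ?r a b
        \<le> V_fun \<Phi> a b (x, t) - V_fun \<Phi> a b (0, t)"
      using payoff_le_V_fun[OF t0 opt_in_conj_epi[OF t0], of x 0] V_fun_eq[OF t0, of 0]
      by (simp add: payoff_def)
    moreover have "V_explicit x t ?r a b - V_explicit 0 t ?r a b \<ge> - (\<bar>\<Lambda>\<bar> + (a + b) * T) * \<bar>x\<bar>"
    proof -
      have "(\<bar>?r\<bar> + (a + b) * t) * \<bar>x - 0\<bar> \<le> (\<bar>\<Lambda>\<bar> + (a + b) * T) * \<bar>x - 0\<bar>"
        using \<Lambda>[of 0 t] t T ab by (intro mult_right_mono add_mono mult_left_mono) auto
      then show ?thesis
        using V_explicit_lipschitz[OF ab t0, of x ?r 0] unfolding diff_0_right mult_minus_left by linarith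
    qed
    ultimately show ?thesis by linarith
  qed
  moreover have "0 \<le> \<bar>\<Lambda>\<bar> + (a + b) * T" using ab T by simp
  ultimately show ?thesis by (intro exI[of _ "\<bar>\<Lambda>\<bar> + (a + b) * T"]) auto
qed

lemma viscosity_solution_unique:
  assumes W: "W \<in> uniqueness_class" "viscosity_solution (U a b) \<Phi> W" and t: "0 \<le> t"
  shows "W (x, t) = V_fun \<Phi> a b (x, t)"
proof (rule antisym)
  have contW: "continuous_on (UNIV \<times> {0..}) W" and sub: "viscosity_subsolution (U a b) W"
    and super: "viscosity_supersolution (U a b) W" and init: "\<And>x. W (x, 0) = \<Phi> x"
    using W(2) by (auto simp: viscosity_solution_def)
  obtain \<alpha> where \<alpha>: "\<And>T. T > 0 \<Longrightarrow> \<exists>C. \<forall>x. \<forall>t\<in>{0..T}. W (x, t) - \<alpha> * x \<ge> C"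
    using W(1) unfolding uniqueness_class_def by blast
  show "W (x, t) \<le> V_fun \<Phi> a b (x, t)"
    by (rule subsolution_le_classical_supersolution[OF contW sub continuous_on_V_fun
          continuous_on_V_x continuous_on_V_t has_grad_V_fun _ V_x_inward_bounded _ t])
       (simp_all add: V_t_def init V_fun_initial)
  \<comment> \<open>The pair is frozen at the target point: the resulting explicit solution equals V
    there and lies below \<Phi> at time 0.\<close>
  obtain p c where pc: "opt (x, t) = (p, c)" by force
  then have epi: "(p, c) \<in> conj_epi" using opt_in_conj_epi[OF t, of x] by simp
  let ?Z = "\<lambda>z. V_explicit (fst z) (snd z) p a b - c"
  let ?G = "\<lambda>z. momentum (fst z) (snd z) p a b"
  let ?H = "\<lambda>z. - 1 / 2 * (?G z)\<^sup>2 - U a b (fst z)"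
  have "?Z (x, t) \<le> W (x, t)"
  proof (rule supersolution_ge_classical_subsolution[OF contW super \<alpha>, where p = ?G and q = ?H])
    show "continuous_on (UNIV \<times> {0..}) ?Z"
      by (intro continuous_intros continuous_on_V_explicit_fixed_p[OF ab])
    show "continuous_on (UNIV \<times> {0<..}) ?G" "continuous_on (UNIV \<times> {0<..}) ?H"
      by (intro continuous_intros continuous_on_V_explicit_fixed_p[OF ab])+
    show "has_grad ?Z (?G (x, t)) (?H (x, t)) (x, t)" if "t > 0" for x t
      using has_grad_diff[OF has_grad_V_explicit[OF ab that] has_grad_of_t[OF DERIV_const]] by simp
    show "?H (x, t) + 1 / 2 * (?G (x, t))\<^sup>2 + U a b x \<le> 0" for x t by simp
    show "\<exists>M\<ge>0. \<forall>x. \<forall>t\<in>{0<..T}. \<bar>?G (x, t)\<bar> \<le> M" if T: "T > 0" for T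
    proof (intro exI conjI allI ballI)
      show "0 \<le> \<bar>p\<bar> + (a + b) * T" using ab T by simp
      fix x t assume t: "t \<in> {0<..T}"
      then have "(a + b) * t \<le> (a + b) * T" using ab by (intro mult_left_mono) auto
      then show "\<bar>?G (x, t)\<bar> \<le> \<bar>p\<bar> + (a + b) * T"
        using abs_momentum_le[OF ab, of t x p] t by simp
    qed
    show "\<exists>A M. \<forall>x. \<forall>t\<in>{0..T}. ?Z (x, t) \<le> A + M * \<bar>x\<bar>" if T: "T > 0" for T
    proof (intro exI allI ballI)
      fix x t assume t: "t \<in> {0..T}"
      have "p * x \<le> \<bar>p\<bar> * \<bar>x\<bar>" by (metis abs_ge_self abs_mult)
      moreover have "(a + b) * t * \<bar>x\<bar> \<le> (a + b) * T * \<bar>x\<bar>"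
        using ab t by (intro mult_right_mono mult_left_mono) auto
      ultimately show "?Z (x, t) \<le> - c + (\<bar>p\<bar> + (a + b) * T) * \<bar>x\<bar>"
        using V_explicit_upper[OF ab, of t x p] t by (simp add: distrib_right)
    qed
    show "?Z (x, 0) \<le> W (x, 0)" for x
    proof -
      have "p * x - \<Phi> x \<le> c" using epi by (simp add: conj_epi_def)
      then show ?thesis by (simp add: V_explicit_initial[OF ab] init)
    qed
  qed (use t in auto)
  then show "V_fun \<Phi> a b (x, t) \<le> W (x, t)"
    by (simp add: V_fun_eq[OF t] payoff_def pc)
qed

end

text \<open>The conversion from extended reals sends infinite values to 0, so finiteness of the
  supremum is a separate conjunct: it guarantees that \<open>V_fun\<close> is the actual
  supremum.\<close>

theorem proposition2p1:
  fixes \<Phi> :: "real \<Rightarrow> real" and a b :: real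
  assumes "convex_on UNIV \<Phi>" and "a > 0" and "b > 0"
  shows "(\<forall>x. \<forall>t\<ge>0. \<bar>V_sup \<Phi> a b x t\<bar> \<noteq> \<infinity>) \<and>
         C1_solution (U a b) \<Phi> (V_fun \<Phi> a b) \<and>
         (poly_lipschitz \<Phi> \<longrightarrow>
            V_fun \<Phi> a b \<in> uniqueness_class \<and>
            viscosity_solution (U a b) \<Phi> (V_fun \<Phi> a b) \<and>
            (\<forall>W \<in> uniqueness_class. viscosity_solution (U a b) \<Phi> W \<longrightarrow>
               (\<forall>x. \<forall>t\<ge>0. W (x, t) = V_fun \<Phi> a b (x, t))))"
proof -
  note h = assms(2,3,1)
  show ?thesis
    using V_sup_eq[OF h] C1_solution_V_fun[OF h] V_fun_in_uniqueness_class[OF h]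
      viscosity_solution_V_fun[OF h] viscosity_solution_unique[OF h] by simp
qed

end
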